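(* Let $G=(V,A)$ be a digraph consisting of two cycles. Let $k$ and $\ell$ denote the numbers of vertices of the two cycles, with $3\le k\le \ell$ and $\ell>3$. Suppose that the two cycles have no more than one common edge. Then the minimal number of edges that have to be added to $G$ (between existing vertices) to obtain a complete realisation of $G$, i.e. the minimum of $|A'|-|A|$ over all digraphs $G'=(V,A')$ with $A\subset A'$ such that $G\subset G'$ has a complete realisation, is $k-1$.
   Context: Digraphs. All digraphs $G=(V,A)$ are finite, with at most one edge $[v_j\to v_i]$ for each ordered pair of vertices. A $k$-cycle is a set of $k$ distinct vertices connected in a cyclic way by directed edges. A digraph consists of two cycles if it is the connected union of two different directed cycles and contains no other cycles. Then the two cycles share at least one vertex, and their common edges (if any) form a single uninterrupted directed path. Simplex method. Let $G'=(V,A')$ be a strongly connected digraph on $V=\{v_1,\dots,v_n\}$ without 1-cycles and 2-cycles. The simplex method associates with $G'$ the system on $\mathbb{R}^n$ $$\dot x_i = x_i\Big(1-|x|^2+\sum_{j=1}^n a_{ji}x_j^2\Big),\quad i=1,\dots,n,$$ with $a_{ii}=0$, and for $i\ne j$: $a_{ji}>0$ if $[v_j\to v_i]\in A'$ and $a_{ji}<0$ otherwise. The vertex $v_j$ corresponds to the equilibrium $\xi_j$, the unit vector on the positive $x_j$-axis; the eigenvalue of the linearisation at $\xi_j$ in the direction of $x_i$ ($i\neq j$) is $a_{ji}$ and the radial eigenvalue is $-2$. For each edge $[v_j\to v_i]\in A'$ there is a heteroclinic connection $[\xi_j\to\xi_i]$ (a non-empty intersection $W^u(\xi_j)\cap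 W^s(\xi_i)$) containing a trajectory in the $(x_j,x_i)$-coordinate plane. The system is equivariant under $\mathbb{Z}_2^n$ acting by reflections in the coordinate hyperplanes, and equilibria and connections are understood up to this symmetry (equivalently, one works in the closed orthant $x_i\ge 0$). The heteroclinic network $X$ realising $G'$ consists of the equilibria $\xi_j$ and the full sets of connections $W^u(\xi_j)\cap W^s(\xi_i)$. Completeness. A heteroclinic network is complete if it contains the unstable manifolds of all its equilibria, i.e. every trajectory in every $W^u(\xi_j)$ converges in forward time to one of the equilibria of the network. Complete realisation. For a strongly connected digraph $G=(V,A)$ without 1- and 2-cycles and a digraph $G'=(V,A')$ with the same vertex set, $A\subset A'$, and without 1- and 2-cycles, $G\subset G'$ has a complete realisation if the simplex method applied to $G'$ (with suitable coefficients of the prescribed signs) produces a complete heteroclinic network $X$; then $X$ is called a complete realisation of $G\subset G'$. The edges in $A'\setminus A$ are the added edges. *)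

theory Defs
  imports "Graph_Theory.Digraph_Component" "HOL-Analysis.Analysis"
begin

text \<open>
  A digraph with at most one edge per ordered pair of vertices is a pair digraph: the arc
  \<open>(j, i)\<close> is the edge \<open>[v\<^sub>j \<rightarrow> v\<^sub>i]\<close>. The index type \<open>'n\<close> of the coordinates of
  \<open>real ^ 'n\<close> serves as the vertex set.
\<close>

definition vertex_digraph :: "'n::finite pair_pre_digraph \<Rightarrow> bool" where
  "vertex_digraph G \<longleftrightarrow> pair_wf_digraph G \<and> pverts G = UNIV"

text \<open>
  A directed cycle is represented by its list of arcs. As the library's \<open>cycle\<close> does not repeat
  vertices, the length of this list is the number of vertices of the cycle. The list also
  records a starting point, so two lists describe the same cycle iff their arc sets agree.
\<close>

definition consists_of_two_cycles ::
  "'n pair_pre_digraph \<Rightarrow> ('n \<times> 'n) list \<Rightarrow> ('n \<times> 'n) list \<Rightarrow> bool" where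
  "consists_of_two_cycles G C D \<longleftrightarrow>
     pre_digraph.cycle (with_proj G) C \<and> pre_digraph.cycle (with_proj G) D \<and>
     set C \<noteq> set D \<and>
     pverts G = fst ` set C \<union> fst ` set D \<and>
     parcs G = set C \<union> set D \<and>
     Digraph_Component.connected (with_proj G) \<and>
     (\<forall>p. pre_digraph.cycle (with_proj G) p \<longrightarrow> set p = set C \<or> set p = set D)"

text \<open>The standing assumptions on a digraph to which the simplex method is applied.\<close>

definition simplex_digraph :: "'n::finite pair_pre_digraph \<Rightarrow> bool" where
  "simplex_digraph G \<longleftrightarrow>
     vertex_digraph G \<and> strongly_connected (with_proj G) \<and>
     (\<forall>p. pre_digraph.cycle (with_proj G) p \<longrightarrow> length p \<noteq> 1 \<and> length p \<noteq> 2)"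

text \<open>The coefficient \<open>a\<^sub>j\<^sub>i\<close> of the system is \<open>a j i\<close>.\<close>

definition simplex_coefficients ::
  "'n::finite pair_pre_digraph \<Rightarrow> ('n \<Rightarrow> 'n \<Rightarrow> real) \<Rightarrow> bool" where
  "simplex_coefficients G a \<longleftrightarrow>
     (\<forall>i. a i i = 0) \<and>
     (\<forall>i j. i \<noteq> j \<longrightarrow> (if (j, i) \<in> parcs G then a j i > 0 else a j i < 0))"

definition simplex_field ::
  "('n::finite \<Rightarrow> 'n \<Rightarrow> real) \<Rightarrow> real ^ 'n \<Rightarrow> real ^ 'n" where
  "simplex_field a x = (\<chi> i. x $ i * (1 - (norm x)\<^sup>2 + (\<Sum>j\<in>UNIV. a j i * (x $ j)\<^sup>2)))"

text \<open>
  For large coefficients solutions need not exist for all times; a point belongs to an unstable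
  (stable) manifold only if its solution exists for all negative (positive) times.
\<close>

definition unstable_manifold ::
  "('a::real_normed_vector \<Rightarrow> 'a) \<Rightarrow> 'a \<Rightarrow> 'a set" where
  "unstable_manifold f \<xi> =
     {x0. \<exists>x. x 0 = x0 \<and>
        (\<forall>t\<le>0. (x has_vector_derivative f (x t)) (at t within {..0::real})) \<and>
        (x \<longlongrightarrow> \<xi>) at_bot}"

definition stable_manifold ::
  "('a::real_normed_vector \<Rightarrow> 'a) \<Rightarrow> 'a \<Rightarrow> 'a set" where
  "stable_manifold f \<xi> =
     {x0. \<exists>x. x 0 = x0 \<and>
        (\<forall>t\<ge>0. (x has_vector_derivative f (x t)) (at t within {0::real..})) \<and>
        (x \<longlongrightarrow> \<xi>) at_top}"

text \<open>
  Equilibria and connections are taken up to the reflections in the coordinate hyperplanes,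
  so everything is restricted to the (flow-invariant) closed positive orthant.
\<close>

definition orthant :: "(real ^ 'n::finite) set" where
  "orthant = {x. \<forall>i. x $ i \<ge> 0}"

definition equilibrium :: "'n::finite \<Rightarrow> real ^ 'n" where
  "equilibrium j = axis j 1"

definition simplex_network ::
  "'n::finite pair_pre_digraph \<Rightarrow> ('n \<Rightarrow> 'n \<Rightarrow> real) \<Rightarrow> (real ^ 'n) set" where
  "simplex_network G a =
     range equilibrium \<union>
     (\<Union>(j, i)\<in>parcs G. unstable_manifold (simplex_field a) (equilibrium j) \<inter>
        stable_manifold (simplex_field a) (equilibrium i) \<inter> orthant)"

definition complete_simplex_network ::
  "'n::finite pair_pre_digraph \<Rightarrow> ('n \<Rightarrow> 'n \<Rightarrow> real) \<Rightarrow> bool" where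
  "complete_simplex_network G a \<longleftrightarrow>
     (\<forall>j. unstable_manifold (simplex_field a) (equilibrium j) \<inter> orthant \<subseteq> simplex_network G a)"

text \<open>\<open>has_complete_realisation G G'\<close>: the pair \<open>G \<subset> G'\<close> has a complete realisation.\<close>

definition has_complete_realisation ::
  "'n::finite pair_pre_digraph \<Rightarrow> 'n pair_pre_digraph \<Rightarrow> bool" where
  "has_complete_realisation G G' \<longleftrightarrow>
     simplex_digraph G \<and> simplex_digraph G' \<and> parcs G \<subseteq> parcs G' \<and>
     (\<exists>a. simplex_coefficients G' a \<and> complete_simplex_network G' a)"

end

theory Submission
  imports Defs
begin

text \<open>
  Completeness of the network of a digraph \<open>G'\<close> is governed by the out-neighbourhoods of \<open>G'\<close>.

  Necessity. If \<open>[v\<^sub>j \<rightarrow> v\<^sub>p]\<close> and \<open>[v\<^sub>j \<rightarrow> v\<^sub>q]\<close> are edges of a complete network, then \<open>v\<^sub>p\<close> and \<open>v\<^sub>q\<close>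
  are joined by an edge (\<open>complete_out_neighbours_adjacent\<close>). Otherwise \<open>\<xi>\<^sub>p\<close> and \<open>\<xi>\<^sub>q\<close> are both sinks in
  the invariant coordinate orthant of the directions \<open>j, p, q\<close>, so that their basins are disjoint and
  relatively open. A short segment near \<open>\<xi>\<^sub>j\<close> that leads from the \<open>(j, p)\<close>-plane to the
  \<open>(j, q)\<close>-plane cannot be covered by the two basins: each end misses one of them, because a zero
  coordinate stays zero, and the segment is connected. Trajectories that start in neither basin leave
  a fixed ball around \<open>\<xi>\<^sub>j\<close> after a time that grows without bound as the segments shrink to \<open>\<xi>\<^sub>j\<close>. A
  limit of their exit points lies in the unstable manifold of \<open>\<xi>\<^sub>j\<close> and still in neither basin
  (\<open>unstable_manifold_meets_closed_invariant_set\<close>), against completeness.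

  Lower bound. The two cycles \<open>c\<^sub>0 \<rightarrow> c\<^sub>1 \<rightarrow> \<dots> \<rightarrow> c\<^sub>k = c\<^sub>0\<close> and \<open>d\<^sub>0 \<rightarrow> d\<^sub>1 \<rightarrow> \<dots> \<rightarrow> d\<^sub>l = d\<^sub>0\<close> separate at
  \<open>c\<^sub>0 = d\<^sub>0\<close>, and they have at most one further vertex in common, the predecessor of \<open>c\<^sub>0\<close> on both
  (\<open>two_cycles_fork\<close>). As \<open>c\<^sub>1\<close> and \<open>d\<^sub>1\<close> are out-neighbours of \<open>c\<^sub>0\<close>, an edge joins them. An edge from
  \<open>c\<^sub>i\<close> to \<open>d\<^sub>j\<close> makes \<open>c\<^sub>i\<^sub>+\<^sub>1\<close> and \<open>d\<^sub>j\<close> out-neighbours of \<open>c\<^sub>i\<close>, hence adjacent; an edge from \<open>d\<^sub>j\<close> to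
  \<open>c\<^sub>i\<close> makes \<open>c\<^sub>i\<close> and \<open>d\<^sub>j\<^sub>+\<^sub>1\<close> adjacent. The pairs met form a staircase of \<open>i + j - 1\<close> adjacent pairs
  when it first has \<open>i = k - 1\<close> or \<open>j = l - 1\<close>. Only the last pair can be joined by an edge of a
  cycle already, and then \<open>i + j = k + l - 3\<close>, which still leaves \<open>k + l - 5\<close>, that is at least
  \<open>k - 1\<close>, new edges as \<open>l > 3\<close> (\<open>fork_added_arcs_lower_bound\<close>).

  Upper bound. Adding the \<open>k - 1\<close> edges \<open>[c\<^sub>i \<rightarrow> d\<^sub>1]\<close>, \<open>0 < i < k\<close>, makes every out-neighbourhood either
  a single vertex or a pair \<open>c\<^sub>i\<^sub>+\<^sub>1 \<rightarrow> d\<^sub>1\<close>. With all coefficients \<open>\<plusminus>1\<close> this suffices for completeness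
  (\<open>transitive_out_neighbourhoods_complete\<close>): the coefficients are antisymmetric in the directions
  in which an unstable manifold extends, which therefore lies on the unit sphere, and there the
  squares of the coordinates are explicit rational functions of \<open>exp (2 t)\<close>.
\<close>


section \<open>Solutions of autonomous differential equations\<close>

text \<open>
  The multiplicative form of Gronwall's inequality: \<open>\<phi> t * exp (- c * t)\<close> is nonincreasing.
\<close>

lemma exp_growth_bound:
  fixes \<phi> \<phi>' :: "real \<Rightarrow> real"
  assumes "a \<le> b"
    and der: "\<And>t. t \<in> {a..b} \<Longrightarrow> (\<phi> has_real_derivative \<phi>' t) (at t within {a..b})"
    and le: "\<And>t. t \<in> {a..b} \<Longrightarrow> \<phi>' t \<le> c * \<phi> t"
  shows "\<phi> b \<le> \<phi> a * exp (c * (b - a))"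
proof -
  let ?\<psi> = "\<lambda>t. \<phi> t * exp (- c * t)"
  have "?\<psi> b - ?\<psi> a \<le> 0"
  proof (cases "a = b")
    case False
    with \<open>a \<le> b\<close> have "a < b" by simp
    have d: "(?\<psi> has_real_derivative (\<phi>' t - c * \<phi> t) * exp (- c * t)) (at t within {a..b})"
      if "t \<in> {a..b}" for t
      by (rule derivative_eq_intros der[OF that] refl | simp add: algebra_simps)+
    have cont: "continuous_on {a..b} ?\<psi>"
      unfolding continuous_on_eq_continuous_within using DERIV_continuous[OF d] by blast
    have d': "(?\<psi> has_real_derivative (\<phi>' t - c * \<phi> t) * exp (- c * t)) (at t)" if "a < t" "t < b" for t
      using d[of t] that at_within_Icc_at[of a t b] by simp
    have "?\<psi> b \<le> ?\<psi> a"
      by (rule DERIV_nonpos_imp_decreasing_open[OF less_imp_le[OF \<open>a < b\<close>] _ cont])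
        (use d' le in \<open>force simp: mult_nonpos_nonneg\<close>)
    then show ?thesis by simp
  qed simp
  then have "\<phi> b * exp (- c * b) * exp (c * b) \<le> \<phi> a * exp (- c * a) * exp (c * b)"
    by (intro mult_right_mono) auto
  then show ?thesis
    by (simp add: mult.assoc flip: exp_add) (simp add: algebra_simps)
qed

definition solution :: "('a::real_normed_vector \<Rightarrow> 'a) \<Rightarrow> (real \<Rightarrow> 'a) \<Rightarrow> real set \<Rightarrow> bool" where
  "solution f x S \<longleftrightarrow> (\<forall>t\<in>S. (x has_vector_derivative f (x t)) (at t within S))"

lemma solution_subset: "solution f x S \<Longrightarrow> T \<subseteq> S \<Longrightarrow> solution f x T"
  unfolding solution_def by (meson has_vector_derivative_within_subset subsetD)

lemma solution_continuous_on: "solution f x S \<Longrightarrow> continuous_on S x"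
  unfolding solution_def continuous_on_eq_continuous_within
  by (auto intro: has_vector_derivative_continuous)

lemma solution_cong: "solution f x S \<Longrightarrow> (\<And>t. t \<in> S \<Longrightarrow> f (x t) = g (x t)) \<Longrightarrow> solution g x S"
  unfolding solution_def by auto

lemma solution_comp_affine:
  assumes "solution f x S" and "\<And>t. t \<in> T \<Longrightarrow> a + c * t \<in> S"
  shows "solution (\<lambda>z. c *\<^sub>R f z) (\<lambda>t. x (a + c * t)) T"
  unfolding solution_def
proof
  fix t assume t: "t \<in> T"
  have "((\<lambda>t. a + c * t) has_vector_derivative c) (at t within T)"
    by (auto intro!: derivative_eq_intros)
  moreover have "(x has_vector_derivative f (x (a + c * t))) (at (a + c * t) within (\<lambda>t. a + c * t) ` T)"
    using assms t unfolding solution_def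
    by (meson has_vector_derivative_within_subset image_subsetI)
  ultimately show "((\<lambda>t. x (a + c * t)) has_vector_derivative c *\<^sub>R f (x (a + c * t))) (at t within T)"
    using vector_diff_chain_within[of "\<lambda>t. a + c * t" c t T x "f (x (a + c * t))"]
    by (simp add: o_def)
qed

lemma has_real_derivative_inner_self:
  fixes u :: "real \<Rightarrow> 'a::real_inner"
  assumes "(u has_vector_derivative u') (at t within S)"
  shows "((\<lambda>t. u t \<bullet> u t) has_real_derivative 2 * (u t \<bullet> u')) (at t within S)"
proof -
  have "((\<lambda>t. u t \<bullet> u t) has_derivative (\<lambda>h. u t \<bullet> (h *\<^sub>R u') + (h *\<^sub>R u') \<bullet> u t)) (at t within S)"
    using assms unfolding has_vector_derivative_def by (intro has_derivative_inner)
  then show ?thesis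
    unfolding has_field_derivative_def by (rule has_derivative_eq_rhs) (auto simp: inner_commute)
qed

text \<open>
  The squared distance \<open>\<phi>\<close> of two solutions satisfies \<open>\<phi>' \<le> 2 * L * \<phi>\<close> by the Cauchy--Schwarz
  inequality. The Lipschitz bound is needed only on a set that contains both solutions.
\<close>

lemma gronwall_solutions:
  fixes f :: "'a::real_inner \<Rightarrow> 'a"
  assumes lip: "L-lipschitz_on S f"
    and x: "solution f x {0..T}" and y: "solution f y {0..T}"
    and "\<And>t. t \<in> {0..T} \<Longrightarrow> x t \<in> S" and "\<And>t. t \<in> {0..T} \<Longrightarrow> y t \<in> S"
    and t: "t \<in> {0..T}"
  shows "dist (x t) (y t) \<le> dist (x 0) (y 0) * exp (L * t)"
proof -
  let ?d = "\<lambda>t. (x t - y t) \<bullet> (x t - y t)"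
  have "?d t \<le> ?d 0 * exp (2 * L * (t - 0))"
  proof (rule exp_growth_bound)
    show "0 \<le> t" using t by simp
    fix s assume s: "s \<in> {0..t}"
    then have sT: "s \<in> {0..T}" and sub: "{0..t} \<subseteq> {0..T}" using t by auto
    have "(x has_vector_derivative f (x s)) (at s within {0..t})"
      "(y has_vector_derivative f (y s)) (at s within {0..t})"
      using solution_subset[OF x sub] solution_subset[OF y sub] s unfolding solution_def by auto
    then have "((\<lambda>t. x t - y t) has_vector_derivative f (x s) - f (y s)) (at s within {0..t})"
      by (rule has_vector_derivative_diff)
    then show "(?d has_real_derivative 2 * ((x s - y s) \<bullet> (f (x s) - f (y s)))) (at s within {0..t})"
      by (rule has_real_derivative_inner_self)
    have "(x s - y s) \<bullet> (f (x s) - f (y s)) \<le> norm (x s - y s) * norm (f (x s) - f (y s))"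
      by (rule norm_cauchy_schwarz)
    also have "\<dots> \<le> norm (x s - y s) * (L * norm (x s - y s))"
      using lipschitz_on_normD[OF lip] assms(4,5) sT by (intro mult_left_mono) auto
    finally show "2 * ((x s - y s) \<bullet> (f (x s) - f (y s))) \<le> 2 * L * ?d s"
      by (simp add: dot_square_norm power2_eq_square algebra_simps)
  qed
  then have "(dist (x t) (y t))\<^sup>2 \<le> (dist (x 0) (y 0) * exp (L * t))\<^sup>2"
    by (simp add: dist_norm power_mult_distrib dot_square_norm algebra_simps flip: exp_double)
  then show ?thesis
    by (rule power2_le_imp_le) simp
qed

text \<open>
  Picard iteration with Bielecki's weight: for \<open>x t = x0 + exp (2 * M * t) *\<^sub>R u t\<close> the integral equation
  becomes a fixed point equation for the bounded continuous function \<open>u\<close>, and because of the weight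
  the map is a contraction by \<open>1/2\<close> on the whole half-line at once, so that no continuation of local
  solutions is necessary.
\<close>

lemma global_solution_exists:
  fixes F :: "'a::euclidean_space \<Rightarrow> 'a"
  assumes lip: "L-lipschitz_on UNIV F"
  shows "\<exists>x. x 0 = x0 \<and> solution F x {0..}"
proof -
  \<comment> \<open>A Lipschitz constant that is positive, so that it can serve as the rate of the weight.\<close>
  define M where "M = L + 1"
  have M: "M > 0" using lipschitz_on_nonneg[OF lip] by (simp add: M_def)
  have lipM: "norm (F u - F v) \<le> M * norm (u - v)" for u v
    using lipschitz_on_normD[OF lip, of u v] by (simp add: M_def distrib_right) (metis add_increasing2 norm_ge_zero order.refl)
  have contF: "continuous_on UNIV F" using lipschitz_on_continuous_on[OF lip] .
  \<comment> \<open>The iterates are functions on the whole line that are constant for \<open>t \<le> 0\<close>.\<close>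
  define \<sigma> where "\<sigma> t = max 0 t" for t :: real
  define X where "X u t = x0 + exp (2 * M * t) *\<^sub>R u t" for u :: "real \<Rightarrow> 'a" and t
  define P where "P u t = exp (- 2 * M * \<sigma> t) *\<^sub>R integral {0..\<sigma> t} (\<lambda>s. F (X u s))"
    for u :: "real \<Rightarrow> 'a" and t
  have contX: "continuous_on {0..b} (\<lambda>s. F (X u s))" if "continuous_on UNIV u" for u b
    unfolding X_def
    by (intro continuous_on_compose2[OF contF] continuous_intros continuous_on_subset[OF that]) auto
  have intexp: "((\<lambda>s. exp (2 * M * s)) has_integral (exp (2 * M * t) - 1) / (2 * M)) {0..t}"
    if "t \<ge> 0" for t
    using fundamental_theorem_of_calculus[OF that, of "\<lambda>s. exp (2 * M * s) / (2 * M)" "\<lambda>s. exp (2 * M * s)"] M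
    by (simp add: has_real_derivative_iff_has_vector_derivative[symmetric] diff_divide_distrib)
       (use M in \<open>force intro!: derivative_eq_intros\<close>)
  have \<sigma>0: "\<sigma> t \<ge> 0" for t by (simp add: \<sigma>_def)
  have small: "exp (- 2 * M * \<sigma> t) * ((exp (2 * M * \<sigma> t) - 1) / (2 * M) * c) \<le> c / (2 * M)"
    if "c \<ge> 0" for t c
  proof -
    have "exp (- 2 * M * \<sigma> t) * (exp (2 * M * \<sigma> t) - 1) \<le> 1"
      by (simp add: right_diff_distrib flip: exp_add)
    then have "exp (- 2 * M * \<sigma> t) * (exp (2 * M * \<sigma> t) - 1) * (c / (2 * M)) \<le> 1 * (c / (2 * M))"
      using M that by (intro mult_right_mono) auto
    then show ?thesis by (simp add: mult.assoc)
  qed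
  have contP: "continuous_on UNIV (P u)" if u: "continuous_on UNIV u" for u
  proof -
    have "isCont (P u) t" for t
    proof -
      define b where "b = \<bar>t\<bar> + 1"
      have "continuous_on {0..b} (\<lambda>t. integral {0..t} (\<lambda>s. F (X u s)))"
        by (intro indefinite_integral_continuous_1 integrable_continuous_interval contX u)
      moreover have "continuous_on {-b<..<b} \<sigma>" "\<sigma> ` {-b<..<b} \<subseteq> {0..b}"
        unfolding \<sigma>_def by (auto intro!: continuous_intros)
      ultimately have "continuous_on {-b<..<b} (\<lambda>t. integral {0..\<sigma> t} (\<lambda>s. F (X u s)))"
        by (rule continuous_on_compose2)
      then have "continuous_on {-b<..<b} (P u)"
        unfolding P_def \<sigma>_def by (intro continuous_intros)
      then show ?thesis
        by (rule continuous_on_interior) (auto simp: b_def)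
    qed
    then show ?thesis by (simp add: continuous_at_imp_continuous_on)
  qed
  have Pdiff: "norm (P u t - P v t) \<le> c / 2"
    if u: "continuous_on UNIV u" and v: "continuous_on UNIV v" and uv: "\<And>s. norm (u s - v s) \<le> c"
    for u v c t
  proof -
    have c: "c \<ge> 0" using uv[of 0] norm_ge_zero order_trans by blast
    have "norm (integral {0..\<sigma> t} (\<lambda>s. F (X u s)) - integral {0..\<sigma> t} (\<lambda>s. F (X v s)))
        = norm (integral {0..\<sigma> t} (\<lambda>s. F (X u s) - F (X v s)))"
      by (subst integral_diff) (auto intro!: integrable_continuous_interval contX u v)
    also have "\<dots> \<le> integral {0..\<sigma> t} (\<lambda>s. exp (2 * M * s) * (M * c))"
    proof (rule integral_norm_bound_integral)
      show "(\<lambda>s. F (X u s) - F (X v s)) integrable_on {0..\<sigma> t}"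
        by (intro integrable_continuous_interval continuous_intros contX u v)
      show "(\<lambda>s. exp (2 * M * s) * (M * c)) integrable_on {0..\<sigma> t}"
        by (intro integrable_continuous_interval continuous_intros)
      fix s
      have "norm (F (X u s) - F (X v s)) \<le> M * norm (X u s - X v s)" by (rule lipM)
      also have "norm (X u s - X v s) = exp (2 * M * s) * norm (u s - v s)"
        by (simp add: X_def flip: scaleR_diff_right)
      also have "M * \<dots> \<le> M * (exp (2 * M * s) * c)"
        using M uv[of s] by (intro mult_left_mono) auto
      finally show "norm (F (X u s) - F (X v s)) \<le> exp (2 * M * s) * (M * c)" by (simp add: algebra_simps)
    qed
    also have "\<dots> = (exp (2 * M * \<sigma> t) - 1) / (2 * M) * (M * c)"
      using has_integral_mult_left[OF intexp[OF \<sigma>0[of t]], of "M * c"] by (rule integral_unique)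
    finally have *: "norm (integral {0..\<sigma> t} (\<lambda>s. F (X u s)) - integral {0..\<sigma> t} (\<lambda>s. F (X v s)))
      \<le> (exp (2 * M * \<sigma> t) - 1) / (2 * M) * (M * c)" .
    have "norm (P u t - P v t) \<le> exp (- 2 * M * \<sigma> t) * ((exp (2 * M * \<sigma> t) - 1) / (2 * M) * (M * c))"
      using * by (simp add: P_def flip: scaleR_diff_right)
    also have "\<dots> \<le> M * c / (2 * M)" using small c M by (intro small) auto
    finally show ?thesis using M by simp
  qed
  have bP0: "norm (P (\<lambda>_. 0) t) \<le> norm (F x0) / (2 * M)" for t
  proof -
    have "norm (P (\<lambda>_. 0) t) = exp (- 2 * M * \<sigma> t) * (\<sigma> t * norm (F x0))"
      using \<sigma>0[of t] by (simp add: P_def X_def)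
    also have "\<dots> \<le> exp (- 2 * M * \<sigma> t) * ((exp (2 * M * \<sigma> t) - 1) / (2 * M) * norm (F x0))"
    proof (intro mult_left_mono mult_right_mono)
      show "\<sigma> t \<le> (exp (2 * M * \<sigma> t) - 1) / (2 * M)"
        using exp_ge_add_one_self[of "2 * M * \<sigma> t"] M by (simp add: field_simps)
    qed auto
    also have "\<dots> \<le> norm (F x0) / (2 * M)" by (rule small) simp
    finally show ?thesis .
  qed
  have bP: "P u \<in> bcontfun" if u: "u \<in> bcontfun" for u
  proof -
    from u have cu: "continuous_on UNIV u" by (simp add: bcontfun_def)
    from u obtain B where B: "\<And>s. norm (u s) \<le> B" by (auto simp: bcontfun_def bounded_iff)
    have "norm (P u t) \<le> norm (F x0) / (2 * M) + B / 2" for t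
    proof -
      have "norm (P u t) \<le> norm (P (\<lambda>_. 0) t) + norm (P u t - P (\<lambda>_. 0) t)"
        by (metis add.commute diff_add_cancel norm_triangle_ineq)
      also have "\<dots> \<le> norm (F x0) / (2 * M) + B / 2"
        using bP0 Pdiff[OF cu continuous_on_const, of 0 B] B by (intro add_mono) auto
      finally show ?thesis .
    qed
    then show ?thesis using contP[OF cu] by (auto simp: bcontfun_def bounded_iff)
  qed
  define \<Phi> where "\<Phi> u = Bcontfun (P (apply_bcontfun u))" for u :: "real \<Rightarrow>\<^sub>C 'a"
  have \<Phi>: "apply_bcontfun (\<Phi> u) = P (apply_bcontfun u)" for u
    unfolding \<Phi>_def by (rule Bcontfun_inverse[OF bP[OF apply_bcontfun]])
  have "\<exists>!u. \<Phi> u = u"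
  proof (rule banach_fix_type[of "1/2"])
    show "\<forall>u v. dist (\<Phi> u) (\<Phi> v) \<le> 1 / 2 * dist u v"
    proof (intro allI dist_bound)
      fix u v t
      show "dist (\<Phi> u t) (\<Phi> v t) \<le> 1 / 2 * dist u v"
        using Pdiff[of "apply_bcontfun u" "apply_bcontfun v" "dist u v" t]
        by (simp add: \<Phi> dist_norm[symmetric] dist_bounded)
    qed
  qed auto
  then obtain u where "\<Phi> u = u" by auto
  then have u: "apply_bcontfun u t = P u t" for t using \<Phi>[of u] by simp
  define x where "x = X u"
  have x: "x t = x0 + integral {0..t} (\<lambda>s. F (x s))" if "t \<ge> 0" for t
    using that unfolding x_def by (subst X_def, subst u) (simp add: P_def \<sigma>_def flip: exp_add)
  have "solution F x {0..}"
    unfolding solution_def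
  proof
    fix t :: real assume "t \<in> {0..}"
    then have t: "t \<in> {0..t+1}" "t \<ge> 0" by auto
    have "((\<lambda>t. integral {0..t} (\<lambda>s. F (x s))) has_vector_derivative F (x t)) (at t within {0..t+1})"
      unfolding x_def by (rule integral_has_vector_derivative[OF contX t(1)]) auto
    then have "((\<lambda>t. x0 + integral {0..t} (\<lambda>s. F (x s))) has_vector_derivative F (x t)) (at t within {0..t+1})"
      by (auto intro!: derivative_eq_intros)
    then have "(x has_vector_derivative F (x t)) (at t within {0..t+1})"
      using x t by (auto intro: has_vector_derivative_transform)
    moreover have "at t within {0..t+1} = at t within {0..}"
      by (rule at_within_nhd[of t "{..<t+1}"]) auto
    ultimately show "(x has_vector_derivative F (x t)) (at t within {0..})" by simp
  qed
  moreover have "x 0 = x0" using x[of 0] by simp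
  ultimately show ?thesis by blast
qed


text \<open>
  Two solutions on a compact interval stay in a common ball, on which the field is Lipschitz.
\<close>

lemma solution_unique:
  fixes f :: "'a::real_inner \<Rightarrow> 'a"
  assumes lip: "\<And>R. \<exists>L. L-lipschitz_on (cball 0 R) f"
    and x: "solution f x {0..T}" and y: "solution f y {0..T}" and "x 0 = y 0" and t: "t \<in> {0..T}"
  shows "x t = y t"
proof -
  have "bounded (x ` {0..T} \<union> y ` {0..T})"
    by (intro bounded_Un[THEN iffD2] conjI compact_imp_bounded compact_continuous_image
        solution_continuous_on[OF x] solution_continuous_on[OF y] compact_Icc)
  then obtain R where R: "\<And>z. z \<in> x ` {0..T} \<union> y ` {0..T} \<Longrightarrow> norm z \<le> R"
    unfolding bounded_iff by blast
  obtain L where "L-lipschitz_on (cball 0 R) f" using lip by blast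
  then have "dist (x t) (y t) \<le> dist (x 0) (y 0) * exp (L * t)"
    by (rule gronwall_solutions[OF _ x y]) (use R t in auto)
  then show ?thesis using \<open>x 0 = y 0\<close> by simp
qed

section \<open>Stable manifolds\<close>

lemma stable_manifold_iff:
  "x0 \<in> stable_manifold f \<xi> \<longleftrightarrow> (\<exists>x. x 0 = x0 \<and> solution f x {0..} \<and> (x \<longlongrightarrow> \<xi>) at_top)"
  unfolding stable_manifold_def solution_def by auto

lemma unstable_manifold_iff:
  "x0 \<in> unstable_manifold f \<xi> \<longleftrightarrow> (\<exists>x. x 0 = x0 \<and> solution f x {..0} \<and> (x \<longlongrightarrow> \<xi>) at_bot)"
  unfolding unstable_manifold_def solution_def by auto

lemma solution_concat:
  assumes "0 \<le> T" and x: "solution f x {0..T}" and y: "solution f y {0..}" and "y 0 = x T"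
  shows "solution f (\<lambda>t. if t \<in> {0..T} then x t else y (t - T)) {0..}"
  unfolding solution_def
proof
  fix t :: real assume t: "t \<in> {0..}"
  have y': "solution f (\<lambda>t. y (t - T)) {T..}"
    using solution_comp_affine[OF y, of "{T..}" "- T" 1] by simp
  have inter: "closure {0..T} \<inter> closure {T..} = {T}" using \<open>0 \<le> T\<close> by auto
  have "((\<lambda>t. if t \<in> {0..T} then x t else y (t - T)) has_vector_derivative
      (if t \<in> {0..T} then f (x t) else f (y (t - T)))) (at t within {0..})"
  proof (rule has_vector_derivative_If_within_closures[where T = "{T..}"])
    show "t \<in> {0..T} \<union> {T..}" "{0..} = {0..T} \<union> {T..}" using t \<open>0 \<le> T\<close> by auto
    have S: "{0..T} \<union> closure {0..T} \<inter> closure {T..} = {0..T}"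
      "{T..} \<union> closure {0..T} \<inter> closure {T..} = {T..}"
      using inter \<open>0 \<le> T\<close> by auto
    show "(x has_vector_derivative f (x t)) (at t within {0..T} \<union> closure {0..T} \<inter> closure {T..})"
      if "t \<in> {0..T} \<union> closure {0..T} \<inter> closure {T..}"
      using x that unfolding S solution_def by blast
    show "((\<lambda>t. y (t - T)) has_vector_derivative f (y (t - T)))
        (at t within {T..} \<union> closure {0..T} \<inter> closure {T..})"
      if "t \<in> {T..} \<union> closure {0..T} \<inter> closure {T..}"
      using y' that unfolding S solution_def by blast
    assume "t \<in> closure {0..T}" "t \<in> closure {T..}"
    then have "t = T" using inter by blast
    then show "x t = y (t - T)" "f (x t) = f (y (t - T))" using assms by auto
  qed
  then show "((\<lambda>t. if t \<in> {0..T} then x t else y (t - T)) has_vector_derivative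
      f (if t \<in> {0..T} then x t else y (t - T))) (at t within {0..})"
    by (simp add: if_distrib[of f])
qed

lemma stable_manifold_backward_invariant:
  assumes "0 \<le> T" "solution f x {0..T}" "x T \<in> stable_manifold f \<xi>"
  shows "x 0 \<in> stable_manifold f \<xi>"
proof -
  from assms(3) obtain y where y: "y 0 = x T" "solution f y {0..}" "(y \<longlongrightarrow> \<xi>) at_top"
    unfolding stable_manifold_iff by auto
  define z where "z t = (if t \<in> {0..T} then x t else y (t - T))" for t
  have "solution f z {0..}"
    unfolding z_def by (rule solution_concat[OF assms(1,2) y(2,1)])
  moreover have "(z \<longlongrightarrow> \<xi>) at_top"
  proof (rule Lim_transform_eventually)
    have "filterlim (\<lambda>t. - T + t) at_top at_top"
      by (rule filterlim_tendsto_add_at_top[OF tendsto_const filterlim_ident])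
    then show "((\<lambda>t. y (- T + t)) \<longlongrightarrow> \<xi>) at_top"
      by (rule filterlim_compose[OF y(3)])
    show "\<forall>\<^sub>F t in at_top. y (- T + t) = z t"
      using eventually_gt_at_top[of T] by eventually_elim (auto simp: z_def)
  qed
  moreover have "z 0 = x 0" using assms(1) by (simp add: z_def)
  ultimately show ?thesis unfolding stable_manifold_iff by blast
qed

lemma first_hitting_time:
  fixes d :: "real \<Rightarrow> real"
  assumes cont: "continuous_on {a..b} d" and "a \<le> b" "d a < r" "r \<le> d b"
  obtains t where "t \<in> {a..b}" "d t = r" "\<And>s. s \<in> {a..t} \<Longrightarrow> d s \<le> r"
proof -
  define K where "K = {t \<in> {a..b}. d t = r}"
  have "\<exists>t\<ge>a. t \<le> b \<and> d t = r"
    using assms by (intro IVT') auto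
  then have "K \<noteq> {}" by (auto simp: K_def)
  moreover have "closed K"
  proof -
    have "K = {a..b} \<inter> d -` {r}" by (auto simp: K_def)
    then show ?thesis
      using continuous_closed_preimage[OF cont closed_atLeastAtMost closed_singleton] by simp
  qed
  then have "compact K"
    unfolding compact_eq_bounded_closed by (auto simp: K_def intro: bounded_subset[of "{a..b}"])
  ultimately obtain t where t: "t \<in> K" and least: "\<And>s. s \<in> K \<Longrightarrow> t \<le> s"
    using compact_attains_inf[of K] by blast
  have "d s \<le> r" if s: "s \<in> {a..t}" for s
  proof (rule ccontr)
    assume "\<not> d s \<le> r"
    moreover have "s \<le> b" using s t by (auto simp: K_def)
    ultimately have "\<exists>u\<ge>a. u \<le> s \<and> d u = r"
      using assms(3) s by (intro IVT' continuous_on_subset[OF cont]) auto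
    then obtain u where "u \<in> K" "u \<le> s" using \<open>s \<le> b\<close> by (auto simp: K_def)
    with least[of u] s have "s = t" by auto
    with t \<open>\<not> d s \<le> r\<close> show False by (simp add: K_def)
  qed
  with t show ?thesis by (intro that[of t]) (auto simp: K_def)
qed

text \<open>
  Precomposition with the nearest-point projection onto a ball turns a locally Lipschitz field into a
  globally Lipschitz one without changing it on the ball. Solutions of the new field exist for all
  times, and as long as they remain in the ball they are solutions of the original one.
\<close>

lemma clamped_field_exists:
  fixes f :: "'a::euclidean_space \<Rightarrow> 'a"
  assumes lip: "L-lipschitz_on (cball 0 R) f" and "0 \<le> R"
  obtains F where "L-lipschitz_on UNIV F" "\<And>z. norm z \<le> R \<Longrightarrow> F z = f z"
proof
  have ne: "cball (0::'a) R \<noteq> {}" using \<open>0 \<le> R\<close> by auto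
  show "L-lipschitz_on UNIV (\<lambda>z. f (closest_point (cball 0 R) z))"
  proof (rule lipschitz_onI)
    show "0 \<le> L" using lipschitz_on_nonneg[OF lip] .
    fix u v :: 'a
    have "dist (f (closest_point (cball 0 R) u)) (f (closest_point (cball 0 R) v))
        \<le> L * dist (closest_point (cball 0 R) u) (closest_point (cball 0 R) v)"
      by (rule lipschitz_onD[OF lip]) (rule closest_point_in_set[OF closed_cball ne])+
    also have "\<dots> \<le> L * dist u v"
      using \<open>0 \<le> L\<close> closest_point_lipschitz[OF convex_cball closed_cball ne]
      by (intro mult_left_mono) auto
    finally show "dist (f (closest_point (cball 0 R) u)) (f (closest_point (cball 0 R) v)) \<le> L * dist u v" .
  qed
qed (simp add: closest_point_self)

lemma filterlim_minus_const_at_top: "filterlim (\<lambda>t::real. t - T) at_top at_top"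
  using filterlim_tendsto_add_at_top[OF tendsto_const filterlim_ident, of "- T"] by simp

lemma dist_square_derivative:
  fixes x :: "real \<Rightarrow> 'a::real_inner"
  assumes "(x has_vector_derivative v) (at t within S)"
  shows "((\<lambda>t. (dist (x t) \<xi>)\<^sup>2) has_real_derivative 2 * ((x t - \<xi>) \<bullet> v)) (at t within S)"
proof -
  have "((\<lambda>t. x t - \<xi>) has_vector_derivative v) (at t within S)"
    using has_vector_derivative_diff[OF assms has_vector_derivative_const[of \<xi>]] by simp
  from has_real_derivative_inner_self[OF this] show ?thesis
    by (simp add: dist_norm power2_norm_eq_inner)
qed

lemma tendsto_of_dist_square_le:
  fixes x :: "'b \<Rightarrow> 'a::metric_space"
  assumes "\<forall>\<^sub>F t in F. (dist (x t) \<xi>)\<^sup>2 \<le> g t" and "(g \<longlongrightarrow> 0) F"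
  shows "(x \<longlongrightarrow> \<xi>) F"
proof -
  have "((\<lambda>t. (dist (x t) \<xi>)\<^sup>2) \<longlongrightarrow> 0) F"
    by (rule tendsto_sandwich[OF _ assms(1) tendsto_const assms(2)]) simp
  then have "((\<lambda>t. dist (x t) \<xi>) \<longlongrightarrow> 0) F"
    using tendsto_real_sqrt[of "\<lambda>t. (dist (x t) \<xi>)\<^sup>2" 0] by simp
  then show ?thesis by (simp add: tendsto_dist_iff[of x \<xi>])
qed

text \<open>
  Near \<open>\<xi>\<close> the squared distance to \<open>\<xi>\<close> decays exponentially along trajectories in \<open>H\<close>. A trajectory
  that converges to \<open>\<xi>\<close> enters this neighbourhood in finite time, and by continuous dependence so do
  the trajectories of all nearby points, without escaping to infinity before.
\<close>

lemma stable_manifold_locally_open: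
  fixes f :: "'a::euclidean_space \<Rightarrow> 'a"
  assumes lip: "\<And>R. \<exists>L. L-lipschitz_on (cball 0 R) f"
    and "0 < r" "0 < c"
    and attr: "\<And>z. z \<in> H \<Longrightarrow> dist z \<xi> \<le> r \<Longrightarrow> (z - \<xi>) \<bullet> f z \<le> - c * (dist z \<xi>)\<^sup>2"
    and inv: "\<And>x T. 0 \<le> T \<Longrightarrow> solution f x {0..T} \<Longrightarrow> x 0 \<in> H \<Longrightarrow> x T \<in> H"
    and x0: "x0 \<in> stable_manifold f \<xi>"
  shows "\<exists>e>0. \<forall>y0\<in>H. dist y0 x0 < e \<longrightarrow> y0 \<in> stable_manifold f \<xi>"
proof -
  from x0 obtain x where x: "x 0 = x0" "solution f x {0..}" "(x \<longlongrightarrow> \<xi>) at_top"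
    unfolding stable_manifold_iff by auto
  have "\<forall>\<^sub>F t in at_top. dist (x t) \<xi> < r / 2"
    using tendstoD[OF x(3), of "r / 2"] \<open>0 < r\<close> by simp
  then obtain T0 where T0: "\<And>t. t \<ge> T0 \<Longrightarrow> dist (x t) \<xi> < r / 2"
    by (auto simp: eventually_at_top_linorder)
  define T where "T = max 0 T0"
  have T: "0 \<le> T" "dist (x T) \<xi> < r / 2" using T0 by (auto simp: T_def)
  have "compact (x ` {0..T})"
    by (rule compact_continuous_image[OF solution_continuous_on[OF solution_subset[OF x(2)]]]) auto
  then have "bounded (x ` {0..T})" by (rule compact_imp_bounded)
  then obtain B where B: "\<And>t. t \<in> {0..T} \<Longrightarrow> norm (x t) \<le> B"
    unfolding bounded_iff by blast
  have B0: "0 \<le> B" using order_trans[OF norm_ge_zero B[of 0]] T(1) by simp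
  define R where "R = B + norm \<xi> + r + 1"
  have R: "0 \<le> R" using B0 \<open>0 < r\<close> by (simp add: R_def)
  obtain L where L: "L-lipschitz_on (cball 0 R) f" using lip by blast
  then obtain F where F: "L-lipschitz_on UNIV F" "\<And>z. norm z \<le> R \<Longrightarrow> F z = f z"
    using clamped_field_exists[OF L R] by blast
  have L0: "0 \<le> L" using lipschitz_on_nonneg[OF L] .
  \<comment> \<open>Points closer than \<open>e\<close> separate by less than \<open>min 1 (r / 2)\<close> up to time \<open>T\<close>, which keeps the
    new solution in the ball of radius \<open>R\<close> and brings it to within \<open>r\<close> of \<open>\<xi>\<close> at time \<open>T\<close>.\<close>
  define e where "e = min 1 (r / 2) * exp (- L * T)"
  have "e > 0" using \<open>0 < r\<close> by (simp add: e_def)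
  moreover have "y0 \<in> stable_manifold f \<xi>" if y0: "y0 \<in> H" "dist y0 x0 < e" for y0
  proof -
    obtain y where y: "y 0 = y0" "solution F y {0..}"
      using global_solution_exists[OF F(1)] by blast
    have xF: "solution F x {0..T}"
    proof (rule solution_cong[OF solution_subset[OF x(2)]])
      fix t assume "t \<in> {0..T}"
      then have "norm (x t) \<le> B" using B[of t] by simp
      then have "norm (x t) \<le> R" using \<open>0 < r\<close> norm_ge_zero[of \<xi>] unfolding R_def by linarith
      then show "f (x t) = F (x t)" using F(2) by simp
    qed auto
    have near: "dist (x t) (y t) < min 1 (r / 2)" if t: "t \<in> {0..T}" for t
    proof -
      have "dist (x t) (y t) \<le> dist (x 0) (y 0) * exp (L * t)"
        by (rule gronwall_solutions[OF F(1) xF solution_subset[OF y(2)] _ _ t]) auto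
      also have "\<dots> \<le> dist y0 x0 * exp (L * T)"
        using t mult_left_mono[OF _ L0, of t T] by (intro mult_mono) (auto simp: x(1) y(1) dist_commute)
      also have "\<dots> < e * exp (L * T)" using y0 by simp
      also have "\<dots> = min 1 (r / 2)" by (simp add: e_def mult.assoc flip: exp_add)
      finally show ?thesis .
    qed
    have small1: "norm (y t) \<le> R" if t: "t \<in> {0..T}" for t
      using B[OF t] near[OF t] norm_triangle_sub[of "y t" "x t"] \<open>0 < r\<close> norm_ge_zero[of \<xi>]
      unfolding R_def dist_norm norm_minus_commute[of "y t"] by linarith
    have small2: "norm (y t) \<le> R" if "dist (y t) \<xi> \<le> r" for t
      using that norm_triangle_sub[of "y t" \<xi>] B0 unfolding R_def dist_norm by linarith
    have yT: "dist (y T) \<xi> < r"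
      using T near[of T] dist_triangle[of "y T" \<xi> "x T"] by (simp add: dist_commute)
    have yf: "solution f y {0..t}" if "\<And>s. s \<in> {T..t} \<Longrightarrow> dist (y s) \<xi> \<le> r" for t
    proof (rule solution_cong[OF solution_subset[OF y(2)]])
      fix s assume s: "s \<in> {0..t}"
      have "norm (y s) \<le> R"
        using small1[of s] small2[of s] that[of s] s by (cases "s \<le> T") auto
      then show "F (y s) = f (y s)" by (rule F(2))
    qed auto
    have decay: "(dist (y t) \<xi>)\<^sup>2 \<le> (dist (y T) \<xi>)\<^sup>2 * exp (- 2 * c * (t - T))"
      if "T \<le> t" and stay: "\<And>s. s \<in> {T..t} \<Longrightarrow> dist (y s) \<xi> \<le> r" for t
    proof (rule exp_growth_bound[OF \<open>T \<le> t\<close>])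
      fix s assume s: "s \<in> {T..t}"
      have ys: "solution f y {T..t}" using yf[OF stay] by (rule solution_subset) (use T in auto)
      then have "(y has_vector_derivative f (y s)) (at s within {T..t})"
        using s by (simp add: solution_def)
      from dist_square_derivative[OF this, of \<xi>]
      show "((\<lambda>t. (dist (y t) \<xi>)\<^sup>2) has_real_derivative 2 * ((y s - \<xi>) \<bullet> f (y s))) (at s within {T..t})" .
      have "y s \<in> H"
        using s T y0 y(1) by (intro inv[of s y] solution_subset[OF yf[OF stay]]) auto
      then show "2 * ((y s - \<xi>) \<bullet> f (y s)) \<le> - 2 * c * (dist (y s) \<xi>)\<^sup>2"
        using attr[of "y s"] stay[OF s] by simp
    qed
    have stay: "dist (y t) \<xi> \<le> r" if "T \<le> t" for t
    proof (rule ccontr)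
      assume "\<not> dist (y t) \<xi> \<le> r"
      moreover have "continuous_on {T..t} (\<lambda>t. dist (y t) \<xi>)"
        by (intro continuous_intros continuous_on_subset[OF solution_continuous_on[OF y(2)]]) (use T in auto)
      ultimately obtain u where u: "u \<in> {T..t}" "dist (y u) \<xi> = r"
        "\<And>s. s \<in> {T..u} \<Longrightarrow> dist (y s) \<xi> \<le> r"
        using first_hitting_time[of T t "\<lambda>t. dist (y t) \<xi>" r] \<open>T \<le> t\<close> yT by auto
      have "(dist (y u) \<xi>)\<^sup>2 \<le> (dist (y T) \<xi>)\<^sup>2 * exp (- 2 * c * (u - T))"
        using u by (intro decay) auto
      also have "\<dots> \<le> (dist (y T) \<xi>)\<^sup>2 * 1"
        using u(1) \<open>0 < c\<close> by (intro mult_left_mono) auto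
      also have "\<dots> < r\<^sup>2" using yT by (simp add: power_strict_mono)
      finally show False using u(2) by simp
    qed
    have "solution f y {0..}"
    proof (rule solution_cong[OF y(2)])
      fix s :: real assume "s \<in> {0..}"
      then have "norm (y s) \<le> R" using small1[of s] small2[of s] stay[of s] by (cases "s \<le> T") auto
      then show "F (y s) = f (y s)" by (rule F(2))
    qed
    moreover have "(y \<longlongrightarrow> \<xi>) at_top"
    proof -
      have "((\<lambda>t. (dist (y T) \<xi>)\<^sup>2 * exp (- 2 * c * (t - T))) \<longlongrightarrow> (dist (y T) \<xi>)\<^sup>2 * 0) at_top"
      proof (intro tendsto_mult tendsto_const filterlim_compose[OF exp_at_bot])
        show "filterlim (\<lambda>t. - 2 * c * (t - T)) at_bot at_top"
          using \<open>0 < c\<close>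
          by (intro filterlim_tendsto_neg_mult_at_bot[OF tendsto_const] filterlim_minus_const_at_top) auto
      qed
      then have lim0: "((\<lambda>t. (dist (y T) \<xi>)\<^sup>2 * exp (- 2 * c * (t - T))) \<longlongrightarrow> 0) at_top"
        by simp
      show ?thesis
        by (rule tendsto_of_dist_square_le[OF _ lim0])
           (use decay stay in \<open>auto intro!: eventually_at_top_linorderI[of T]\<close>)
    qed
    ultimately show ?thesis using y(1) unfolding stable_manifold_iff by blast
  qed
  ultimately show ?thesis by blast
qed


section \<open>The simplex field\<close>

lemma lipschitz_on_mult_compact:
  fixes f g :: "'a::metric_space \<Rightarrow> real"
  assumes "compact S" and f: "\<exists>L. L-lipschitz_on S f" and g: "\<exists>M. M-lipschitz_on S g"
  shows "\<exists>K. K-lipschitz_on S (\<lambda>x. f x * g x)"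
proof -
  from f g obtain L M where L: "L-lipschitz_on S f" and M: "M-lipschitz_on S g" by blast
  have "bounded (f ` S)" "bounded (g ` S)"
    using L M \<open>compact S\<close>
    by (auto intro!: compact_imp_bounded compact_continuous_image lipschitz_on_continuous_on)
  then obtain A B where A: "\<And>x. x \<in> S \<Longrightarrow> \<bar>f x\<bar> \<le> A" and B: "\<And>x. x \<in> S \<Longrightarrow> \<bar>g x\<bar> \<le> B"
    unfolding bounded_iff real_norm_def by blast
  have "(\<bar>A\<bar> * M + L * \<bar>B\<bar>)-lipschitz_on S (\<lambda>x. f x * g x)"
  proof (rule lipschitz_onI)
    show "0 \<le> \<bar>A\<bar> * M + L * \<bar>B\<bar>"
      using lipschitz_on_nonneg[OF L] lipschitz_on_nonneg[OF M] by simp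
    fix x y assume xy: "x \<in> S" "y \<in> S"
    have "f x * g x - f y * g y = f x * (g x - g y) + (f x - f y) * g y"
      by (simp add: algebra_simps)
    then have "\<bar>f x * g x - f y * g y\<bar> \<le> \<bar>f x\<bar> * \<bar>g x - g y\<bar> + \<bar>f x - f y\<bar> * \<bar>g y\<bar>"
      by (metis abs_mult abs_triangle_ineq)
    also have "\<dots> \<le> \<bar>A\<bar> * (M * dist x y) + (L * dist x y) * \<bar>B\<bar>"
      using lipschitz_onD[OF L xy] lipschitz_onD[OF M xy] A[OF xy(1)] B[OF xy(2)]
        lipschitz_on_nonneg[OF L] lipschitz_on_nonneg[OF M]
      by (intro add_mono mult_mono) (auto simp: dist_real_def)
    finally show "dist (f x * g x) (f y * g y) \<le> (\<bar>A\<bar> * M + L * \<bar>B\<bar>) * dist x y"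
      by (simp add: dist_real_def algebra_simps)
  qed
  then show ?thesis ..
qed

lemma lipschitz_on_sum_finite:
  fixes f :: "'i \<Rightarrow> 'a::metric_space \<Rightarrow> 'b::real_normed_vector"
  assumes "finite J" "\<And>j. j \<in> J \<Longrightarrow> \<exists>L. L-lipschitz_on S (f j)"
  shows "\<exists>L. L-lipschitz_on S (\<lambda>x. \<Sum>j\<in>J. f j x)"
  using assms
proof (induction J rule: finite_induct)
  case empty
  show ?case using lipschitz_on_constant[of S 0] by auto
next
  case (insert j J)
  then obtain L M where "L-lipschitz_on S (f j)" "M-lipschitz_on S (\<lambda>x. \<Sum>j\<in>J. f j x)" by blast
  from lipschitz_on_add[OF this] show ?case using insert.hyps by auto
qed

text \<open>
  The field has Kolmogorov form: each coordinate evolves by \<open>x\<^sub>i' = x\<^sub>i * simplex_rate a i x\<close>. At the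
  equilibrium \<open>\<xi>\<^sub>j\<close> the rate of a coordinate \<open>i \<noteq> j\<close> is the eigenvalue \<open>a\<^sub>j\<^sub>i\<close>.
\<close>

definition simplex_rate :: "('n::finite \<Rightarrow> 'n \<Rightarrow> real) \<Rightarrow> 'n \<Rightarrow> real ^ 'n \<Rightarrow> real" where
  "simplex_rate a i x = 1 - (norm x)\<^sup>2 + (\<Sum>j\<in>UNIV. a j i * (x $ j)\<^sup>2)"

lemma simplex_field_nth: "simplex_field a x $ i = x $ i * simplex_rate a i x"
  by (simp add: simplex_field_def simplex_rate_def)

lemma norm_square_sum: "(norm (x::real^'n::finite))\<^sup>2 = (\<Sum>j\<in>UNIV. (x $ j)\<^sup>2)"
  unfolding norm_vec_def L2_set_def by (simp add: sum_nonneg)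

lemma simplex_rate_eq: "simplex_rate a i x = 1 - (\<Sum>j\<in>UNIV. (1 - a j i) * (x $ j)\<^sup>2)"
  by (simp add: simplex_rate_def norm_square_sum left_diff_distrib sum_subtractf)

lemma simplex_rate_axis: "simplex_rate a i (axis j 1) = a j i"
proof -
  have "(\<Sum>k\<in>UNIV. (1 - a k i) * (axis j (1::real) $ k)\<^sup>2)
      = (\<Sum>k\<in>UNIV. if k = j then 1 - a k i else 0)"
    by (rule sum.cong) (auto simp: axis_def)
  then show ?thesis by (simp add: simplex_rate_eq)
qed

lemma continuous_on_simplex_rate [continuous_intros]:
  "continuous_on S f \<Longrightarrow> continuous_on S (\<lambda>t. simplex_rate a i (f t))"
  unfolding simplex_rate_def by (intro continuous_intros)

lemma simplex_field_lipschitz_on_cball: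
  fixes a :: "'n::finite \<Rightarrow> 'n \<Rightarrow> real"
  shows "\<exists>L. L-lipschitz_on (cball 0 R) (simplex_field a)"
proof -
  let ?S = "cball (0::real^'n) R"
  have coord: "\<exists>L. L-lipschitz_on ?S (\<lambda>x. x $ i)" for i :: 'n
    using bounded_linear.lipschitz_boundE[OF bounded_linear_vec_nth[of i], of ?S] by metis
  have const: "\<exists>L. L-lipschitz_on ?S (\<lambda>_. c)" for c :: real
    using lipschitz_on_constant by blast
  have sums: "\<exists>L. L-lipschitz_on ?S (\<lambda>x. \<Sum>j\<in>UNIV. (1 - a j i) * (x $ j)\<^sup>2)" for i
    unfolding power2_eq_square
    by (intro lipschitz_on_sum_finite lipschitz_on_mult_compact compact_cball coord const finite)
  have "\<exists>L. L-lipschitz_on ?S (\<lambda>x. simplex_rate a i x)" for i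
  proof -
    obtain L where "L-lipschitz_on ?S (\<lambda>x. \<Sum>j\<in>UNIV. (1 - a j i) * (x $ j)\<^sup>2)"
      using sums by blast
    from lipschitz_on_diff[OF lipschitz_on_constant[of ?S "1::real"] this]
    show ?thesis unfolding simplex_rate_eq by blast
  qed
  then have "\<exists>L. L-lipschitz_on ?S (\<lambda>x. simplex_field a x $ i)" for i :: 'n
    unfolding simplex_field_nth by (intro lipschitz_on_mult_compact compact_cball coord)
  then obtain L where L: "\<And>i. (L i)-lipschitz_on ?S (\<lambda>x. simplex_field a x $ i)" by metis
  have "(\<Sum>i\<in>UNIV. L i)-lipschitz_on ?S (simplex_field a)"
  proof (rule lipschitz_onI)
    show "0 \<le> (\<Sum>i\<in>UNIV. L i)" using lipschitz_on_nonneg[OF L] by (simp add: sum_nonneg)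
    fix x y assume xy: "x \<in> ?S" "y \<in> ?S"
    have "dist (simplex_field a x) (simplex_field a y)
        \<le> (\<Sum>i\<in>UNIV. \<bar>(simplex_field a x - simplex_field a y) $ i\<bar>)"
      unfolding dist_norm by (rule norm_le_l1_cart)
    also have "\<dots> \<le> (\<Sum>i\<in>UNIV. L i * dist x y)"
      using lipschitz_onD[OF L xy] by (intro sum_mono) (simp add: dist_real_def)
    finally show "dist (simplex_field a x) (simplex_field a y) \<le> (\<Sum>i\<in>UNIV. L i) * dist x y"
      by (simp add: sum_distrib_right)
  qed
  then show ?thesis ..
qed

lemma stable_manifolds_disjoint:
  assumes "z \<in> stable_manifold (simplex_field a) \<xi>" "z \<in> stable_manifold (simplex_field a) \<zeta>"
  shows "\<xi> = \<zeta>"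
proof -
  from assms obtain x y where x: "x 0 = z" "solution (simplex_field a) x {0..}" "(x \<longlongrightarrow> \<xi>) at_top"
    and y: "y 0 = z" "solution (simplex_field a) y {0..}" "(y \<longlongrightarrow> \<zeta>) at_top"
    unfolding stable_manifold_iff by blast
  have "x t = y t" if "0 \<le> t" for t
    by (rule solution_unique[OF simplex_field_lipschitz_on_cball, of a x t y])
       (use x y that in \<open>auto intro: solution_subset\<close>)
  then have "\<forall>\<^sub>F t in at_top. x t = y t" by (intro eventually_at_top_linorderI[of 0]) auto
  from Lim_transform_eventually[OF x(3) this] show ?thesis
    using tendsto_unique[OF trivial_limit_at_top_linorder _ y(3)] by blast
qed

lemma solution_component_derivative:
  assumes "solution (simplex_field a) x S" "t \<in> S"
  shows "((\<lambda>t. x t $ i) has_real_derivative x t $ i * simplex_rate a i (x t)) (at t within S)"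
proof -
  have "(x has_vector_derivative simplex_field a (x t)) (at t within S)"
    using assms by (auto simp: solution_def)
  from bounded_linear.has_vector_derivative[OF bounded_linear_vec_nth[of i] this]
  show ?thesis
    by (simp add: has_real_derivative_iff_has_vector_derivative simplex_field_nth)
qed

lemma solution_square_derivative:
  assumes "solution (simplex_field a) x S" "t \<in> S"
  shows "((\<lambda>t. (x t $ i)\<^sup>2) has_real_derivative 2 * simplex_rate a i (x t) * (x t $ i)\<^sup>2) (at t within S)"
  using DERIV_power[OF solution_component_derivative[OF assms, of i], of 2]
  by (simp add: power2_eq_square mult_ac)

text \<open>
  A coordinate is multiplied by the exponential of its integrated rate. Hence the sign of every
  coordinate, and whether it vanishes, do not change along a solution.
\<close>

lemma solution_component_multiplier:
  assumes x: "solution (simplex_field A) x {a..b}" and "a \<le> b"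
  shows "\<exists>m>0. x b $ i = m * x a $ i"
proof -
  define g where "g t = simplex_rate A i (x t)" for t
  define B where "B t = integral {a..t} g" for t
  have cont: "continuous_on {a..b} g"
    unfolding g_def by (intro continuous_intros solution_continuous_on[OF x])
  have dB: "(B has_real_derivative g t) (at t within {a..b})" if "t \<in> {a..b}" for t
    unfolding B_def by (rule integral_has_real_derivative[OF cont that])
  have "\<exists>c. \<forall>t\<in>{a..b}. x t $ i * exp (- B t) = c"
  proof (rule has_field_derivative_zero_constant)
    fix t assume t: "t \<in> {a..b}"
    show "((\<lambda>t. x t $ i * exp (- B t)) has_field_derivative 0) (at t within {a..b})"
      by (rule derivative_eq_intros solution_component_derivative[OF x t] dB[OF t] refl
          | simp add: g_def)+
  qed simp
  then have "x b $ i * exp (- B b) = x a $ i * exp (- B a)" using \<open>a \<le> b\<close> by auto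
  moreover have "B a = 0" by (simp add: B_def)
  ultimately have "x b $ i = exp (B b) * x a $ i" by (simp add: exp_minus field_simps)
  then show ?thesis by (intro exI[of _ "exp (B b)"]) auto
qed

definition face :: "'n::finite set \<Rightarrow> (real ^ 'n) set" where
  "face S = {x. (\<forall>i. 0 \<le> x $ i) \<and> (\<forall>i. i \<notin> S \<longrightarrow> x $ i = 0)}"

lemma solution_face_iff:
  assumes "solution (simplex_field A) x {a..b}" and "a \<le> b"
  shows "x b \<in> face S \<longleftrightarrow> x a \<in> face S"
proof -
  have "(0 \<le> x b $ i \<longleftrightarrow> 0 \<le> x a $ i) \<and> (x b $ i = 0 \<longleftrightarrow> x a $ i = 0)" for i
  proof -
    obtain m where "m > 0" "x b $ i = m * x a $ i"
      using solution_component_multiplier[OF assms] by blast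
    then show ?thesis by (auto simp: zero_le_mult_iff)
  qed
  then show ?thesis by (simp add: face_def)
qed

lemma closed_face: "closed (face S)"
  unfolding face_def
  by (intro closed_Collect_conj closed_Collect_all closed_Collect_imp closed_Collect_le
      closed_Collect_eq continuous_intros) auto

definition transversal :: "'n::finite \<Rightarrow> real ^ 'n \<Rightarrow> real" where
  "transversal j x = (\<Sum>i\<in>- {j}. (x $ i)\<^sup>2)"

lemma transversal_nonneg: "0 \<le> transversal j x"
  unfolding transversal_def by (simp add: sum_nonneg)

lemma norm_square_transversal: "(norm x)\<^sup>2 = (x $ j)\<^sup>2 + transversal j x"
  unfolding norm_square_sum transversal_def
  by (subst sum.remove[of UNIV j]) (auto simp: Compl_eq_Diff_UNIV)

lemma dist_equilibrium: "(dist x (equilibrium j))\<^sup>2 = (x $ j - 1)\<^sup>2 + transversal j x"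
  unfolding dist_norm norm_square_transversal[of _ j] transversal_def equilibrium_def
  by (auto simp: axis_def intro!: sum.cong)

lemma continuous_on_transversal [continuous_intros]:
  "continuous_on S f \<Longrightarrow> continuous_on S (\<lambda>t. transversal j (f t))"
  unfolding transversal_def by (intro continuous_intros)

text \<open>
  The left-hand side is half the derivative of \<open>(x\<^sub>j - 1)\<^sup>2\<close> along solutions. Up to a term quadratic in the
  other coordinates, the rate of \<open>x\<^sub>j\<close> is \<open>1 - x\<^sub>j\<^sup>2\<close>, and \<open>x\<^sub>j * (1 + x\<^sub>j) \<ge> 1\<close> for \<open>x\<^sub>j \<ge> 3/4\<close>.
\<close>

lemma radial_rate_bound:
  assumes "a j j = 0" and u: "\<bar>x $ j - 1\<bar> \<le> 1/4" and A: "\<And>i. \<bar>1 - a i j\<bar> \<le> A"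
  shows "(x $ j - 1) * (x $ j * simplex_rate a j x)
    \<le> - (x $ j - 1)\<^sup>2 + 2 * A * \<bar>x $ j - 1\<bar> * transversal j x"
proof -
  define y where "y = x $ j"
  define W where "W = (\<Sum>i\<in>- {j}. (1 - a i j) * (x $ i)\<^sup>2)"
  have y: "3/4 \<le> y" "y \<le> 5/4" using u by (auto simp: y_def abs_if split: if_splits)
  have "simplex_rate a j x = 1 - y\<^sup>2 - W"
    unfolding simplex_rate_eq W_def y_def
    by (subst sum.remove[of UNIV j]) (auto simp: \<open>a j j = 0\<close> Compl_eq_Diff_UNIV)
  then have eq: "(y - 1) * (y * simplex_rate a j x) = - ((y - 1)\<^sup>2 * (y * (1 + y))) - (y - 1) * y * W"
    by (simp only:) (simp add: power2_eq_square algebra_simps)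
  have "1 \<le> 3/4 * (1 + 3/4::real)" by simp
  also have "\<dots> \<le> y * (1 + y)" using y by (intro mult_mono) auto
  finally have "(y - 1)\<^sup>2 * 1 \<le> (y - 1)\<^sup>2 * (y * (1 + y))" by (intro mult_left_mono) auto
  moreover have "\<bar>W\<bar> \<le> A * transversal j x"
    unfolding W_def transversal_def sum_distrib_left
    by (rule order_trans[OF sum_abs]) (auto simp: abs_mult intro!: sum_mono mult_right_mono A)
  then have "\<bar>(y - 1) * y * W\<bar> \<le> \<bar>y - 1\<bar> * 2 * (A * transversal j x)"
    unfolding abs_mult using y by (intro mult_mono) auto
  then have "- ((y - 1) * y * W) \<le> 2 * A * \<bar>y - 1\<bar> * transversal j x"
    by (simp add: mult_ac)
  ultimately show ?thesis using eq unfolding y_def by linarith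
qed

lemma inner_field_equilibrium:
  "(x - equilibrium j) \<bullet> simplex_field a x
    = (x $ j - 1) * (x $ j * simplex_rate a j x) + (\<Sum>i\<in>- {j}. simplex_rate a i x * (x $ i)\<^sup>2)"
  unfolding inner_vec_def equilibrium_def simplex_field_nth
  by (subst sum.remove[of UNIV j])
     (auto simp: axis_def power2_eq_square Compl_eq_Diff_UNIV mult_ac intro!: sum.cong)

lemma rates_near_equilibrium:
  assumes "0 < c"
  shows "\<exists>r>0. \<forall>x. dist x (equilibrium j) \<le> r \<longrightarrow> (\<forall>i. \<bar>simplex_rate a i x - a j i\<bar> < c)"
proof -
  have "\<forall>\<^sub>F x in nhds (equilibrium j). \<bar>simplex_rate a i x - a j i\<bar> < c" for i
  proof -
    have "isCont (simplex_rate a i) (equilibrium j)"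
      using continuous_on_simplex_rate[OF continuous_on_id, of UNIV a i]
      by (simp add: continuous_on_eq_continuous_at)
    then have "(simplex_rate a i \<longlongrightarrow> a j i) (nhds (equilibrium j))"
      unfolding isCont_def tendsto_at_iff_tendsto_nhds by (simp add: equilibrium_def simplex_rate_axis)
    from tendstoD[OF this \<open>0 < c\<close>] show ?thesis by (simp add: dist_real_def)
  qed
  then have "\<forall>\<^sub>F x in nhds (equilibrium j). \<forall>i. \<bar>simplex_rate a i x - a j i\<bar> < c"
    by (simp add: eventually_all_finite)
  then obtain d where d: "d > 0" "\<And>x. dist x (equilibrium j) < d \<Longrightarrow> \<forall>i. \<bar>simplex_rate a i x - a j i\<bar> < c"
    unfolding eventually_nhds_metric by blast
  then show ?thesis by (intro exI[of _ "d / 2"]) auto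
qed

text \<open>
  The linearisation at \<open>\<xi>\<^sub>p\<close> is diagonal, with eigenvalue \<open>- 2\<close> in the radial direction and \<open>a\<^sub>p\<^sub>i\<close> in the
  direction \<open>i \<noteq> p\<close>. All of these are negative on the face, so that the Euclidean distance to \<open>\<xi>\<^sub>p\<close> is
  itself a Lyapunov function.
\<close>

lemma sink_attracts:
  assumes "a p p = 0" and neg: "\<And>i. i \<in> S \<Longrightarrow> i \<noteq> p \<Longrightarrow> a p i < 0"
  shows "\<exists>r>0. \<exists>c>0. \<forall>x\<in>face S. dist x (equilibrium p) \<le> r \<longrightarrow>
    (x - equilibrium p) \<bullet> simplex_field a x \<le> - c * (dist x (equilibrium p))\<^sup>2"
proof -
  define m where "m = Min (insert 1 ((\<lambda>i. - a p i) ` (S - {p})))"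
  define c where "c = m / 2"
  have "0 < m" using neg by (auto simp: m_def)
  moreover have "m \<le> 1" unfolding m_def by (rule Min_le) auto
  ultimately have c: "0 < c" and c1: "c \<le> 1" by (auto simp: c_def)
  have ca: "a p i \<le> - 2 * c" if "i \<in> S" "i \<noteq> p" for i
  proof -
    have "m \<le> - a p i"
      unfolding m_def by (rule Min_le) (use that in auto)
    then show ?thesis by (simp add: c_def)
  qed
  define A where "A = (\<Sum>i\<in>UNIV. \<bar>1 - a i p\<bar>)"
  have A: "\<bar>1 - a i p\<bar> \<le> A" for i unfolding A_def by (rule member_le_sum) auto
  have A0: "0 \<le> A" using A[of p] by linarith
  obtain r0 where r0: "r0 > 0"
    "\<And>x i. dist x (equilibrium p) \<le> r0 \<Longrightarrow> \<bar>simplex_rate a i x - a p i\<bar> < c / 2"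
    using rates_near_equilibrium[of "c / 2" p a] c by auto
  \<comment> \<open>The last bound makes the mixed term of \<open>radial_rate_bound\<close> at most \<open>c / 2\<close> times the
    transversal part, a third of the decay available there.\<close>
  define r where "r = min r0 (min (1/4) (c / (4 * A + 1)))"
  have r: "r > 0" using r0 c A0 by (simp add: r_def)
  have "(x - equilibrium p) \<bullet> simplex_field a x \<le> - c * (dist x (equilibrium p))\<^sup>2"
    if x: "x \<in> face S" "dist x (equilibrium p) \<le> r" for x
  proof -
    have "(x $ p - 1)\<^sup>2 \<le> (dist x (equilibrium p))\<^sup>2"
      unfolding dist_equilibrium using transversal_nonneg[of p x] by simp
    then have u: "\<bar>x $ p - 1\<bar> \<le> r"
      using x(2) by (metis abs_le_square_iff abs_of_nonneg order_trans zero_le_dist)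
    have "(\<Sum>i\<in>- {p}. simplex_rate a i x * (x $ i)\<^sup>2) \<le> (\<Sum>i\<in>- {p}. - (3/2) * c * (x $ i)\<^sup>2)"
    proof (rule sum_mono)
      fix i assume i: "i \<in> - {p}"
      show "simplex_rate a i x * (x $ i)\<^sup>2 \<le> - (3/2) * c * (x $ i)\<^sup>2"
      proof (cases "i \<in> S")
        case True
        have "simplex_rate a i x \<le> - (3/2) * c"
          using r0(2)[of x i] ca[OF True] x(2) i by (auto simp: r_def abs_if split: if_splits)
        then show ?thesis by (intro mult_right_mono) auto
      qed (use x(1) in \<open>simp add: face_def\<close>)
    qed
    then have tr: "(\<Sum>i\<in>- {p}. simplex_rate a i x * (x $ i)\<^sup>2) \<le> - (3/2) * c * transversal p x"
      by (simp add: transversal_def sum_distrib_left)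
    have "(x $ p - 1) * (x $ p * simplex_rate a p x)
        \<le> - (x $ p - 1)\<^sup>2 + 2 * A * \<bar>x $ p - 1\<bar> * transversal p x"
      by (rule radial_rate_bound) (use assms u A in \<open>auto simp: r_def\<close>)
    moreover have "2 * A * \<bar>x $ p - 1\<bar> \<le> c / 2"
    proof -
      have "\<bar>x $ p - 1\<bar> * (4 * A + 1) \<le> c"
        using u A0 by (simp add: r_def pos_le_divide_eq)
      then show ?thesis by (simp add: algebra_simps)
    qed
    then have "2 * A * \<bar>x $ p - 1\<bar> * transversal p x \<le> c / 2 * transversal p x"
      by (intro mult_right_mono transversal_nonneg)
    moreover have "c * (x $ p - 1)\<^sup>2 \<le> 1 * (x $ p - 1)\<^sup>2"
      using c1 by (intro mult_right_mono) auto
    ultimately show ?thesis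
      unfolding inner_field_equilibrium dist_equilibrium using tr by (simp add: distrib_left)
  qed
  with r c show ?thesis by (intro exI[of _ r] exI[of _ c] conjI ballI impI)
qed

lemma sink_stable_manifold_relatively_open:
  assumes "a p p = 0" and "\<And>i. i \<in> S \<Longrightarrow> i \<noteq> p \<Longrightarrow> a p i < 0"
  shows "openin (top_of_set (face S)) (face S \<inter> stable_manifold (simplex_field a) (equilibrium p))"
proof -
  obtain r c where rc: "r > 0" "c > 0" "\<And>x. x \<in> face S \<Longrightarrow> dist x (equilibrium p) \<le> r \<Longrightarrow>
    (x - equilibrium p) \<bullet> simplex_field a x \<le> - c * (dist x (equilibrium p))\<^sup>2"
    using sink_attracts[of a p S] assms by blast
  show ?thesis
    unfolding openin_euclidean_subtopology_iff
  proof (intro conjI ballI)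
    fix x0 assume "x0 \<in> face S \<inter> stable_manifold (simplex_field a) (equilibrium p)"
    then have x0: "x0 \<in> stable_manifold (simplex_field a) (equilibrium p)" by simp
    have "\<exists>e>0. \<forall>y\<in>face S. dist y x0 < e \<longrightarrow> y \<in> stable_manifold (simplex_field a) (equilibrium p)"
      by (rule stable_manifold_locally_open[OF simplex_field_lipschitz_on_cball rc _ x0])
         (auto intro: solution_face_iff[THEN iffD2])
    then show "\<exists>e>0. \<forall>y\<in>face S. dist y x0 < e \<longrightarrow>
        y \<in> face S \<inter> stable_manifold (simplex_field a) (equilibrium p)"
      by auto
  qed auto
qed


section \<open>Trajectories leaving a saddle\<close>

text \<open>
  Half the derivative of \<open>transversal j\<close> along solutions.
\<close>

definition transversal_rate :: "('n::finite \<Rightarrow> 'n \<Rightarrow> real) \<Rightarrow> 'n \<Rightarrow> real ^ 'n \<Rightarrow> real" where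
  "transversal_rate a j x = (\<Sum>i\<in>- {j}. simplex_rate a i x * (x $ i)\<^sup>2)"

text \<open>
  The region where this is at most \<open>0\<close> is a cone around the unstable directions of \<open>\<xi>\<^sub>j\<close>: there
  the radial displacement is controlled by the transversal coordinates.
\<close>

definition cone_function :: "'n::finite \<Rightarrow> real \<Rightarrow> real ^ 'n \<Rightarrow> real" where
  "cone_function j K x = (x $ j - 1)\<^sup>2 - K * transversal j x"

text \<open>
  A ball around \<open>\<xi>\<^sub>j\<close> in which the transversal part grows at rates between \<open>c\<close> and \<open>M\<close>, and in which the
  cone is forward invariant: the last inequality says that the derivative of \<open>cone_function j K\<close> is
  at most \<open>- 2 * cone_function j K\<close>.
\<close>

definition saddle_neighbourhood ::
  "('n::finite \<Rightarrow> 'n \<Rightarrow> real) \<Rightarrow> 'n set \<Rightarrow> 'n \<Rightarrow> real \<Rightarrow> real \<Rightarrow> real \<Rightarrow> real \<Rightarrow> bool" where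
  "saddle_neighbourhood a S j r c M K \<longleftrightarrow> 0 < r \<and> r \<le> 1/4 \<and> 0 < c \<and> 0 \<le> K \<and> 0 \<le> M \<and>
     (\<forall>x\<in>face S. dist x (equilibrium j) \<le> r \<longrightarrow>
        c * transversal j x \<le> transversal_rate a j x \<and>
        transversal_rate a j x \<le> M * transversal j x \<and>
        (x $ j - 1) * (x $ j * simplex_rate a j x) - K * transversal_rate a j x
          \<le> - cone_function j K x)"

text \<open>
  By \<open>radial_rate_bound\<close> the radial part contracts up to an error of order \<open>transversal j x\<close>. The
  transversal part grows at least at rate \<open>c\<close>, so that a large multiple \<open>K\<close> of it absorbs the error.
\<close>

lemma saddle_neighbourhood_exists:
  assumes "a j j = 0" and pos: "\<And>i. i \<in> S \<Longrightarrow> i \<noteq> j \<Longrightarrow> 0 < a j i"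
  shows "\<exists>r c M K. saddle_neighbourhood a S j r c M K"
proof -
  define m where "m = Min (insert 1 (a j ` (S - {j})))"
  define c where "c = m / 2"
  have "0 < m" using pos by (auto simp: m_def)
  then have c: "0 < c" by (simp add: c_def)
  have ca: "2 * c \<le> a j i" if "i \<in> S" "i \<noteq> j" for i
  proof -
    have "m \<le> a j i" unfolding m_def by (rule Min_le) (use that in auto)
    then show ?thesis by (simp add: c_def)
  qed
  define A where "A = (\<Sum>i\<in>UNIV. \<bar>1 - a i j\<bar>)"
  have A: "\<bar>1 - a i j\<bar> \<le> A" for i unfolding A_def by (rule member_le_sum) auto
  have A0: "0 \<le> A" using A[of j] by linarith
  define M where "M = (\<Sum>i\<in>UNIV. \<bar>a j i\<bar>) + c"
  have M: "a j i + c \<le> M" for i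
    unfolding M_def using member_le_sum[of i UNIV "\<lambda>i. \<bar>a j i\<bar>"] by simp
  have M0: "0 \<le> M" unfolding M_def using c by (simp add: sum_nonneg)
  \<comment> \<open>Chosen so that \<open>K * c\<close> is the factor \<open>2 * A * (1/4)\<close> of the error term when \<open>\<bar>x\<^sub>j - 1\<bar> \<le> 1/4\<close>.\<close>
  define K where "K = A / (2 * c)"
  have K: "0 \<le> K" using A0 c by (simp add: K_def)
  obtain r0 where r0: "r0 > 0"
    "\<And>x i. dist x (equilibrium j) \<le> r0 \<Longrightarrow> \<bar>simplex_rate a i x - a j i\<bar> < c"
    using rates_near_equilibrium[OF c] by blast
  define r where "r = min r0 (1/4)"
  have "c * transversal j x \<le> transversal_rate a j x \<and>
        transversal_rate a j x \<le> M * transversal j x \<and>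
        (x $ j - 1) * (x $ j * simplex_rate a j x) - K * transversal_rate a j x
          \<le> - cone_function j K x"
    if x: "x \<in> face S" "dist x (equilibrium j) \<le> r" for x
  proof -
    have rate: "\<bar>simplex_rate a i x - a j i\<bar> < c" for i using x(2) r0(2) by (simp add: r_def)
    have lower: "c * transversal j x \<le> transversal_rate a j x"
      unfolding transversal_def transversal_rate_def sum_distrib_left
    proof (rule sum_mono)
      fix i assume "i \<in> - {j}"
      then show "c * (x $ i)\<^sup>2 \<le> simplex_rate a i x * (x $ i)\<^sup>2"
      proof (cases "i \<in> S")
        case True
        then have "c \<le> simplex_rate a i x"
          using rate[of i] ca[of i] \<open>i \<in> - {j}\<close> by (auto simp: abs_less_iff)
        then show ?thesis by (intro mult_right_mono) auto
      qed (use x(1) in \<open>simp add: face_def\<close>)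
    qed
    have upper: "transversal_rate a j x \<le> M * transversal j x"
      unfolding transversal_def transversal_rate_def sum_distrib_left
    proof (intro sum_mono mult_right_mono)
      fix i show "simplex_rate a i x \<le> M"
        using rate[of i] M[of i] by (auto simp: abs_less_iff)
    qed auto
    have "(x $ j - 1)\<^sup>2 \<le> (dist x (equilibrium j))\<^sup>2"
      unfolding dist_equilibrium using transversal_nonneg[of j x] by simp
    then have u: "\<bar>x $ j - 1\<bar> \<le> 1/4"
      using x(2) by (auto simp: r_def dest!: power2_le_imp_le[of "\<bar>x $ j - 1\<bar>", simplified])
    have "(x $ j - 1) * (x $ j * simplex_rate a j x)
        \<le> - (x $ j - 1)\<^sup>2 + 2 * A * \<bar>x $ j - 1\<bar> * transversal j x"
      by (rule radial_rate_bound[of a, OF assms(1) u A])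
    also have "\<dots> \<le> - (x $ j - 1)\<^sup>2 + 2 * A * (1/4) * transversal j x"
      using u A0 transversal_nonneg by (intro add_left_mono mult_right_mono mult_left_mono) auto
    also have "2 * A * (1/4) * transversal j x = K * (c * transversal j x)"
      using c by (simp add: K_def)
    also have "\<dots> \<le> K * transversal_rate a j x" using lower K by (intro mult_left_mono)
    finally have "(x $ j - 1) * (x $ j * simplex_rate a j x) - K * transversal_rate a j x
        \<le> - (x $ j - 1)\<^sup>2" by simp
    also have "\<dots> \<le> - cone_function j K x"
      using K transversal_nonneg[of j x] by (simp add: cone_function_def)
    finally show ?thesis using lower upper by blast
  qed
  then have "saddle_neighbourhood a S j r c M K"
    using r0(1) c K M0 by (auto simp: saddle_neighbourhood_def r_def)
  then show ?thesis by blast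
qed

lemma transversal_derivative:
  assumes "solution (simplex_field a) x S" "t \<in> S"
  shows "((\<lambda>t. transversal j (x t)) has_real_derivative 2 * transversal_rate a j (x t)) (at t within S)"
proof -
  have "((\<lambda>t. transversal j (x t)) has_real_derivative
      (\<Sum>i\<in>- {j}. 2 * simplex_rate a i (x t) * (x t $ i)\<^sup>2)) (at t within S)"
    unfolding transversal_def by (intro DERIV_sum solution_square_derivative[OF assms])
  then show ?thesis by (simp add: transversal_rate_def sum_distrib_left mult.assoc)
qed

lemma cone_function_derivative:
  assumes "solution (simplex_field a) x S" "t \<in> S"
  shows "((\<lambda>t. cone_function j K (x t)) has_real_derivative
    2 * ((x t $ j - 1) * (x t $ j * simplex_rate a j (x t)) - K * transversal_rate a j (x t)))
    (at t within S)"
  unfolding cone_function_def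
  by (rule derivative_eq_intros solution_component_derivative[OF assms]
      transversal_derivative[OF assms] refl | simp add: algebra_simps)+

lemma transversal_growth:
  assumes box: "saddle_neighbourhood a S j r c M K"
    and x: "solution (simplex_field a) x {\<alpha>..\<beta>}" and "\<alpha> \<le> \<beta>"
    and stay: "\<And>t. t \<in> {\<alpha>..\<beta>} \<Longrightarrow> x t \<in> face S \<and> dist (x t) (equilibrium j) \<le> r"
  shows "transversal j (x \<alpha>) * exp (2 * c * (\<beta> - \<alpha>)) \<le> transversal j (x \<beta>)"
    and "transversal j (x \<beta>) \<le> transversal j (x \<alpha>) * exp (2 * M * (\<beta> - \<alpha>))"
proof -
  have b: "c * transversal j (x t) \<le> transversal_rate a j (x t) \<and>
      transversal_rate a j (x t) \<le> M * transversal j (x t)" if "t \<in> {\<alpha>..\<beta>}" for t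
    using box stay[OF that] unfolding saddle_neighbourhood_def by blast
  have "- transversal j (x \<beta>) \<le> - transversal j (x \<alpha>) * exp (2 * c * (\<beta> - \<alpha>))"
    by (rule exp_growth_bound[OF \<open>\<alpha> \<le> \<beta>\<close> DERIV_minus[OF transversal_derivative[OF x]]])
       (use b in auto)
  then show "transversal j (x \<alpha>) * exp (2 * c * (\<beta> - \<alpha>)) \<le> transversal j (x \<beta>)" by simp
  show "transversal j (x \<beta>) \<le> transversal j (x \<alpha>) * exp (2 * M * (\<beta> - \<alpha>))"
    by (rule exp_growth_bound[OF \<open>\<alpha> \<le> \<beta>\<close> transversal_derivative[OF x]]) (use b in auto)
qed

definition cone_box :: "'n::finite set \<Rightarrow> 'n \<Rightarrow> real \<Rightarrow> real \<Rightarrow> (real ^ 'n) set" where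
  "cone_box S j r K = {x \<in> face S. dist x (equilibrium j) \<le> r \<and> cone_function j K x \<le> 0}"

lemma closed_cone_box: "closed (cone_box S j r K)"
  unfolding cone_box_def cone_function_def Collect_conj_eq Collect_mem_eq
  by (intro closed_Int closed_face closed_Collect_conj closed_Collect_le continuous_intros)

lemma cone_box_dist:
  assumes "x \<in> cone_box S j r K"
  shows "(dist x (equilibrium j))\<^sup>2 \<le> (1 + K) * transversal j x"
  using assms unfolding cone_box_def cone_function_def dist_equilibrium by (simp add: distrib_right)

lemma cone_box_norm:
  assumes "x \<in> cone_box S j r K" "r \<le> 1"
  shows "norm x \<le> 2"
  using assms norm_triangle_sub[of x "equilibrium j"]
  by (simp add: cone_box_def dist_norm equilibrium_def)

text \<open>
  Exponential growth of the transversal part forces the trajectory to leave the ball, and until then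
  it stays in the cone. At the exit the transversal part is at least \<open>r\<^sup>2 / (1 + K)\<close>, and it grew at
  most at rate \<open>M\<close>; the last conclusion is therefore a lower bound for the exit time, which is large
  when \<open>z\<close> is close to \<open>\<xi>\<^sub>j\<close>.
\<close>

lemma saddle_exit:
  assumes box: "saddle_neighbourhood a S j r c M K"
    and z: "z \<in> face S" "z $ j = 1" "0 < transversal j z" "transversal j z < r\<^sup>2"
  obtains x T where "0 \<le> T" "x 0 = z" "solution (simplex_field a) x {0..T}"
    "dist (x T) (equilibrium j) = r" "\<And>t. t \<in> {0..T} \<Longrightarrow> x t \<in> cone_box S j r K"
    "r\<^sup>2 \<le> (1 + K) * transversal j z * exp (2 * M * T)"
proof -
  let ?f = "simplex_field a" and ?\<xi> = "equilibrium j"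
  from box have r: "0 < r" "r \<le> 1/4" and c: "0 < c" and K: "0 \<le> K"
    by (auto simp: saddle_neighbourhood_def)
  obtain L where L: "L-lipschitz_on (cball 0 2) ?f" using simplex_field_lipschitz_on_cball by blast
  obtain F where F: "L-lipschitz_on UNIV F" "\<And>z. norm z \<le> 2 \<Longrightarrow> F z = ?f z"
    using clamped_field_exists[OF L] by auto
  obtain x where x: "x 0 = z" "solution F x {0..}" using global_solution_exists[OF F(1)] by blast
  have small: "norm y \<le> 2" if "dist y ?\<xi> \<le> r" for y
    using that r norm_triangle_sub[of y ?\<xi>] by (simp add: dist_norm equilibrium_def)
  have xf: "solution ?f x {0..t}" if "\<And>s. s \<in> {0..t} \<Longrightarrow> dist (x s) ?\<xi> \<le> r" for t
    by (rule solution_cong[OF solution_subset[OF x(2)]]) (use F(2) small that in auto)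
  have xface: "x s \<in> face S" if "\<And>s. s \<in> {0..t} \<Longrightarrow> dist (x s) ?\<xi> \<le> r" "s \<in> {0..t}" for s t
  proof -
    have "solution ?f x {0..s}" by (rule xf) (use that in auto)
    then show ?thesis using solution_face_iff[of a x 0 s S] that(2) z(1) x(1) by auto
  qed
  have dz: "dist z ?\<xi> < r"
  proof -
    have "(dist z ?\<xi>)\<^sup>2 < r\<^sup>2" using z by (simp add: dist_equilibrium)
    then show ?thesis by (rule power2_less_imp_less) (use r(1) in simp)
  qed
  \<comment> \<open>A time by which growth at rate \<open>2 * c\<close> lifts the transversal part above \<open>r\<^sup>2\<close>, already by
    \<open>exp s \<ge> 1 + s\<close>.\<close>
  define t1 where "t1 = r\<^sup>2 / (transversal j z * c)"
  have t1: "0 \<le> t1" using z c by (simp add: t1_def)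
  have "\<exists>t\<in>{0..t1}. r \<le> dist (x t) ?\<xi>"
  proof (rule ccontr)
    assume "\<not> (\<exists>t\<in>{0..t1}. r \<le> dist (x t) ?\<xi>)"
    then have stay: "dist (x s) ?\<xi> \<le> r" if "s \<in> {0..t1}" for s
      using that by force
    have "transversal j (x 0) * exp (2 * c * (t1 - 0)) \<le> transversal j (x t1)"
      using stay xface[OF stay] by (intro transversal_growth(1)[OF box xf[OF stay] t1]) auto
    also have "\<dots> \<le> (dist (x t1) ?\<xi>)\<^sup>2" by (simp add: dist_equilibrium)
    also have "\<dots> \<le> r\<^sup>2" using stay[of t1] t1 by (intro power_mono) auto
    finally have "transversal j z * exp (2 * c * t1) \<le> r\<^sup>2" by (simp add: x(1))
    moreover have "transversal j z * (1 + 2 * c * t1) \<le> transversal j z * exp (2 * c * t1)"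
      using z(3) by (intro mult_left_mono exp_ge_add_one_self) auto
    moreover have "transversal j z * (1 + 2 * c * t1) = transversal j z + 2 * r\<^sup>2"
      using z(3) c by (simp add: t1_def field_simps)
    ultimately have "transversal j z + r\<^sup>2 \<le> 0" by linarith
    then show False using z(3) zero_le_power2[of r] by linarith
  qed
  then obtain t2 where t2: "0 \<le> t2" "r \<le> dist (x t2) ?\<xi>" by auto
  have "continuous_on {0..t2} (\<lambda>t. dist (x t) ?\<xi>)"
    by (intro continuous_intros continuous_on_subset[OF solution_continuous_on[OF x(2)]]) auto
  then obtain T where T: "T \<in> {0..t2}" "dist (x T) ?\<xi> = r"
    and stay: "\<And>s. s \<in> {0..T} \<Longrightarrow> dist (x s) ?\<xi> \<le> r"
    using first_hitting_time[of 0 t2 "\<lambda>t. dist (x t) ?\<xi>" r] t2 dz x(1) by blast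
  have T0: "0 \<le> T" using T(1) by simp
  have sol: "solution ?f x {0..T}" by (rule xf[OF stay])
  have inbox: "x t \<in> cone_box S j r K" if t: "t \<in> {0..T}" for t
  proof -
    have "cone_function j K (x t) \<le> cone_function j K (x 0) * exp (- 2 * (t - 0))"
    proof (rule exp_growth_bound)
      fix s assume s: "s \<in> {0..t}"
      have "solution ?f x {0..t}" by (rule solution_subset[OF sol]) (use t in auto)
      from cone_function_derivative[OF this s, of j K]
      show "((\<lambda>t. cone_function j K (x t)) has_real_derivative
        2 * ((x s $ j - 1) * (x s $ j * simplex_rate a j (x s)) - K * transversal_rate a j (x s)))
        (at s within {0..t})" .
      have sT: "s \<in> {0..T}" using s t by auto
      show "2 * ((x s $ j - 1) * (x s $ j * simplex_rate a j (x s)) - K * transversal_rate a j (x s))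
        \<le> - 2 * cone_function j K (x s)"
        using box xface[OF stay sT] stay[OF sT] unfolding saddle_neighbourhood_def by auto
    qed (use t in auto)
    also have "\<dots> \<le> 0"
      using K z x(1) by (intro mult_nonpos_nonneg) (auto simp: cone_function_def)
    finally show ?thesis using stay[OF t] xface[OF stay t] by (simp add: cone_box_def)
  qed
  have "r\<^sup>2 \<le> (1 + K) * transversal j (x T)"
    using cone_box_dist[OF inbox[of T]] T0 T(2) by simp
  also have "\<dots> \<le> (1 + K) * (transversal j (x 0) * exp (2 * M * (T - 0)))"
    using K stay xface[OF stay]
    by (intro mult_left_mono transversal_growth(2)[OF box sol T0]) auto
  finally have "r\<^sup>2 \<le> (1 + K) * transversal j z * exp (2 * M * T)" by (simp add: x(1) mult.assoc)
  with that[OF T0 x(1) sol T(2) inbox] show ?thesis by blast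
qed


text \<open>
  A point of the unstable manifold is obtained as a limit \<open>w\<close> of exit points of trajectories that
  start in \<open>E\<close> ever closer to \<open>\<xi>\<^sub>j\<close>. As the exit times tend to infinity, the backward trajectory of \<open>w\<close>
  never leaves the cone inside the ball, where the transversal part, and with it the distance to \<open>\<xi>\<^sub>j\<close>,
  decays exponentially in backward time.
\<close>

lemma unstable_manifold_meets_closed_invariant_set:
  fixes a :: "'n::finite \<Rightarrow> 'n \<Rightarrow> real"
  assumes "a j j = 0" and pos: "\<And>i. i \<in> S \<Longrightarrow> i \<noteq> j \<Longrightarrow> 0 < a j i"
    and E: "closed E" "E \<subseteq> face S"
    and inv: "\<And>x T. 0 \<le> T \<Longrightarrow> solution (simplex_field a) x {0..T} \<Longrightarrow> x 0 \<in> E \<Longrightarrow> x T \<in> E"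
    and arb: "\<And>\<epsilon>. 0 < \<epsilon> \<Longrightarrow> \<exists>z\<in>E. z $ j = 1 \<and> 0 < transversal j z \<and> transversal j z < \<epsilon>"
  shows "\<exists>w\<in>E. w \<in> unstable_manifold (simplex_field a) (equilibrium j) \<and>
    0 < transversal j w \<and> dist w (equilibrium j) \<le> 1/4"
proof -
  let ?f = "simplex_field a" and ?\<xi> = "equilibrium j :: real^'n"
  obtain r c M K where box: "saddle_neighbourhood a S j r c M K"
    using saddle_neighbourhood_exists[of a j S, OF assms(1) pos] by blast
  from box have r: "0 < r" "r \<le> 1/4" and c: "0 < c" and K: "0 \<le> K" and M: "0 \<le> M"
    by (auto simp: saddle_neighbourhood_def)
  define N where "N = cone_box S j r K"
  have "\<exists>x T. 0 \<le> T \<and> x T \<in> E \<and> solution ?f x {0..T} \<and> dist (x T) ?\<xi> = r \<and>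
      (\<forall>t\<in>{0..T}. x t \<in> N) \<and> real (Suc n) \<le> (1 + K) * exp (2 * M * T)" for n
  proof -
    have "0 < r\<^sup>2 / real (Suc n)" using r by simp
    then obtain z where z: "z \<in> E" "z $ j = 1" "0 < transversal j z" "transversal j z < r\<^sup>2 / real (Suc n)"
      using arb by blast
    note z(4)
    also have "r\<^sup>2 / real (Suc n) \<le> r\<^sup>2" using r by (simp add: divide_le_eq mult_le_cancel_left1)
    finally have "transversal j z < r\<^sup>2" .
    then obtain x T where x: "0 \<le> T" "x 0 = z" "solution ?f x {0..T}" "dist (x T) ?\<xi> = r"
      "\<And>t. t \<in> {0..T} \<Longrightarrow> x t \<in> N" "r\<^sup>2 \<le> (1 + K) * transversal j z * exp (2 * M * T)"
      unfolding N_def using saddle_exit[OF box subsetD[OF E(2) z(1)] z(2,3)] by blast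
    have "r\<^sup>2 \<le> (1 + K) * exp (2 * M * T) * transversal j z" using x(6) by (simp add: mult_ac)
    also have "\<dots> \<le> (1 + K) * exp (2 * M * T) * (r\<^sup>2 / real (Suc n))"
      using z(4) K by (intro mult_left_mono) auto
    finally have "r\<^sup>2 * real (Suc n) \<le> r\<^sup>2 * ((1 + K) * exp (2 * M * T))"
      by (simp add: pos_le_divide_eq mult_ac)
    then have "real (Suc n) \<le> (1 + K) * exp (2 * M * T)"
      using r(1) by (subst (asm) mult_le_cancel_left_pos) auto
    moreover have "x T \<in> E" using inv[OF x(1,3)] x(2) z(1) by simp
    ultimately show ?thesis using x(1,3,4,5) by blast
  qed
  then obtain x T where T: "\<And>n. 0 \<le> T n" and xE: "\<And>n. x n (T n) \<in> E"
    and sol: "\<And>n. solution ?f (x n) {0..T n}" and xr: "\<And>n. dist (x n (T n)) ?\<xi> = r"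
    and xN: "\<And>n t. t \<in> {0..T n} \<Longrightarrow> x n t \<in> N"
    and large: "\<And>n. real (Suc n) \<le> (1 + K) * exp (2 * M * T n)"
    by metis
  have T_large: "\<forall>\<^sub>F n in sequentially. t \<le> T n" for t
  proof -
    have "\<forall>\<^sub>F n in sequentially. (1 + K) * exp (2 * M * t) < real n"
      by (rule filterlim_at_top_dense[THEN iffD1, OF filterlim_real_sequentially, rule_format])
    then show ?thesis
    proof eventually_elim
      case (elim n)
      show ?case
      proof (rule ccontr)
        assume "\<not> t \<le> T n"
        then have "exp (2 * M * T n) \<le> exp (2 * M * t)" using M by (simp add: mult_left_mono)
        then have "(1 + K) * exp (2 * M * T n) \<le> (1 + K) * exp (2 * M * t)"
          using K by (intro mult_left_mono) auto
        then show False using large[of n] elim by simp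
      qed
    qed
  qed
  have "compact (E \<inter> sphere ?\<xi> r)" using E(1) by (simp add: closed_Int_compact)
  moreover have "\<forall>n. x n (T n) \<in> E \<inter> sphere ?\<xi> r" using xE xr by (simp add: dist_commute)
  ultimately obtain w \<sigma> where w: "w \<in> E \<inter> sphere ?\<xi> r" and \<sigma>: "strict_mono \<sigma>"
    and lim: "((\<lambda>n. x n (T n)) \<circ> \<sigma>) \<longlonglongrightarrow> w"
    unfolding compact_def by metis
  obtain L where L: "L-lipschitz_on (cball 0 2) ?f" using simplex_field_lipschitz_on_cball by blast
  obtain F where F: "L-lipschitz_on UNIV F" "\<And>z. norm z \<le> 2 \<Longrightarrow> F z = ?f z"
    using clamped_field_exists[OF L] by auto
  have F': "L-lipschitz_on UNIV (\<lambda>z. - F z)" using F(1) by (rule lipschitz_on_minus)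
  obtain b where b: "b 0 = w" "solution (\<lambda>z. - F z) b {0..}"
    using global_solution_exists[OF F'] by blast
  have FN: "F z = ?f z" if "z \<in> N" for z
    using F(2) cone_box_norm[OF that[unfolded N_def]] r by simp
  \<comment> \<open>For fixed \<open>t\<close> the reversed trajectories from the exit points are eventually defined at time \<open>t\<close>,
    lie in \<open>N\<close>, and converge to \<open>b t\<close>.\<close>
  have bN: "b t \<in> N" if t: "0 \<le> t" for t
  proof -
    have rev: "dist (x n (T n - t)) (b t) \<le> dist (x n (T n)) w * exp (L * t)" if "t \<le> T n" for n
    proof -
      have "solution (\<lambda>z. (- 1) *\<^sub>R ?f z) (\<lambda>s. x n (T n + (- 1) * s)) {0..t}"
        by (rule solution_comp_affine[OF sol]) (use that in auto)
      then have rev: "solution (\<lambda>z. - ?f z) (\<lambda>s. x n (T n - s)) {0..t}" by simp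
      have "solution (\<lambda>z. - F z) (\<lambda>s. x n (T n - s)) {0..t}"
        by (rule solution_cong[OF rev]) (use that in \<open>auto simp: FN xN\<close>)
      from gronwall_solutions[OF F' this solution_subset[OF b(2)], of t] t show ?thesis
        by (simp add: b(1))
    qed
    have lim_b: "(\<lambda>n. x (\<sigma> n) (T (\<sigma> n) - t)) \<longlonglongrightarrow> b t"
    proof (rule metric_tendsto_imp_tendsto)
      have "(\<lambda>n. dist (x (\<sigma> n) (T (\<sigma> n))) w * exp (L * t)) \<longlonglongrightarrow> 0 * exp (L * t)"
        using lim by (intro tendsto_mult tendsto_const) (simp add: o_def tendsto_dist_iff[symmetric])
      then show "(\<lambda>n. dist (x (\<sigma> n) (T (\<sigma> n))) w * exp (L * t)) \<longlonglongrightarrow> 0" by simp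
      show "\<forall>\<^sub>F n in sequentially. dist (x (\<sigma> n) (T (\<sigma> n) - t)) (b t)
          \<le> dist (dist (x (\<sigma> n) (T (\<sigma> n))) w * exp (L * t)) 0"
        using eventually_subseq[OF \<sigma> T_large[of t]] by eventually_elim (use rev in auto)
    qed
    have ev_N: "\<forall>\<^sub>F n in sequentially. x (\<sigma> n) (T (\<sigma> n) - t) \<in> N"
      using eventually_subseq[OF \<sigma> T_large[of t]] by eventually_elim (use xN t in auto)
    show ?thesis
      unfolding N_def
      by (rule Lim_in_closed_set[OF closed_cone_box ev_N[unfolded N_def] sequentially_bot lim_b])
  qed
  define y where "y t = b (- t)" for t
  have "solution (\<lambda>z. (- 1) *\<^sub>R - F z) (\<lambda>t. b (0 + (- 1) * t)) {..0}"
    by (rule solution_comp_affine[OF b(2)]) auto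
  then have y': "solution F y {..0}" by (simp add: y_def[abs_def])
  have y: "solution ?f y {..0}"
    by (rule solution_cong[OF y']) (use bN in \<open>auto simp: FN y_def\<close>)
  have yN: "y t \<in> N" if "t \<le> 0" for t using bN[of "- t"] that by (simp add: y_def)
  have ydist: "(dist (y t) ?\<xi>)\<^sup>2 \<le> (1 + K) * (transversal j w * exp (2 * c * t))" if "t \<le> 0" for t
  proof -
    have "transversal j (y t) * exp (2 * c * (0 - t)) \<le> transversal j (y 0)"
      by (rule transversal_growth(1)[OF box solution_subset[OF y] that])
         (use yN in \<open>auto simp: N_def cone_box_def\<close>)
    then have "transversal j (y t) \<le> transversal j w * exp (2 * c * t)"
      by (simp add: y_def b(1) exp_minus field_simps)
    then have "(1 + K) * transversal j (y t) \<le> (1 + K) * (transversal j w * exp (2 * c * t))"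
      using K by (intro mult_left_mono) auto
    then show ?thesis
      using cone_box_dist[of "y t"] yN[OF that] unfolding N_def by fastforce
  qed
  have "(y \<longlongrightarrow> ?\<xi>) at_bot"
  proof -
    have "((\<lambda>t. (1 + K) * (transversal j w * exp (2 * c * t))) \<longlongrightarrow> (1 + K) * (transversal j w * 0)) at_bot"
    proof (intro tendsto_mult tendsto_const filterlim_compose[OF exp_at_bot])
      show "filterlim (\<lambda>t. 2 * c * t) at_bot at_bot"
        using c by (intro filterlim_tendsto_pos_mult_at_bot[OF tendsto_const] filterlim_ident) auto
    qed
    then have lim0: "((\<lambda>t. (1 + K) * (transversal j w * exp (2 * c * t))) \<longlongrightarrow> 0) at_bot" by simp
    show ?thesis
      by (rule tendsto_of_dist_square_le[OF _ lim0])
         (use ydist in \<open>auto intro!: eventually_at_bot_linorderI[of 0]\<close>)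
  qed
  then have "w \<in> unstable_manifold ?f ?\<xi>"
    using y unfolding unstable_manifold_iff by (intro exI[of _ y]) (simp add: y_def b(1))
  moreover have "0 < transversal j w"
  proof -
    have "w \<in> N" using yN[of 0] by (simp add: y_def b(1))
    then have "r\<^sup>2 \<le> (1 + K) * transversal j w"
      using cone_box_dist[of w S j r K] w by (simp add: N_def dist_commute)
    moreover have "0 < r\<^sup>2" using r by simp
    ultimately have "0 < (1 + K) * transversal j w" by linarith
    then show ?thesis using K by (simp add: zero_less_mult_iff)
  qed
  moreover have "dist w ?\<xi> \<le> 1/4" using w r by (simp add: dist_commute)
  ultimately show ?thesis using w by blast
qed

text \<open>
  Inside the face all transversal directions at \<open>\<xi>\<^sub>j\<close> are unstable. A trajectory that tends to \<open>\<xi>\<^sub>j\<close> has a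
  transversal part that eventually does not decrease and yet tends to \<open>0\<close>.
\<close>

lemma saddle_stable_manifold_trivial:
  assumes "a j j = 0" "\<And>i. i \<in> S \<Longrightarrow> i \<noteq> j \<Longrightarrow> 0 < a j i"
    and "w \<in> face S" "w \<in> stable_manifold (simplex_field a) (equilibrium j)"
  shows "transversal j w = 0"
proof -
  let ?f = "simplex_field a"
  obtain r c M K where box: "saddle_neighbourhood a S j r c M K"
    using saddle_neighbourhood_exists[of a j S, OF assms(1,2)] by blast
  from box have r: "0 < r" and c: "0 < c" by (auto simp: saddle_neighbourhood_def)
  from assms(4) obtain x where x: "x 0 = w" "solution ?f x {0..}" "(x \<longlongrightarrow> equilibrium j) at_top"
    unfolding stable_manifold_iff by auto
  have xs: "x t \<in> face S" if "0 \<le> t" for t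
    using solution_face_iff[OF solution_subset[OF x(2)], of 0 t S] that x(1) assms(3) by auto
  have "\<forall>\<^sub>F t in at_top. dist (x t) (equilibrium j) < r"
    using tendstoD[OF x(3) r] .
  then obtain T0 where T0: "\<And>t. t \<ge> T0 \<Longrightarrow> dist (x t) (equilibrium j) < r"
    by (auto simp: eventually_at_top_linorder)
  define T where "T = max 0 T0"
  have "transversal j (x T) \<le> transversal j (x t)" if "T \<le> t" for t
  proof -
    have "transversal j (x T) * 1 \<le> transversal j (x T) * exp (2 * c * (t - T))"
      using that c transversal_nonneg by (intro mult_left_mono) auto
    also have "\<dots> \<le> transversal j (x t)"
      by (rule transversal_growth(1)[OF box solution_subset[OF x(2)] that])
         (use xs T0 in \<open>auto simp: T_def intro: less_imp_le\<close>)
    finally show ?thesis by simp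
  qed
  then have "\<forall>\<^sub>F t in at_top. transversal j (x T) \<le> transversal j (x t)"
    by (rule eventually_at_top_linorderI)
  moreover have "((\<lambda>t. transversal j (x t)) \<longlongrightarrow> transversal j (equilibrium j)) at_top"
  proof -
    have "isCont (transversal j) (equilibrium j)"
      using continuous_on_transversal[OF continuous_on_id, of UNIV j]
      by (simp add: continuous_on_eq_continuous_at)
    then show ?thesis using x(3) by (rule isCont_tendsto_compose)
  qed
  moreover have "transversal j (equilibrium j) = 0"
    by (simp add: transversal_def equilibrium_def axis_def)
  ultimately have "transversal j (x T) \<le> 0"
    using tendsto_lowerbound[of "\<lambda>t. transversal j (x t)" 0 at_top "transversal j (x T)"] by simp
  then have "\<forall>i\<in>- {j}. (x T $ i)\<^sup>2 = 0"
    using transversal_nonneg[of j "x T"] unfolding transversal_def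
    by (subst sum_nonneg_eq_0_iff[symmetric]) auto
  have "w $ i = 0" if "i \<noteq> j" for i
  proof -
    obtain m where "m > 0" "x T $ i = m * x 0 $ i"
      using solution_component_multiplier[OF solution_subset[OF x(2)], of 0 T i] by (auto simp: T_def)
    moreover have "x T $ i = 0" using that \<open>\<forall>i\<in>- {j}. (x T $ i)\<^sup>2 = 0\<close> by auto
    ultimately show ?thesis using x(1) by simp
  qed
  then show ?thesis by (auto simp: transversal_def)
qed

lemma stable_manifold_face_mem:
  assumes "w \<in> face S" "w \<in> stable_manifold (simplex_field a) (equilibrium i)"
  shows "i \<in> S"
proof (rule ccontr)
  assume "i \<notin> S"
  from assms(2) obtain x where x: "x 0 = w" "solution (simplex_field a) x {0..}"
    "(x \<longlongrightarrow> equilibrium i) at_top"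
    unfolding stable_manifold_iff by auto
  have "x t $ i = 0" if "0 \<le> t" for t
    using solution_face_iff[OF solution_subset[OF x(2)], of 0 t S] that x(1) assms(1) \<open>i \<notin> S\<close>
    by (auto simp: face_def)
  then have "\<forall>\<^sub>F t in at_top. x t $ i = 0" by (intro eventually_at_top_linorderI[of 0]) auto
  then have "((\<lambda>t. x t $ i) \<longlongrightarrow> 0) at_top" by (rule tendsto_eventually)
  moreover have "((\<lambda>t. x t $ i) \<longlongrightarrow> equilibrium i $ i) at_top" by (intro tendsto_vec_nth x(3))
  ultimately have "equilibrium i $ i = 0" using tendsto_unique[OF trivial_limit_at_top_linorder] by blast
  then show False by (simp add: equilibrium_def axis_def)
qed

lemma equilibrium_not_near:
  assumes "i \<noteq> j" shows "dist (equilibrium i) (equilibrium j) > 1/4"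
proof -
  have "1 = \<bar>(equilibrium i - equilibrium j) $ i\<bar>" using assms by (simp add: equilibrium_def axis_def)
  also have "\<dots> \<le> dist (equilibrium i) (equilibrium j)" unfolding dist_norm by (rule component_le_norm_cart)
  finally show ?thesis by simp
qed

section \<open>Out-neighbours in a complete network\<close>

text \<open>
  Were \<open>p\<close> and \<open>q\<close> not adjacent, then \<open>\<xi>\<^sub>p\<close> and \<open>\<xi>\<^sub>q\<close> would be sinks in the face of \<open>j, p, q\<close>. The complement
  \<open>E\<close> of the two basins in this face is closed and forward invariant, and it meets every short
  segment \<open>\<gamma>\<close> that joins the two coordinate planes near \<open>\<xi>\<^sub>j\<close>. It follows that the unstable manifold of
  \<open>\<xi>\<^sub>j\<close> contains a point of \<open>E\<close> other than \<open>\<xi>\<^sub>j\<close>. Its trajectory stays in the face, where it could only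
  converge to \<open>\<xi>\<^sub>j\<close>, \<open>\<xi>\<^sub>p\<close> or \<open>\<xi>\<^sub>q\<close>; the last two are excluded by the choice of \<open>E\<close>, and the first
  because all directions in the face are unstable at \<open>\<xi>\<^sub>j\<close>, apart from the radial one.
\<close>

theorem complete_out_neighbours_adjacent:
  fixes a :: "'n::finite \<Rightarrow> 'n \<Rightarrow> real"
  assumes coeff: "simplex_coefficients G a" and complete: "complete_simplex_network G a"
    and edges: "(j, p) \<in> parcs G" "(j, q) \<in> parcs G" "p \<noteq> q" "p \<noteq> j" "q \<noteq> j"
    and no2: "(p, j) \<notin> parcs G" "(q, j) \<notin> parcs G"
  shows "(p, q) \<in> parcs G \<or> (q, p) \<in> parcs G"
proof (rule ccontr)
  assume nonadj: "\<not> ((p, q) \<in> parcs G \<or> (q, p) \<in> parcs G)"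
  let ?f = "simplex_field a"
  let ?W = "\<lambda>i. stable_manifold ?f (equilibrium i)"
  define S where "S = {j, p, q}"
  have zero: "a i i = 0" for i using coeff by (simp add: simplex_coefficients_def)
  have sgn: "0 < a k i \<longleftrightarrow> (k, i) \<in> parcs G" "a k i < 0 \<longleftrightarrow> (k, i) \<notin> parcs G" if "i \<noteq> k" for i k
    using coeff that unfolding simplex_coefficients_def by (smt (verit, best))+
  have openW: "openin (top_of_set (face S)) (face S \<inter> ?W i)" if "i \<in> {p, q}" for i
    by (rule sink_stable_manifold_relatively_open[OF zero])
       (use that edges nonadj no2 sgn in \<open>auto simp: S_def\<close>)
  define E where "E = face S - ?W p - ?W q"
  have "closedin (top_of_set (face S)) E"
  proof -
    have "E = face S - (face S \<inter> ?W p) - (face S \<inter> ?W q)" by (auto simp: E_def)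
    then show ?thesis using openW[of p] openW[of q]
      by (simp add: closedin_diff)
  qed
  then have "closed E" using closed_face closedin_closed_trans by blast
  have inv: "x T \<in> E" if "0 \<le> T" "solution ?f x {0..T}" "x 0 \<in> E" for x T
    using that solution_face_iff[OF that(2,1)] stable_manifold_backward_invariant[OF that(1,2)]
    by (auto simp: E_def)
  have arb: "\<exists>z\<in>E. z $ j = 1 \<and> 0 < transversal j z \<and> transversal j z < \<epsilon>" if "0 < \<epsilon>" for \<epsilon> :: real
  proof -
    define d where "d = min 1 (\<epsilon> / 4)"
    have d: "0 < d" "d \<le> 1" "d \<le> \<epsilon> / 4" using \<open>0 < \<epsilon>\<close> by (auto simp: d_def)
    define \<gamma> where "\<gamma> s = (\<chi> i. if i = j then 1 else if i = p then d * (1 - s) else if i = q then d * s else 0)"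
      for s :: real
    have \<gamma>_face: "\<gamma> s \<in> face S" if "s \<in> {0..1}" for s
      using that d by (auto simp: \<gamma>_def face_def S_def)
    have tr: "transversal j (\<gamma> s) = d\<^sup>2 * ((1 - s)\<^sup>2 + s\<^sup>2)" for s
    proof -
      have "transversal j (\<gamma> s) = (\<Sum>i\<in>{p, q}. (\<gamma> s $ i)\<^sup>2)"
        unfolding transversal_def by (rule sum.mono_neutral_right) (use edges in \<open>auto simp: \<gamma>_def\<close>)
      also have "\<dots> = d\<^sup>2 * ((1 - s)\<^sup>2 + s\<^sup>2)"
        using edges by (simp add: \<gamma>_def power_mult_distrib distrib_left)
      finally show ?thesis .
    qed
    have conn: "Topological_Spaces.connected (\<gamma> ` {0..1})"
      unfolding \<gamma>_def
    proof (intro connected_continuous_image continuous_on_vec_lambda connected_Icc)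
      fix i
      show "continuous_on {0..1}
          (\<lambda>s. if i = j then 1 else if i = p then d * (1 - s) else if i = q then d * s else 0)"
        by (cases "i = j"; cases "i = p"; cases "i = q") (auto intro!: continuous_intros)
    qed
    have "\<gamma> 0 \<in> face {j, p}" "\<gamma> 1 \<in> face {j, q}"
      using edges d by (auto simp: \<gamma>_def face_def)
    then have notq: "\<gamma> 0 \<notin> ?W q" and notp: "\<gamma> 1 \<notin> ?W p"
      using stable_manifold_face_mem edges by fastforce+
    have "\<exists>s\<in>{0..1}. \<gamma> s \<in> E"
    proof (rule ccontr)
      assume "\<not> ?thesis"
      then have cover: "\<gamma> s \<in> ?W p \<or> \<gamma> s \<in> ?W q" if "s \<in> {0..1}" for s
        using \<gamma>_face[OF that] that by (auto simp: E_def)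
      obtain U V where U: "open U" "face S \<inter> ?W p = face S \<inter> U"
        and V: "open V" "face S \<inter> ?W q = face S \<inter> V"
        using openW[of p] openW[of q] unfolding openin_open by auto
      have disj: "?W p \<inter> ?W q \<inter> \<gamma> ` {0..1} = {}"
        using stable_manifolds_disjoint[of _ a "equilibrium p" "equilibrium q"] equilibrium_not_near[of p q] edges(3)
        by fastforce
      have mem: "\<gamma> s \<in> U \<longleftrightarrow> \<gamma> s \<in> ?W p" "\<gamma> s \<in> V \<longleftrightarrow> \<gamma> s \<in> ?W q" if "s \<in> {0..1}" for s
        using U(2) V(2) \<gamma>_face[OF that] by blast+
      have "U \<inter> V \<inter> \<gamma> ` {0..1} = {}" "\<gamma> ` {0..1} \<subseteq> U \<union> V"
        using disj cover mem by blast+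
      moreover have "\<gamma> 0 \<in> U" "\<gamma> 1 \<in> V"
        using cover[of 0] cover[of 1] notp notq mem by auto
      ultimately show False
        using connectedD[OF conn U(1) V(1)] by fastforce
    qed
    then obtain s where s: "s \<in> {0..1}" "\<gamma> s \<in> E" by blast
    have "0 < (1 - s)\<^sup>2 + s\<^sup>2" by (simp add: sum_power2_gt_zero_iff) 
    moreover have "(1 - s)\<^sup>2 + s\<^sup>2 \<le> 1 + 1"
      using s(1) by (intro add_mono power_le_one) auto
    moreover have "d\<^sup>2 \<le> \<epsilon> / 4"
      using d mult_mono[of d "\<epsilon>/4" d 1] by (simp add: power2_eq_square)
    ultimately have "0 < transversal j (\<gamma> s)" "transversal j (\<gamma> s) < \<epsilon>"
      using mult_mono[of "d\<^sup>2" "\<epsilon>/4" "(1 - s)\<^sup>2 + s\<^sup>2" 2] d \<open>0 < \<epsilon>\<close> unfolding tr by auto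
    then show ?thesis using s(2) by (intro bexI[of _ "\<gamma> s"]) (auto simp: \<gamma>_def)
  qed
  have pos: "0 < a j i" if "i \<in> S" "i \<noteq> j" for i using that edges sgn by (auto simp: S_def)
  have "\<exists>w\<in>E. w \<in> unstable_manifold ?f (equilibrium j) \<and> 0 < transversal j w \<and>
      dist w (equilibrium j) \<le> 1/4"
  proof (rule unstable_manifold_meets_closed_invariant_set[where S = S])
    show "a j j = 0" by (rule zero)
    show "E \<subseteq> face S" by (auto simp: E_def)
  qed (fact pos \<open>closed E\<close> inv arb)+
  then obtain w where w: "w \<in> E" "w \<in> unstable_manifold ?f (equilibrium j)" "0 < transversal j w"
      "dist w (equilibrium j) \<le> 1/4"
    by blast
  have wS: "w \<in> face S" using w(1) by (simp add: E_def)
  then have "w \<in> simplex_network G a"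
    using complete w(2) by (auto simp: complete_simplex_network_def orthant_def face_def)
  then consider i where "w = equilibrium i" | i where "w \<in> ?W i"
    by (auto simp: simplex_network_def)
  then show False
  proof cases
    case 1
    then have "i = j" using w(4) equilibrium_not_near[of i j] by fastforce
    then show False using 1 w(3) by (simp add: transversal_def equilibrium_def axis_def)
  next
    case 2
    have "i \<in> S" using stable_manifold_face_mem[OF wS 2] .
    moreover have "i \<noteq> p" "i \<noteq> q" using 2 w(1) by (auto simp: E_def)
    ultimately have "w \<in> ?W j" using 2 by (simp add: S_def)
    then show False using saddle_stable_manifold_trivial[of a j S w] zero pos wS w(3) by simp
  qed
qed


section \<open>Completeness with unit coefficients\<close>

lemma solution_componentI:
  fixes a :: "'n::finite \<Rightarrow> 'n \<Rightarrow> real"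
  assumes "\<And>t i. t \<in> S \<Longrightarrow> ((\<lambda>t. x t $ i) has_real_derivative x t $ i * simplex_rate a i (x t)) (at t within S)"
  shows "solution (simplex_field a) x S"
  unfolding solution_def has_vector_derivative_def
proof
  fix t assume t: "t \<in> S"
  show "(x has_derivative (\<lambda>h. h *\<^sub>R simplex_field a (x t))) (at t within S)"
  proof (rule has_derivative_componentwise_within[THEN iffD2], rule ballI)
    fix b :: "real^'n" assume "b \<in> Basis"
    then obtain i where b: "b = axis i 1" using axis_inverse by blast
    have "((\<lambda>t. x t $ i) has_derivative (*) (x t $ i * simplex_rate a i (x t))) (at t within S)"
      using assms[OF t, of i] unfolding has_field_derivative_def .
    moreover have "(*) (x t $ i * simplex_rate a i (x t)) = (\<lambda>h. (h *\<^sub>R simplex_field a (x t)) \<bullet> b)"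
      by (rule ext) (simp add: b inner_axis simplex_field_nth mult.commute)
    moreover have "(\<lambda>t. x t $ i) = (\<lambda>t. x t \<bullet> b)" by (simp add: b inner_axis)
    ultimately show "((\<lambda>t. x t \<bullet> b) has_derivative (\<lambda>h. (h *\<^sub>R simplex_field a (x t)) \<bullet> b)) (at t within S)"
      by (simp only:)
  qed
qed

text \<open>
  Near \<open>\<xi>\<^sub>j\<close> the coordinate \<open>x\<^sub>i\<close> has a negative rate, so that \<open>x\<^sub>i\<^sup>2\<close> can only increase in backward time. It
  tends to \<open>0\<close> there and hence vanishes.
\<close>

lemma unstable_manifold_component_zero:
  assumes "a j i < 0" "i \<noteq> j" and x0: "x0 \<in> unstable_manifold (simplex_field a) (equilibrium j)"
  shows "x0 $ i = 0"
proof -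
  from x0 obtain x where x: "x 0 = x0" "solution (simplex_field a) x {..0}"
    "(x \<longlongrightarrow> equilibrium j) at_bot"
    unfolding unstable_manifold_iff by auto
  obtain r where r: "0 < r" "\<And>y k. dist y (equilibrium j) \<le> r \<Longrightarrow> \<bar>simplex_rate a k y - a j k\<bar> < - a j i"
    using rates_near_equilibrium[of "- a j i" j a] assms(1) by auto
  have "\<forall>\<^sub>F t in at_bot. dist (x t) (equilibrium j) < r" using tendstoD[OF x(3) r(1)] .
  then obtain T0 where T0: "\<And>t. t \<le> T0 \<Longrightarrow> dist (x t) (equilibrium j) < r"
    by (auto simp: eventually_at_bot_linorder)
  define T where "T = min 0 T0"
  have mono: "(x T $ i)\<^sup>2 \<le> (x t $ i)\<^sup>2" if "t \<le> T" for t
  proof -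
    have "(x T $ i)\<^sup>2 \<le> (x t $ i)\<^sup>2 * exp (0 * (T - t))"
    proof (rule exp_growth_bound[OF that])
      fix s assume s: "s \<in> {t..T}"
      have "solution (simplex_field a) x {t..T}"
        by (rule solution_subset[OF x(2)]) (auto simp: T_def)
      from solution_square_derivative[OF this s]
      show "((\<lambda>t. (x t $ i)\<^sup>2) has_real_derivative 2 * simplex_rate a i (x s) * (x s $ i)\<^sup>2) (at s within {t..T})" .
      have "simplex_rate a i (x s) < 0"
        using r(2)[of "x s" i] T0[of s] s by (auto simp: T_def)
      then show "2 * simplex_rate a i (x s) * (x s $ i)\<^sup>2 \<le> 0 * (x s $ i)\<^sup>2"
        by (simp add: mult_nonpos_nonneg)
    qed
    then show ?thesis by simp
  qed
  have "((\<lambda>t. (x t $ i)\<^sup>2) \<longlongrightarrow> (equilibrium j $ i)\<^sup>2) at_bot"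
    by (intro tendsto_power tendsto_vec_nth x(3))
  then have lim: "((\<lambda>t. (x t $ i)\<^sup>2) \<longlongrightarrow> 0) at_bot"
    using assms(2) by (simp add: equilibrium_def axis_def)
  have "\<forall>\<^sub>F t in at_bot. (x T $ i)\<^sup>2 \<le> (x t $ i)\<^sup>2"
    using mono by (rule eventually_at_bot_linorderI)
  then have "(x T $ i)\<^sup>2 \<le> 0"
    by (rule tendsto_lowerbound[OF lim]) simp
  then have "x T $ i = 0" by simp
  moreover obtain m where "x 0 $ i = m * x T $ i"
    using solution_component_multiplier[OF solution_subset[OF x(2)], of T 0 i] by (auto simp: T_def)
  ultimately show ?thesis using x(1) by simp
qed

text \<open>
  The interaction terms cancel in pairs, so that \<open>\<rho> = (norm x)\<^sup>2\<close> satisfies the logistic equation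
  \<open>\<rho>' = 2 * \<rho> * (1 - \<rho>)\<close>.
\<close>

lemma inner_simplex_field_antisymmetric:
  assumes anti: "\<And>i k. i \<in> S \<Longrightarrow> k \<in> S \<Longrightarrow> a i k = - a k i" and off: "\<And>i. i \<notin> S \<Longrightarrow> x $ i = 0"
  shows "x \<bullet> simplex_field a x = (norm x)\<^sup>2 * (1 - (norm x)\<^sup>2)"
proof -
  let ?c = "\<lambda>i k. a k i * (x $ k)\<^sup>2 * (x $ i)\<^sup>2"
  define Z where "Z = (\<Sum>i\<in>UNIV. \<Sum>k\<in>UNIV. ?c i k)"
  have "Z = (\<Sum>k\<in>UNIV. \<Sum>i\<in>UNIV. ?c i k)" unfolding Z_def by (rule sum.swap)
  also have "\<dots> = (\<Sum>k\<in>UNIV. \<Sum>i\<in>UNIV. - ?c k i)"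
  proof (intro sum.cong refl)
    fix i k show "?c i k = - ?c k i"
      using anti[of i k] off[of i] off[of k] by (cases "i \<in> S"; cases "k \<in> S") auto
  qed
  also have "\<dots> = - Z" by (simp add: Z_def sum_negf)
  finally have "Z = 0" by simp
  have "x \<bullet> simplex_field a x = (\<Sum>i\<in>UNIV. (x $ i)\<^sup>2 * (1 - (norm x)\<^sup>2) + (\<Sum>k\<in>UNIV. ?c i k))"
    unfolding inner_vec_def simplex_field_nth simplex_rate_def
    by (intro sum.cong refl) (simp add: power2_eq_square algebra_simps sum_distrib_left)
  also have "\<dots> = (norm x)\<^sup>2 * (1 - (norm x)\<^sup>2) + Z"
    by (simp add: sum.distrib sum_distrib_right[symmetric] norm_square_sum Z_def)
  finally show ?thesis using \<open>Z = 0\<close> by simp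
qed

text \<open>
  For a solution of the logistic equation \<open>(\<rho> - 1)\<^sup>2\<close> is nonincreasing. In backward time \<open>\<rho>\<close> tends to
  \<open>1\<close> on the unstable manifold, so that \<open>(\<rho> - 1)\<^sup>2\<close> is bounded above by its limit \<open>0\<close>.
\<close>

lemma unstable_manifold_on_sphere:
  assumes anti: "\<And>i k. i \<in> S \<Longrightarrow> k \<in> S \<Longrightarrow> a i k = - a k i"
    and x0: "x0 \<in> unstable_manifold (simplex_field a) (equilibrium j)" "x0 \<in> face S"
  shows "norm x0 = 1"
proof -
  from x0 obtain x where x: "x 0 = x0" "solution (simplex_field a) x {..0}"
    "(x \<longlongrightarrow> equilibrium j) at_bot"
    unfolding unstable_manifold_iff by auto
  define \<rho> where "\<rho> t = x t \<bullet> x t" for t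
  define \<phi> where "\<phi> t = (\<rho> t - 1)\<^sup>2" for t
  have xS: "x t \<in> face S" if "t \<le> 0" for t
    using solution_face_iff[OF solution_subset[OF x(2)], of t 0 S] that x(1) x0(2) by auto
  have mono: "\<phi> 0 \<le> \<phi> t" if "t \<le> 0" for t
  proof -
    have "\<phi> 0 \<le> \<phi> t * exp (0 * (0 - t))"
    proof (rule exp_growth_bound[OF that])
      fix s assume s: "s \<in> {t..0}"
      have "solution (simplex_field a) x {t..0}" by (rule solution_subset[OF x(2)]) auto
      then have "(x has_vector_derivative simplex_field a (x s)) (at s within {t..0})"
        using s by (simp add: solution_def)
      then have "(\<rho> has_real_derivative 2 * (x s \<bullet> simplex_field a (x s))) (at s within {t..0})"
        unfolding \<rho>_def by (rule has_real_derivative_inner_self)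
      moreover have "x s \<bullet> simplex_field a (x s) = \<rho> s * (1 - \<rho> s)"
        using inner_simplex_field_antisymmetric[of S a "x s", OF anti] xS[of s] s
        by (simp add: face_def \<rho>_def power2_norm_eq_inner)
      ultimately have "(\<rho> has_real_derivative 2 * (\<rho> s * (1 - \<rho> s))) (at s within {t..0})" by simp
      then show "(\<phi> has_real_derivative - 4 * \<rho> s * \<phi> s) (at s within {t..0})"
        unfolding \<phi>_def by (auto intro!: derivative_eq_intros simp: power2_eq_square algebra_simps)
      have "0 \<le> \<rho> s" "0 \<le> \<phi> s" by (auto simp: \<rho>_def \<phi>_def)
      then show "- 4 * \<rho> s * \<phi> s \<le> 0 * \<phi> s" by simp
    qed
    then show ?thesis by simp
  qed
  have "(\<phi> \<longlongrightarrow> (equilibrium j \<bullet> equilibrium j - 1)\<^sup>2) at_bot"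
    unfolding \<phi>_def \<rho>_def by (intro tendsto_intros x(3))
  then have lim: "(\<phi> \<longlongrightarrow> 0) at_bot" by (simp add: equilibrium_def inner_axis_axis)
  have "\<forall>\<^sub>F t in at_bot. \<phi> 0 \<le> \<phi> t" using mono by (rule eventually_at_bot_linorderI)
  then have "\<phi> 0 \<le> 0" by (rule tendsto_lowerbound[OF lim]) simp
  then have "\<rho> 0 = 1" by (simp add: \<phi>_def)
  then show ?thesis by (simp add: \<rho>_def x(1) norm_eq_1)
qed

text \<open>
  The hypothesis says that \<open>- 2 * k\<close> is the logarithmic derivative of \<open>D\<close>.
\<close>

lemma inverse_sqrt_derivative:
  assumes "(D has_real_derivative - 2 * k * D t) (at t within S)" "0 < D t"
  shows "((\<lambda>t. 1 / sqrt (D t)) has_real_derivative k / sqrt (D t)) (at t within S)"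
proof -
  have "((\<lambda>t. 1 / sqrt (D t)) has_real_derivative
      - ((- 2 * k * D t) * (inverse (sqrt (D t)) / 2)) / (sqrt (D t) * sqrt (D t))) (at t within S)"
    using assms by (auto intro!: derivative_eq_intros)
  moreover have "- ((- 2 * k * (s * s)) * (inverse s / 2)) / (s * s) = k / s" if "0 < s" for s :: real
    using that by (simp add: field_simps)
  from this[of "sqrt (D t)"]
  have "- ((- 2 * k * D t) * (inverse (sqrt (D t)) / 2)) / (sqrt (D t) * sqrt (D t)) = k / sqrt (D t)"
    using assms(2) by simp
  ultimately show ?thesis by metis
qed

text \<open>
  On the unit sphere, with \<open>c \<rightarrow> p\<close>, \<open>c \<rightarrow> q\<close> and \<open>p \<rightarrow> q\<close> of strength one, the squares of the outer
  coordinates decouple: \<open>(x\<^sub>c\<^sup>2)' = - 2 * x\<^sub>c\<^sup>2 * (1 - x\<^sub>c\<^sup>2)\<close> and \<open>(x\<^sub>q\<^sup>2)' = 2 * x\<^sub>q\<^sup>2 * (1 - x\<^sub>q\<^sup>2)\<close>. Both are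
  logistic equations, with explicit solutions, and the remainder \<open>x\<^sub>p\<^sup>2 = 1 - x\<^sub>c\<^sup>2 - x\<^sub>q\<^sup>2\<close> factorises as
  its initial value divided by the two logistic denominators. The choice \<open>p = c\<close> describes the planar
  flow from \<open>\<xi>\<^sub>c\<close> to \<open>\<xi>\<^sub>q\<close>.
\<close>

theorem transitive_flow_converges:
  fixes a :: "'n::finite \<Rightarrow> 'n \<Rightarrow> real"
  assumes diag: "\<And>i. a i i = 0" and "c \<noteq> q" "p \<noteq> q" and cq: "a c q = 1" "a q c = - 1"
    and p: "p \<noteq> c \<Longrightarrow> a c p = 1 \<and> a p c = - 1 \<and> a p q = 1 \<and> a q p = - 1"
    and x0: "x0 \<in> face {c, p, q}" "norm x0 = 1" "0 < x0 $ q"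
  shows "x0 \<in> stable_manifold (simplex_field a) (equilibrium q)"
proof -
  define C Q P where "C = x0 $ c" and "Q = x0 $ q" and "P = (if p = c then 0 else x0 $ p)"
  have CQP: "0 \<le> C" "0 < Q" "0 \<le> P" using x0 by (auto simp: C_def Q_def P_def face_def)
  have face_sum: "(\<Sum>k\<in>UNIV. f k * (y $ k)\<^sup>2) =
      f c * (y $ c)\<^sup>2 + f q * (y $ q)\<^sup>2 + (if p = c then 0 else f p * (y $ p)\<^sup>2)"
    if "\<And>k. k \<notin> {c, p, q} \<Longrightarrow> y $ k = 0" for f and y :: "real^'n"
  proof -
    have "(\<Sum>k\<in>UNIV. f k * (y $ k)\<^sup>2) = (\<Sum>k\<in>{c, p, q}. f k * (y $ k)\<^sup>2)"
      by (rule sum.mono_neutral_right) (use that in auto)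
    then show ?thesis using \<open>c \<noteq> q\<close> \<open>p \<noteq> q\<close> by auto
  qed
  have one: "C\<^sup>2 + Q\<^sup>2 + P\<^sup>2 = 1"
  proof -
    have "(norm x0)\<^sup>2 = (\<Sum>k\<in>UNIV. 1 * (x0 $ k)\<^sup>2)" by (simp add: norm_square_sum)
    also have "\<dots> = C\<^sup>2 + Q\<^sup>2 + P\<^sup>2"
      by (subst face_sum) (use x0(1) in \<open>auto simp: C_def Q_def P_def face_def\<close>)
    finally show ?thesis using x0(2) by simp
  qed
  then have le1: "C\<^sup>2 \<le> 1" "Q\<^sup>2 \<le> 1" using zero_le_power2[of C] zero_le_power2[of Q] zero_le_power2[of P] by linarith+
  \<comment> \<open>The logistic denominators: \<open>x\<^sub>c\<^sup>2 = C\<^sup>2 * exp (- 2 * t) / D t\<close> and \<open>x\<^sub>q\<^sup>2 = Q\<^sup>2 * exp (2 * t) / E t\<close>.\<close>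
  define D E where "D t = 1 - C\<^sup>2 + C\<^sup>2 * exp (- 2 * t)" and "E t = 1 - Q\<^sup>2 + Q\<^sup>2 * exp (2 * t)" for t :: real
  have D: "0 < D t" for t
    unfolding D_def using le1 by (cases "C = 0") (auto intro!: add_nonneg_pos)
  have E: "0 < E t" for t
    unfolding E_def using le1 CQP by (auto intro!: add_nonneg_pos)
  define xc xq xp where "xc t = C * exp (- t) * (1 / sqrt (D t))" and "xq t = Q * exp t * (1 / sqrt (E t))"
    and "xp t = P * (1 / sqrt (D t)) * (1 / sqrt (E t))" for t :: real
  have xc2: "(xc t)\<^sup>2 = C\<^sup>2 * exp (- 2 * t) / D t" for t
    using D[of t] by (simp add: xc_def power_mult_distrib power_divide exp_double[symmetric])
  have xq2: "(xq t)\<^sup>2 = Q\<^sup>2 * exp (2 * t) / E t" for t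
    using E[of t] by (simp add: xq_def power_mult_distrib power_divide exp_double[symmetric])
  have xp2: "(xp t)\<^sup>2 = P\<^sup>2 / (D t * E t)" for t
    using D[of t] E[of t] by (simp add: xp_def power_mult_distrib power_divide)
  have sphere: "(xc t)\<^sup>2 + (xq t)\<^sup>2 + (xp t)\<^sup>2 = 1" for t
  proof -
    have ee: "exp (- 2 * t) * exp (2 * t) = 1" by (simp flip: exp_add)
    have P2: "P\<^sup>2 = 1 - C\<^sup>2 - Q\<^sup>2" using one by simp
    have "C\<^sup>2 * exp (- 2 * t) * E t + Q\<^sup>2 * exp (2 * t) * D t + P\<^sup>2
        = D t * E t + C\<^sup>2 * Q\<^sup>2 * (exp (- 2 * t) * exp (2 * t) - 1)"
      unfolding D_def E_def P2 by (simp add: algebra_simps)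
    then have "C\<^sup>2 * exp (- 2 * t) * E t + Q\<^sup>2 * exp (2 * t) * D t + P\<^sup>2 = D t * E t"
      unfolding ee by simp
    then have "(C\<^sup>2 * exp (- 2 * t) * E t + Q\<^sup>2 * exp (2 * t) * D t + P\<^sup>2) / (D t * E t) = 1"
      using D[of t] E[of t] by simp
    then show ?thesis
      unfolding xc2 xq2 xp2 using D[of t] E[of t] by (simp add: add_divide_distrib)
  qed
  have dD: "((\<lambda>t. 1 / sqrt (D t)) has_real_derivative (xc t)\<^sup>2 / sqrt (D t)) (at t within S)" for t S
  proof (rule inverse_sqrt_derivative[of D, OF _ D])
    have "(D has_real_derivative - 2 * (C\<^sup>2 * exp (- 2 * t))) (at t within S)"
      unfolding D_def by (auto intro!: derivative_eq_intros)
    then show "(D has_real_derivative - 2 * (xc t)\<^sup>2 * D t) (at t within S)"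
      using D[of t] by (simp add: xc2)
  qed
  have dE: "((\<lambda>t. 1 / sqrt (E t)) has_real_derivative - (xq t)\<^sup>2 / sqrt (E t)) (at t within S)" for t S
  proof (rule inverse_sqrt_derivative[of E, OF _ E])
    have "(E has_real_derivative 2 * (Q\<^sup>2 * exp (2 * t))) (at t within S)"
      unfolding E_def by (auto intro!: derivative_eq_intros)
    then show "(E has_real_derivative - 2 * - (xq t)\<^sup>2 * E t) (at t within S)"
      using E[of t] by (simp add: xq2)
  qed
  have dc: "(xc has_real_derivative xc t * ((xc t)\<^sup>2 - 1)) (at t within S)" for t S
    unfolding xc_def by (rule derivative_eq_intros dD refl)+ (simp add: xc_def algebra_simps)
  have dq: "(xq has_real_derivative xq t * (1 - (xq t)\<^sup>2)) (at t within S)" for t S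
    unfolding xq_def by (rule derivative_eq_intros dE refl)+ (simp add: xq_def algebra_simps)
  have dp: "(xp has_real_derivative xp t * ((xc t)\<^sup>2 - (xq t)\<^sup>2)) (at t within S)" for t S
    unfolding xp_def by (rule derivative_eq_intros dD dE refl)+ (simp add: xp_def algebra_simps)
  define x where "x t = (\<chi> i. if i = c then xc t else if i = q then xq t else if i = p then xp t else 0)"
    for t :: real
  have xcp: "x t $ c = xc t" "x t $ q = xq t" "p \<noteq> c \<Longrightarrow> x t $ p = xp t"
      "i \<notin> {c, p, q} \<Longrightarrow> x t $ i = 0" for t i
    using \<open>c \<noteq> q\<close> \<open>p \<noteq> q\<close> by (auto simp: x_def)
  have xp0: "p = c \<Longrightarrow> xp t = 0" for t by (simp add: xp_def P_def)
  have norm1: "(norm (x t))\<^sup>2 = 1" for t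
    using face_sum[of "x t" "\<lambda>_. 1"] xcp xp0 sphere[of t] by (auto simp: norm_square_sum)
  have rate: "simplex_rate a i (x t) = a c i * (xc t)\<^sup>2 + a q i * (xq t)\<^sup>2 + a p i * (xp t)\<^sup>2" for i t
    unfolding simplex_rate_def using face_sum[of "x t" "\<lambda>k. a k i"] xcp xp0 norm1 by auto
  have "solution (simplex_field a) x {0..}"
  proof (rule solution_componentI)
    fix t :: real and i
    consider "i = c" | "i = q" | "i = p" "p \<noteq> c" | "i \<notin> {c, p, q}" by blast
    then show "((\<lambda>t. x t $ i) has_real_derivative x t $ i * simplex_rate a i (x t)) (at t within {0..})"
    proof cases
      case 1
      have "simplex_rate a c (x t) = (xc t)\<^sup>2 - 1"
        using sphere[of t] cq diag p xp0 unfolding rate by (cases "p = c") auto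
      then show ?thesis using 1 dc by (simp add: xcp)
    next
      case 2
      have "simplex_rate a q (x t) = 1 - (xq t)\<^sup>2"
        using sphere[of t] cq diag p xp0 unfolding rate by (cases "p = c") auto
      then show ?thesis using 2 dq by (simp add: xcp)
    next
      case 3
      have "simplex_rate a p (x t) = (xc t)\<^sup>2 - (xq t)\<^sup>2"
        using diag p 3(2) unfolding rate by auto
      then show ?thesis using 3 dp by (simp add: xcp)
    qed (simp add: xcp)
  qed
  moreover have "x 0 = x0"
  proof (rule vec_eq_iff[THEN iffD2, rule_format])
    fix i
    have "D 0 = 1" "E 0 = 1" by (simp_all add: D_def E_def)
    then show "x 0 $ i = x0 $ i"
      using x0(1) by (auto simp: x_def xc_def xq_def xp_def C_def Q_def P_def face_def)
  qed
  moreover have "(x \<longlongrightarrow> equilibrium q) at_top"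
  proof -
    have bound: "(dist (x t) (equilibrium q))\<^sup>2 \<le> 2 / Q\<^sup>2 * exp (- 2 * t)" if "0 \<le> t" for t
    proof -
      have xq01: "0 \<le> xq t" "xq t \<le> 1"
      proof -
        show "0 \<le> xq t" using CQP E[of t] by (simp add: xq_def)
        have "(xq t)\<^sup>2 \<le> 1"
          using sphere[of t] zero_le_power2[of "xc t"] zero_le_power2[of "xp t"] by linarith
        then show "xq t \<le> 1" by (simp add: abs_square_le_1)
      qed
      have "transversal q (x t) = 1 - (xq t)\<^sup>2"
        using norm_square_transversal[of "x t" q] norm1[of t] by (simp add: xcp)
      then have "(dist (x t) (equilibrium q))\<^sup>2 = 2 * (1 - xq t)"
        unfolding dist_equilibrium by (simp add: xcp power2_eq_square algebra_simps)
      also have "\<dots> \<le> 2 * (1 - (xq t)\<^sup>2)"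
        using xq01 mult_left_mono[of "xq t" 1 "xq t"] by (simp add: power2_eq_square)
      also have "1 - (xq t)\<^sup>2 = (1 - Q\<^sup>2) / E t"
        using E[of t] unfolding xq2 by (simp add: field_simps) (simp add: E_def)
      also have "\<dots> \<le> 1 / (Q\<^sup>2 * exp (2 * t))"
        using CQP le1 by (intro frac_le) (auto simp: E_def)
      finally show ?thesis by (simp add: exp_minus field_simps)
    qed
    have "((\<lambda>t. 2 / Q\<^sup>2 * exp (- 2 * t)) \<longlongrightarrow> 2 / Q\<^sup>2 * 0) at_top"
      by (intro tendsto_mult tendsto_const filterlim_compose[OF exp_at_bot]
          filterlim_tendsto_neg_mult_at_bot[OF tendsto_const] filterlim_ident) auto
    then have lim0: "((\<lambda>t. 2 / Q\<^sup>2 * exp (- 2 * t)) \<longlongrightarrow> 0) at_top" by simp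
    show ?thesis
      by (rule tendsto_of_dist_square_le[OF _ lim0])
         (use bound in \<open>auto intro!: eventually_at_top_linorderI[of 0]\<close>)
  qed
  ultimately show ?thesis unfolding stable_manifold_iff by blast
qed

definition unit_coefficients :: "'n pair_pre_digraph \<Rightarrow> 'n \<Rightarrow> 'n \<Rightarrow> real" where
  "unit_coefficients G j i = (if i = j then 0 else if (j, i) \<in> parcs G then 1 else - 1)"

text \<open>
  The unstable manifold of \<open>\<xi>\<^sub>j\<close> lies on the unit sphere and in the face of \<open>j, p, q\<close>, where the flow is
  explicit. Its points converge to \<open>\<xi>\<^sub>q\<close> if \<open>x\<^sub>q > 0\<close>; otherwise they converge to \<open>\<xi>\<^sub>p\<close> if \<open>x\<^sub>p > 0\<close>, and the
  only point with \<open>x\<^sub>p = x\<^sub>q = 0\<close> is \<open>\<xi>\<^sub>j\<close>.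
\<close>

theorem transitive_out_neighbourhoods_complete:
  fixes G :: "'n::finite pair_pre_digraph"
  assumes asym: "\<And>i j. (i, j) \<in> parcs G \<Longrightarrow> i \<noteq> j \<and> (j, i) \<notin> parcs G"
    and out: "\<And>j. \<exists>p q. {i. (j, i) \<in> parcs G} = {p, q} \<and> (p = q \<or> (p, q) \<in> parcs G)"
  shows "complete_simplex_network G (unit_coefficients G)"
  unfolding complete_simplex_network_def
proof (intro allI subsetI)
  fix j x0
  let ?a = "unit_coefficients G" let ?f = "simplex_field ?a"
  assume "x0 \<in> unstable_manifold ?f (equilibrium j) \<inter> orthant"
  then have x0: "x0 \<in> unstable_manifold ?f (equilibrium j)" "x0 \<in> orthant" by auto
  obtain p q where pq: "{i. (j, i) \<in> parcs G} = {p, q}" "p = q \<or> (p, q) \<in> parcs G"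
    using out by blast
  then have edges: "(j, p) \<in> parcs G" "(j, q) \<in> parcs G" and only: "\<And>i. (j, i) \<in> parcs G \<Longrightarrow> i \<in> {p, q}"
    by blast+
  have a1: "?a i k = 1" "?a k i = - 1" if "(i, k) \<in> parcs G" for i k
    using asym[OF that] that by (auto simp: unit_coefficients_def)
  have a0: "?a i i = 0" for i by (simp add: unit_coefficients_def)
  have jpq: "j \<noteq> p" "j \<noteq> q" using asym edges by blast+
  have "x0 $ i = 0" if "i \<notin> {j, p, q}" for i
    by (rule unstable_manifold_component_zero[OF _ _ x0(1)])
       (use that only[of i] in \<open>auto simp: unit_coefficients_def\<close>)
  then have F: "x0 \<in> face {j, p, q}" using x0(2) by (simp add: face_def orthant_def)
  have n1: "norm x0 = 1"
  proof (rule unstable_manifold_on_sphere[OF _ x0(1) F])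
    fix i k assume "i \<in> {j, p, q}" "k \<in> {j, p, q}"
    then show "?a i k = - ?a k i" using a1 a0 edges pq(2) by auto
  qed
  have conn: "x0 \<in> simplex_network G ?a" if "(j, i) \<in> parcs G" "x0 \<in> stable_manifold ?f (equilibrium i)" for i
    using x0 that by (auto simp: simplex_network_def)
  have nonneg: "0 \<le> x0 $ i" for i using F by (simp add: face_def)
  consider "0 < x0 $ q" | "x0 $ q = 0" "p \<noteq> q" "0 < x0 $ p" | "x0 $ q = 0" "x0 $ p = 0"
    using nonneg[of p] nonneg[of q] by fastforce
  then show "x0 \<in> simplex_network G ?a"
  proof cases
    case 1
    have "x0 \<in> stable_manifold ?f (equilibrium q)"
    proof (cases "p = q")
      case True
      then have "x0 \<in> face {j, j, q}" using F by simp
      then show ?thesis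
        by (intro transitive_flow_converges[where c = j and p = j, OF a0 jpq(2,2) a1[OF edges(2)] _ _ n1 1]) simp_all
    next
      case False
      then have "(p, q) \<in> parcs G" using pq(2) by simp
      then show ?thesis
        by (intro transitive_flow_converges[where c = j and p = p, OF a0 jpq(2) False a1[OF edges(2)] _ F n1 1])
           (use a1 edges in auto)
    qed
    then show ?thesis using conn edges by blast
  next
    case 2
    then have "x0 \<in> face {j, j, p}" using F by (auto simp: face_def)
    then have "x0 \<in> stable_manifold ?f (equilibrium p)"
      by (intro transitive_flow_converges[where c = j and p = j, OF a0 jpq(1,1) a1[OF edges(1)] _ _ n1 2(3)]) simp_all
    then show ?thesis using conn edges by blast
  next
    case 3
    then have z: "x0 $ i = 0" if "i \<noteq> j" for i using F that by (auto simp: face_def)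
    then have "transversal j x0 = 0" by (simp add: transversal_def)
    then have "(x0 $ j)\<^sup>2 = 1" using norm_square_transversal[of x0 j] n1 by simp
    then have "x0 $ j = 1" using nonneg[of j] by (simp add: power2_eq_1_iff)
    then have "x0 = equilibrium j" using z by (simp add: vec_eq_iff equilibrium_def axis_def)
    then show ?thesis by (simp add: simplex_network_def)
  qed
qed


section \<open>Digraphs that consist of two cycles\<close>

text \<open>
  A cycle is traversed by a sequence of vertices, of which only the values at \<open>0, \<dots>, k\<close> matter. In
  contrast to a list of arcs, the sequence can start at any vertex of the cycle (\<open>enum_rotate\<close>), and
  its values at \<open>k\<close> and \<open>0\<close> agree, so that the last arc needs no separate treatment.
\<close>

definition cyclic_enum :: "(nat \<Rightarrow> 'a) \<Rightarrow> nat \<Rightarrow> bool" where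
  "cyclic_enum c k \<longleftrightarrow> 0 < k \<and> c k = c 0 \<and> inj_on c {..<k}"

definition enum_arcs :: "(nat \<Rightarrow> 'a) \<Rightarrow> nat \<Rightarrow> ('a \<times> 'a) set" where
  "enum_arcs c k = (\<lambda>i. (c i, c (Suc i))) ` {..<k}"

lemma enum_arcsI: "i < k \<Longrightarrow> (c i, c (Suc i)) \<in> enum_arcs c k"
  by (auto simp: enum_arcs_def)

lemma card_enum_arcs: "cyclic_enum c k \<Longrightarrow> card (enum_arcs c k) = k"
  unfolding cyclic_enum_def enum_arcs_def by (subst card_image) (auto simp: inj_on_def)

lemma enum_arc_unique:
  assumes "cyclic_enum c k" "(c i, y) \<in> enum_arcs c k" "i < k"
  shows "y = c (Suc i)"
  using assms by (auto simp: cyclic_enum_def enum_arcs_def dest: inj_onD)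

lemma cycle_of_enum:
  assumes wf: "pair_wf_digraph G" and c: "cyclic_enum c k" and sub: "enum_arcs c k \<subseteq> parcs G"
  shows "pre_digraph.cycle (with_proj G) (map (\<lambda>i. (c i, c (Suc i))) [0..<k])"
proof -
  interpret pair_wf_digraph G by (rule wf)
  have k: "0 < k" "c k = c 0" "inj_on c {..<k}" using c by (auto simp: cyclic_enum_def)
  let ?p = "\<lambda>m n. map (\<lambda>i. (c i, c (Suc i))) [m..<n]"
  have cas: "pcas (c m) (?p m n) (c n)" if "m \<le> n" for m n
    using that by (induction rule: inc_induct) (auto simp: upt_conv_Cons)
  have verts: "tl (pawalk_verts u (?p 0 k)) = map (\<lambda>i. c (Suc i)) [0..<k]" for u
  proof -
    have "tl (pawalk_verts u (?p m n)) = map (\<lambda>i. c (Suc i)) [m..<n]" if "m \<le> n" for m n u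
      using that
    proof (induction arbitrary: u rule: inc_induct)
      case (step m)
      then show ?case
        by (cases "Suc m < n") (auto simp: upt_conv_Cons)
    qed simp
    then show ?thesis by simp
  qed
  have "distinct (map (\<lambda>i. c (Suc i)) [0..<k])"
  proof -
    have "inj_on (\<lambda>i. c (Suc i)) {..<k}"
    proof (rule inj_onI)
      fix i j assume ij: "i \<in> {..<k}" "j \<in> {..<k}" "c (Suc i) = c (Suc j)"
      show "i = j"
      proof (cases "Suc i < k \<and> Suc j < k")
        case True
        then show ?thesis using ij k(3) by (auto dest: inj_onD)
      next
        case False
        then have "Suc i = k \<or> Suc j = k" using ij by auto
        then show ?thesis
        proof
          assume "Suc i = k"
          then have "c 0 = c (Suc j)" using ij k(2) by simp
          then have "\<not> Suc j < k" using inj_onD[OF k(3), of 0 "Suc j"] k(1) by auto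
          then show ?thesis using ij \<open>Suc i = k\<close> by auto
        next
          assume "Suc j = k"
          then have "c 0 = c (Suc i)" using ij k(2) by simp
          then have "\<not> Suc i < k" using inj_onD[OF k(3), of 0 "Suc i"] k(1) by auto
          then show ?thesis using ij \<open>Suc j = k\<close> by auto
        qed
      qed
    qed
    then show ?thesis by (simp add: distinct_map lessThan_atLeast0)
  qed
  moreover have "c 0 \<in> pverts G"
    using sub k(1) arc_fst_in_verts[of "(c 0, c (Suc 0))"] by (auto simp: enum_arcs_def)
  moreover have "set (?p 0 k) \<subseteq> parcs G" using sub by (auto simp: enum_arcs_def)
  ultimately have "awalk (c 0) (?p 0 k) (c 0)"
    using cas[of 0 k] k by (simp add: awalk_def)
  then show ?thesis
    unfolding cycle_def using verts \<open>distinct _\<close> k(1) by (intro exI[of _ "c 0"]) simp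
qed

lemma enum_of_cycle:
  assumes wf: "pair_wf_digraph G" and p: "pre_digraph.cycle (with_proj G) p"
  shows "\<exists>c. cyclic_enum c (length p) \<and> p = map (\<lambda>i. (c i, c (Suc i))) [0..<length p]"
proof -
  interpret pair_wf_digraph G by (rule wf)
  from p obtain u where u: "awalk u p u" "distinct (tl (pawalk_verts u p))" "p \<noteq> []"
    unfolding cycle_def by auto
  define c where "c i = pawalk_verts u p ! i" for i
  have *: "length (pawalk_verts v q) = Suc (length q) \<and> pawalk_verts v q ! 0 = v \<and>
      pawalk_verts v q ! length q = w \<and>
      q = map (\<lambda>i. (pawalk_verts v q ! i, pawalk_verts v q ! Suc i)) [0..<length q]"
    if "pcas v q w" for v q w
    using that
  proof (induction q arbitrary: v)
    case (Cons e q)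
    then have IH: "length (pawalk_verts (snd e) q) = Suc (length q)" "pawalk_verts (snd e) q ! 0 = snd e"
      "pawalk_verts (snd e) q ! length q = w"
      "q = map (\<lambda>i. (pawalk_verts (snd e) q ! i, pawalk_verts (snd e) q ! Suc i)) [0..<length q]"
      and e: "fst e = v" by auto
    have "map (\<lambda>i. (pawalk_verts v (e # q) ! i, pawalk_verts v (e # q) ! Suc i)) [0..<length (e # q)]
        = e # map (\<lambda>i. (pawalk_verts (snd e) q ! i, pawalk_verts (snd e) q ! Suc i)) [0..<length q]"
      using IH(2) e by (cases e) (simp add: upt_conv_Cons map_Suc_upt[symmetric] o_def del: upt_Suc)
    also have "\<dots> = e # q" using IH(4) by simp
    finally show ?case using IH e by simp
  qed simp
  have cas: "pcas u p u" using u(1) by (simp add: awalk_def)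
  have c: "length (pawalk_verts u p) = Suc (length p)" "c 0 = u" "c (length p) = u"
    "p = map (\<lambda>i. (c i, c (Suc i))) [0..<length p]"
    using *[OF cas] unfolding c_def by blast+
  have inj: "inj_on (\<lambda>i. c (Suc i)) {..<length p}"
    unfolding c_def using u(2) c(1)
    by (auto simp: inj_on_def distinct_conv_nth nth_tl)
  have "inj_on c {..<length p}"
  proof (rule inj_onI)
    fix i j assume ij: "i \<in> {..<length p}" "j \<in> {..<length p}" "c i = c j"
    define s where "s i = (if i = 0 then length p else i)" for i
    have "c (s i) = c (s j)" using ij c by (auto simp: s_def)
    moreover have "s i = Suc (s i - 1)" "s j = Suc (s j - 1)" "s i - 1 < length p" "s j - 1 < length p"
      using ij by (auto simp: s_def)
    ultimately have "s i - 1 = s j - 1" using inj by (metis inj_onD lessThan_iff)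
    then show "i = j" using ij by (auto simp: s_def split: if_splits)
  qed
  then show ?thesis using c u(3) unfolding cyclic_enum_def by (metis length_greater_0_conv)
qed

lemma enum_rotate:
  assumes c: "cyclic_enum c k" and "m < k"
  shows "\<exists>c'. cyclic_enum c' k \<and> c' 0 = c m \<and> enum_arcs c' k = enum_arcs c k"
proof -
  from c have k: "0 < k" "c k = c 0" "inj_on c {..<k}" by (auto simp: cyclic_enum_def)
  define c' where "c' i = c ((m + i) mod k)" for i
  have "inj_on c' {..<k}"
  proof (rule inj_onI)
    fix i j assume ij: "i \<in> {..<k}" "j \<in> {..<k}" "c' i = c' j"
    then have "(m + i) mod k = (m + j) mod k"
      using k by (auto simp: c'_def dest!: inj_onD)
    then show "i = j"
      using ij \<open>m < k\<close> by (auto simp: mod_if split: if_splits)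
  qed
  moreover have "c' k = c' 0" by (simp add: c'_def)
  ultimately have enum: "cyclic_enum c' k" using k by (simp add: cyclic_enum_def)
  have sub: "enum_arcs c' k \<subseteq> enum_arcs c k"
  proof
    fix e assume "e \<in> enum_arcs c' k"
    then obtain i where "e = (c' i, c' (Suc i))" by (auto simp: enum_arcs_def)
    moreover define n where "n = (m + i) mod k"
    have "n < k" using k by (simp add: n_def)
    have "c' (Suc i) = c (Suc n)"
    proof (cases "Suc n = k")
      case True
      then have "(m + Suc i) mod k = 0" by (simp add: n_def mod_Suc)
      then show ?thesis using True k by (simp add: c'_def)
    next
      case False
      then have "(m + Suc i) mod k = Suc n" by (simp add: n_def mod_Suc)
      then show ?thesis by (simp add: c'_def)
    qed
    ultimately show "e \<in> enum_arcs c k" using \<open>n < k\<close> by (auto simp: enum_arcs_def c'_def n_def)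
  qed
  have "enum_arcs c' k = enum_arcs c k"
    by (rule card_subset_eq[OF _ sub]) (simp_all add: card_enum_arcs enum c, simp add: enum_arcs_def)
  moreover have "c' 0 = c m" using \<open>m < k\<close> by (simp add: c'_def)
  ultimately show ?thesis using enum by blast
qed

lemma no_short_cycles_asym:
  assumes "simplex_digraph G" "(x, y) \<in> parcs G"
  shows "x \<noteq> y \<and> (y, x) \<notin> parcs G"
proof -
  have wf: "pair_wf_digraph G" using assms(1) by (simp add: simplex_digraph_def vertex_digraph_def)
  have short: "\<not> pre_digraph.cycle (with_proj G) p" if "length p = 1 \<or> length p = 2" for p
    using assms(1) that by (auto simp: simplex_digraph_def)
  have ne: "x \<noteq> y"
  proof
    assume "x = y"
    then have "cyclic_enum (\<lambda>_. x) 1" "enum_arcs (\<lambda>_. x) 1 \<subseteq> parcs G"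
      using assms(2) by (auto simp: cyclic_enum_def enum_arcs_def inj_on_def)
    from cycle_of_enum[OF wf this] show False using short by simp
  qed
  moreover have "(y, x) \<notin> parcs G"
  proof
    assume "(y, x) \<in> parcs G"
    then have "cyclic_enum (\<lambda>i. if i = 1 then y else x) 2" "enum_arcs (\<lambda>i. if i = 1 then y else x) 2 \<subseteq> parcs G"
      using assms(2) ne by (auto simp: cyclic_enum_def enum_arcs_def inj_on_def less_2_cases_iff)
    from cycle_of_enum[OF wf this] show False using short by simp
  qed
  ultimately show ?thesis ..
qed

text \<open>
  Two cycles that separate at their common starting vertex and meet again, if at all before
  returning to it, in the last vertex of both.
\<close>

definition fork :: "(nat \<Rightarrow> 'a) \<Rightarrow> nat \<Rightarrow> (nat \<Rightarrow> 'a) \<Rightarrow> nat \<Rightarrow> bool" where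
  "fork c k d l \<longleftrightarrow> cyclic_enum c k \<and> cyclic_enum d l \<and> c 0 = d 0 \<and> c 1 \<noteq> d 1 \<and>
     (\<forall>i j. 1 \<le> i \<longrightarrow> i < k \<longrightarrow> 1 \<le> j \<longrightarrow> j < l \<longrightarrow> c i = d j \<longrightarrow> Suc i = k \<and> Suc j = l)"

text \<open>
  Otherwise no arc would lead from the vertices of one cycle to those of the other, in either
  direction, and the digraph would not be connected.
\<close>

lemma cycles_intersect:
  assumes two: "consists_of_two_cycles G C D"
    and c: "cyclic_enum c k" "set C = enum_arcs c k" and d: "cyclic_enum d l" "set D = enum_arcs d l"
  shows "\<exists>i<k. \<exists>j<l. c i = d j"
proof (rule ccontr)
  assume "\<not> ?thesis"
  then have disj: "c ` {..<k} \<inter> d ` {..<l} = {}" by auto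
  from c d have k: "0 < k" "c k = c 0" "0 < l" "d l = d 0" by (auto simp: cyclic_enum_def)
  have Cv: "x \<in> c ` {..<k} \<and> y \<in> c ` {..<k}" if xy: "(x, y) \<in> set C" for x y
  proof -
    obtain i where i: "i < k" "x = c i" "y = c (Suc i)" using xy c(2) by (auto simp: enum_arcs_def)
    then have "y = c (if Suc i = k then 0 else Suc i)" using k by auto
    then show ?thesis using i k by (auto split: if_splits)
  qed
  have Dv: "x \<in> d ` {..<l} \<and> y \<in> d ` {..<l}" if xy: "(x, y) \<in> set D" for x y
  proof -
    obtain i where i: "i < l" "x = d i" "y = d (Suc i)" using xy d(2) by (auto simp: enum_arcs_def)
    then have "y = d (if Suc i = l then 0 else Suc i)" using k by auto
    then show ?thesis using i k by (auto split: if_splits)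
  qed
  have "(c 0, c 1) \<in> set C" "(d 0, d 1) \<in> set D" using c(2) d(2) k by (auto simp: enum_arcs_def)
  moreover have "pverts G = fst ` set C \<union> fst ` set D"
    and conn: "Digraph_Component.connected (with_proj G)" and arcs: "parcs G = set C \<union> set D"
    using two unfolding consists_of_two_cycles_def by blast+
  ultimately have "c 0 \<in> pverts G" "d 0 \<in> pverts G" by force+
  with conn have "(c 0, d 0) \<in> rtrancl_on (pverts G) ((parcs G)\<^sup>s)"
    unfolding connected_conv by simp
  then have "(c 0, d 0) \<in> ((parcs G)\<^sup>s)\<^sup>*" by (rule rtrancl_on_rtranclI)
  then have "d 0 \<in> c ` {..<k}"
  proof (induction rule: rtrancl_induct)
    case base
    show ?case using k by auto
  next
    case (step y z)
    have "(y, z) \<in> set C \<union> set D \<or> (z, y) \<in> set C \<union> set D"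
      using step(2) arcs by (auto simp: symcl_def)
    then show ?case using step(3) Cv Dv disj by blast
  qed
  then show False using disj k by auto
qed

text \<open>
  Following the first cycle from the vertex of separation to its next common vertex and then the
  second cycle home gives a cycle that contains the arc \<open>(c 0, c 1)\<close>, which is not on the second
  cycle. So it is the first cycle, and all the arcs on the way home are common to both cycles. As at
  most one arc is common, the vertex met is the last one of both cycles.
\<close>

lemma two_cycles_fork:
  assumes wf: "pair_wf_digraph G" and two: "consists_of_two_cycles G C D"
    and shared: "card (set C \<inter> set D) \<le> 1"
  shows "\<exists>c d. fork c (length C) d (length D) \<and> set C = enum_arcs c (length C) \<and>
    set D = enum_arcs d (length D)"
proof -
  define k l where "k = length C" and "l = length D"
  have cyc: "pre_digraph.cycle (with_proj G) C" "pre_digraph.cycle (with_proj G) D"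
    and ne: "set C \<noteq> set D" and arcs: "parcs G = set C \<union> set D"
    and only: "\<And>p. pre_digraph.cycle (with_proj G) p \<Longrightarrow> set p = set C \<or> set p = set D"
    using two unfolding consists_of_two_cycles_def by blast+
  have ex: "\<exists>c. cyclic_enum c (length p) \<and> set p = enum_arcs c (length p)"
    if "pre_digraph.cycle (with_proj G) p" for p
  proof -
    from enum_of_cycle[OF wf that] obtain c where c: "cyclic_enum c (length p)"
      "p = map (\<lambda>i. (c i, c (Suc i))) [0..<length p]" by blast
    have "set p = enum_arcs c (length p)"
      by (subst c(2)) (simp add: enum_arcs_def lessThan_atLeast0)
    then show ?thesis using c(1) by blast
  qed
  obtain c0 where c0: "cyclic_enum c0 k" "set C = enum_arcs c0 k" using ex[OF cyc(1)] k_def by blast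
  obtain d0 where d0: "cyclic_enum d0 l" "set D = enum_arcs d0 l" using ex[OF cyc(2)] l_def by blast
  obtain m n where mn: "m < k" "n < l" "c0 m = d0 n"
    using cycles_intersect[OF two c0 d0] by blast
  \<comment> \<open>If the successors agreed at all common vertices, then the two cycles would coincide.\<close>
  have "\<exists>v x y. (v, x) \<in> set C \<and> (v, y) \<in> set D \<and> x \<noteq> y"
  proof (rule ccontr)
    assume "\<not> ?thesis"
    then have same: "x = y" if "(v, x) \<in> set C" "(v, y) \<in> set D" for v x y using that by blast
    obtain c where c: "cyclic_enum c k" "c 0 = c0 m" "enum_arcs c k = set C"
      using enum_rotate[OF c0(1) mn(1)] c0(2) by auto
    obtain d where d: "cyclic_enum d l" "d 0 = d0 n" "enum_arcs d l = set D"
      using enum_rotate[OF d0(1) mn(2)] d0(2) by auto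
    have eq: "c i = d i" if "i \<le> min k l" for i
      using that
    proof (induction i)
      case (Suc i)
      have "(c i, c (Suc i)) \<in> enum_arcs c k" "(d i, d (Suc i)) \<in> enum_arcs d l"
        using Suc.prems by (auto intro!: enum_arcsI)
      then have "(c i, c (Suc i)) \<in> set C" "(d i, d (Suc i)) \<in> set D"
        using c(3) d(3) by auto
      moreover have "c i = d i" using Suc by simp
      ultimately show ?case using same[of "c i"] by simp
    qed (use c d mn in simp)
    have kl: "0 < k" "0 < l" "c k = c 0" "d l = d 0" "inj_on c {..<k}" "inj_on d {..<l}"
      using c d by (auto simp: cyclic_enum_def)
    have "k = l"
    proof (rule ccontr)
      assume "k \<noteq> l"
      then consider "k < l" | "l < k" by linarith
      then show False
      proof cases
        case 1
        then have "d k = d 0" using eq[of k] eq[of 0] kl by auto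
        then show False using inj_onD[OF kl(6), of k 0] 1 kl by auto
      next
        case 2
        then have "c l = c 0" using eq[of l] eq[of 0] kl by auto
        then show False using inj_onD[OF kl(5), of l 0] 2 kl by auto
      qed
    qed
    then have "enum_arcs c k = enum_arcs d l"
      using eq unfolding enum_arcs_def by (intro image_cong) auto
    then show False using ne c(3) d(3) by simp
  qed
  then obtain v x y where v: "(v, x) \<in> set C" "(v, y) \<in> set D" "x \<noteq> y" by blast
  from v(1) c0(2) obtain m' where m': "m' < k" "v = c0 m'" by (auto simp: enum_arcs_def)
  from v(2) d0(2) obtain n' where n': "n' < l" "v = d0 n'" by (auto simp: enum_arcs_def)
  obtain c where c: "cyclic_enum c k" "c 0 = v" "enum_arcs c k = set C"
    using enum_rotate[OF c0(1) m'(1)] c0(2) m'(2) by auto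
  obtain d where d: "cyclic_enum d l" "d 0 = v" "enum_arcs d l = set D"
    using enum_rotate[OF d0(1) n'(1)] d0(2) n'(2) by auto
  have kl: "0 < k" "0 < l" "c k = c 0" "d l = d 0" "inj_on c {..<k}" "inj_on d {..<l}"
    using c d by (auto simp: cyclic_enum_def)
  have "x = c 1" "y = d 1"
    using enum_arc_unique[OF c(1), of 0 x] enum_arc_unique[OF d(1), of 0 y] v c d kl by auto
  then have c1d1: "c 1 \<noteq> d 1" using v(3) by simp
  have notD: "(c 0, c 1) \<notin> set D"
    using enum_arc_unique[OF d(1), of 0 "c 1"] c d kl c1d1 by auto
  have last: "Suc i = k \<and> Suc j = l" if ij: "1 \<le> i" "i < k" "1 \<le> j" "j < l" "c i = d j" for i j
  proof -
    define meets where "meets i \<longleftrightarrow> 1 \<le> i \<and> i < k \<and> c i \<in> d ` {1..<l}" for i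
    define i0 where "i0 = (LEAST i. meets i)"
    have "meets i" using ij by (auto simp: meets_def)
    then have i0: "meets i0" and least: "\<And>m. m < i0 \<Longrightarrow> \<not> meets m"
      unfolding i0_def by (auto intro: LeastI dest: not_less_Least)
    have "i0 \<le> i" using \<open>meets i\<close> unfolding i0_def by (rule Least_le)
    obtain j0 where j0: "1 \<le> j0" "j0 < l" "c i0 = d j0" using i0 by (auto simp: meets_def)
    have i01: "1 \<le> i0" "i0 < k" using i0 by (auto simp: meets_def)
    define e where "e m = (if m < i0 then c m else d (j0 + (m - i0)))" for m
    define n where "n = i0 + (l - j0)"
    have e_c: "e m = c m" if "m \<le> i0" for m using that j0 by (cases "m = i0") (auto simp: e_def)
    have e_d: "e (i0 + m) = d (j0 + m)" for m by (simp add: e_def)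
    have cross: "c a \<noteq> d b" if "a < i0" "1 \<le> b" "b < l" for a b
    proof (cases "a = 0")
      case True
      then show ?thesis using that c(2) d(2) kl inj_onD[OF kl(6), of 0 b] by auto
    next
      case False
      then show ?thesis using least[OF that(1)] that i01 by (auto simp: meets_def)
    qed
    have inj: "inj_on e {..<n}"
    proof (rule inj_onI)
      fix a b assume ab: "a \<in> {..<n}" "b \<in> {..<n}" "e a = e b"
      consider "a < i0" "b < i0" | "a < i0" "i0 \<le> b" | "i0 \<le> a" "b < i0" | "i0 \<le> a" "i0 \<le> b"
        by linarith
      then show "a = b"
      proof cases
        case 1
        then show ?thesis using ab(3) inj_onD[OF kl(5), of a b] i01 by (auto simp: e_def)
      next
        case 2
        then have "e a = c a" "e b = d (j0 + (b - i0))" by (auto simp: e_def)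
        moreover have "j0 + (b - i0) < l" "1 \<le> j0 + (b - i0)" using 2 ab j0 by (auto simp: n_def)
        ultimately show ?thesis using ab(3) cross[OF 2(1)] by metis
      next
        case 3
        then have "e b = c b" "e a = d (j0 + (a - i0))" by (auto simp: e_def)
        moreover have "j0 + (a - i0) < l" "1 \<le> j0 + (a - i0)" using 3 ab j0 by (auto simp: n_def)
        ultimately show ?thesis using ab(3) cross[OF 3(2)] by metis
      next
        case 4
        then have "e a = d (j0 + (a - i0))" "e b = d (j0 + (b - i0))" by (auto simp: e_def)
        moreover have "j0 + (a - i0) < l" "j0 + (b - i0) < l" using 4 ab j0 by (auto simp: n_def)
        ultimately have "j0 + (a - i0) = j0 + (b - i0)" using ab(3) kl(6) by (auto dest: inj_onD)
        then show ?thesis using 4 by simp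
      qed
    qed
    have "e n = e 0"
      using e_d[of "l - j0"] e_c[of 0] j0 kl c(2) d(2) by (simp add: n_def)
    then have enum: "cyclic_enum e n" using inj i01 by (simp add: cyclic_enum_def n_def)
    have cpart: "(e a, e (Suc a)) \<in> set C" if "a < i0" for a
      using that e_c[of a] e_c[of "Suc a"] enum_arcsI[of a k c] i01 unfolding c(3) by simp
    have dpart: "(e (i0 + m), e (Suc (i0 + m))) = (d (j0 + m), d (Suc (j0 + m)))" for m
      using e_d[of m] e_d[of "Suc m"] by simp
    have dpartD: "(d (j0 + m), d (Suc (j0 + m))) \<in> set D" if "m < l - j0" for m
      using that enum_arcsI[of "j0 + m" l d] unfolding d(3) by simp
    have sub: "enum_arcs e n \<subseteq> parcs G"
    proof
      fix z assume "z \<in> enum_arcs e n"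
      then obtain a where a: "a < n" "z = (e a, e (Suc a))" by (auto simp: enum_arcs_def)
      show "z \<in> parcs G"
      proof (cases "a < i0")
        case True
        then show ?thesis using cpart a arcs by auto
      next
        case False
        then obtain m where "a = i0 + m" "m < l - j0" using a by (auto simp: n_def le_iff_add not_less)
        then show ?thesis using dpart dpartD a arcs by auto
      qed
    qed
    have setmap: "set (map (\<lambda>i. (e i, e (Suc i))) [0..<n]) = enum_arcs e n"
      by (simp add: enum_arcs_def lessThan_atLeast0)
    have "(c 0, c 1) \<in> enum_arcs e n"
      using e_c[of 0] e_c[of 1] i01 by (force simp: enum_arcs_def n_def)
    then have eC: "enum_arcs e n = set C"
      using only[OF cycle_of_enum[OF wf enum sub]] notD unfolding setmap by blast
    then have "n = k" using card_enum_arcs[OF enum] card_enum_arcs[OF c(1)] c(3) by simp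
    have "(\<lambda>m. (d (j0 + m), d (Suc (j0 + m)))) ` {..<l - j0} \<subseteq> set C \<inter> set D"
    proof
      fix z assume "z \<in> (\<lambda>m. (d (j0 + m), d (Suc (j0 + m)))) ` {..<l - j0}"
      then obtain m where m: "m < l - j0" "z = (d (j0 + m), d (Suc (j0 + m)))" by auto
      then have "z \<in> enum_arcs e n"
        unfolding enum_arcs_def using dpart[of m] by (intro image_eqI[of _ _ "i0 + m"]) (auto simp: n_def)
      then show "z \<in> set C \<inter> set D" using eC m dpartD by auto
    qed
    then have "card ((\<lambda>m. (d (j0 + m), d (Suc (j0 + m)))) ` {..<l - j0}) \<le> 1"
      using card_mono[of "set C \<inter> set D"] shared by (meson List.finite_set finite_Int order_trans)
    moreover have "inj_on (\<lambda>m. (d (j0 + m), d (Suc (j0 + m)))) {..<l - j0}"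
    proof (rule inj_onI)
      fix a b assume "a \<in> {..<l - j0}" "b \<in> {..<l - j0}"
        "(d (j0 + a), d (Suc (j0 + a))) = (d (j0 + b), d (Suc (j0 + b)))"
      then show "a = b" using inj_onD[OF kl(6), of "j0 + a" "j0 + b"] by auto
    qed
    ultimately have "l - j0 \<le> 1" by (simp add: card_image)
    then have "Suc j0 = l" "Suc i0 = k" using j0 \<open>n = k\<close> by (auto simp: n_def)
    moreover have "i = i0" using \<open>i0 \<le> i\<close> \<open>Suc i0 = k\<close> ij by simp
    moreover have "j = j0" using \<open>i = i0\<close> ij j0 inj_onD[OF kl(6), of j j0] by auto
    ultimately show ?thesis by simp
  qed
  have "c 0 = d 0" using c(2) d(2) by simp
  then have "fork c k d l"
    unfolding fork_def using c(1) d(1) c1d1 last by blast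
  moreover have "set C = enum_arcs c k" "set D = enum_arcs d l" using c(3) d(3) by simp_all
  ultimately show ?thesis unfolding k_def l_def by blast
qed


section \<open>The number of added edges\<close>

definition adjacent :: "('a \<times> 'a) set \<Rightarrow> 'a \<Rightarrow> 'a \<Rightarrow> bool" where
  "adjacent A x y \<longleftrightarrow> (x, y) \<in> A \<or> (y, x) \<in> A"

lemma fork_sym:
  assumes "fork c k d l" shows "fork d l c k"
proof -
  have "Suc i = l \<and> Suc j = k" if "1 \<le> i" "i < l" "1 \<le> j" "j < k" "d i = c j" for i j
    using assms that(1-4) that(5)[symmetric] unfolding fork_def by blast
  moreover have "cyclic_enum d l" "cyclic_enum c k" "d 0 = c 0" "d 1 \<noteq> c 1"
    using assms unfolding fork_def by metis+
  ultimately show ?thesis unfolding fork_def by blast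
qed

lemma fork_facts:
  assumes "fork c k d l"
  shows "0 < k" "0 < l" "c k = c 0" "d l = c 0" "d 0 = c 0" "inj_on c {..<k}" "inj_on d {..<l}"
    and "\<And>i. 1 \<le> i \<Longrightarrow> i < k \<Longrightarrow> c i \<noteq> c 0" and "\<And>j. 1 \<le> j \<Longrightarrow> j < l \<Longrightarrow> d j \<noteq> c 0"
    and "\<And>i j. 1 \<le> i \<Longrightarrow> i < k \<Longrightarrow> 1 \<le> j \<Longrightarrow> j < l \<Longrightarrow> c i = d j \<Longrightarrow> Suc i = k \<and> Suc j = l"
    and "cyclic_enum c k" "cyclic_enum d l" "c 1 \<noteq> d 1"
proof -
  show enum: "cyclic_enum c k" "cyclic_enum d l" "c 1 \<noteq> d 1" and d0: "d 0 = c 0"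
    using assms unfolding fork_def by metis+
  show k: "0 < k" "0 < l" "c k = c 0" "d l = c 0" "inj_on c {..<k}" "inj_on d {..<l}"
    using enum(1,2) d0 by (auto simp: cyclic_enum_def)
  show "c i \<noteq> c 0" if "1 \<le> i" "i < k" for i using inj_onD[OF k(5), of i 0] that by auto
  show "d j \<noteq> c 0" if "1 \<le> j" "j < l" for j using inj_onD[OF k(6), of j 0] that d0 by auto
  show "Suc i = k \<and> Suc j = l" if "1 \<le> i" "i < k" "1 \<le> j" "j < l" "c i = d j" for i j
    using assms that unfolding fork_def by blast
qed

text \<open>
  An arc of the first cycle leads from \<open>c i\<close> to \<open>c (Suc i)\<close>, which can only be some \<open>d j\<close> if it is the
  common last vertex. An arc of the second cycle that starts at \<open>c i\<close> starts at the common last vertex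
  and so leads to \<open>c 0\<close>.
\<close>

lemma fork_arc_half:
  assumes f: "fork c k d l" and ij: "1 \<le> i" "i < k" "1 \<le> j" "j < l"
    and arc: "(c i, d j) \<in> enum_arcs c k \<union> enum_arcs d l"
  shows "Suc (Suc i) = k \<and> Suc j = l"
proof -
  note ff = fork_facts[OF f]
  from arc show ?thesis
  proof
    assume "(c i, d j) \<in> enum_arcs c k"
    then have "d j = c (Suc i)" using enum_arc_unique[OF ff(11) _ ij(2)] by blast
    moreover have "Suc i \<noteq> k" using ff(3) ff(9)[OF ij(3,4)] calculation by auto
    ultimately show ?thesis using ff(10)[of "Suc i" j] ij by auto
  next
    assume "(c i, d j) \<in> enum_arcs d l"
    then obtain m where m: "m < l" "c i = d m" "d j = d (Suc m)" by (auto simp: enum_arcs_def)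
    have "m \<noteq> 0" using m ff(5) ff(8)[OF ij(1,2)] by metis
    then have "Suc m = l" using ff(10)[of i m] m ij by auto
    then show ?thesis using m ff(4) ff(9)[OF ij(3,4)] by auto
  qed
qed

text \<open>
  So the only pairs across the branches that are joined already are those of the common last vertex,
  if it exists, with its two predecessors.
\<close>

lemma fork_adjacent:
  assumes f: "fork c k d l" and ij: "1 \<le> i" "i < k" "1 \<le> j" "j < l"
    and adj: "adjacent (enum_arcs c k \<union> enum_arcs d l) (c i) (d j)"
  shows "Suc (Suc i) = k \<and> Suc j = l \<or> Suc i = k \<and> Suc (Suc j) = l"
  using adj fork_arc_half[OF f ij] fork_arc_half[OF fork_sym[OF f] ij(3,4,1,2)]
  by (auto simp: adjacent_def Un_commute)

text \<open>
  \<open>S\<close> records the pairs of indices visited on the way from \<open>(1, 1)\<close> to \<open>(i, j)\<close>, in steps that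
  increase one index by one. Before the end of the path neither index has reached its last value.
\<close>

definition staircase ::
  "('a \<times> 'a) set \<Rightarrow> (nat \<Rightarrow> 'a) \<Rightarrow> nat \<Rightarrow> (nat \<Rightarrow> 'a) \<Rightarrow> nat \<Rightarrow> nat \<Rightarrow> nat \<Rightarrow> (nat \<times> nat) set \<Rightarrow> bool" where
  "staircase A c k d l i j S \<longleftrightarrow>
     1 \<le> i \<and> i < k \<and> 1 \<le> j \<and> j < l \<and> (Suc i < k \<or> Suc j < l) \<and>
     finite S \<and> (i, j) \<in> S \<and> card S = i + j - 1 \<and>
     (\<forall>u\<in>S. 1 \<le> fst u \<and> fst u \<le> i \<and> 1 \<le> snd u \<and> snd u \<le> j \<and>
        adjacent A (c (fst u)) (d (snd u)) \<and> (u = (i, j) \<or> Suc (fst u) < k \<and> Suc (snd u) < l))"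

lemma staircase_extend:
  assumes st: "staircase A c k d l i j S" and less: "Suc i < k" "Suc j < l"
    and next': "(i', j') = (Suc i, j) \<or> (i', j') = (i, Suc j)" and adj: "adjacent A (c i') (d j')"
  shows "staircase A c k d l i' j' (insert (i', j') S)"
proof -
  have S: "finite S" "(i, j) \<in> S" "card S = i + j - 1" "1 \<le> i" "1 \<le> j"
    and el: "\<And>u. u \<in> S \<Longrightarrow> 1 \<le> fst u \<and> fst u \<le> i \<and> 1 \<le> snd u \<and> snd u \<le> j \<and>
      adjacent A (c (fst u)) (d (snd u)) \<and> (u = (i, j) \<or> Suc (fst u) < k \<and> Suc (snd u) < l)"
    using st unfolding staircase_def by blast+
  have "(i', j') \<notin> S" using el[of "(i', j')"] next' by auto
  then have card: "card (insert (i', j') S) = i' + j' - 1" using S next' by auto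
  have "1 \<le> fst u \<and> fst u \<le> i' \<and> 1 \<le> snd u \<and> snd u \<le> j' \<and>
      adjacent A (c (fst u)) (d (snd u)) \<and> (u = (i', j') \<or> Suc (fst u) < k \<and> Suc (snd u) < l)"
    if "u \<in> insert (i', j') S" for u
  proof (cases "u = (i', j')")
    case True
    then show ?thesis using adj next' S by auto
  next
    case False
    then have "u \<in> S" using that by simp
    from el[OF this] have "Suc (fst u) < k \<and> Suc (snd u) < l" using less by auto
    moreover have "i \<le> i'" "j \<le> j'" using next' by auto
    ultimately show ?thesis using el[OF \<open>u \<in> S\<close>] by linarith
  qed
  moreover have "1 \<le> i'" "i' < k" "1 \<le> j'" "j' < l" "Suc i' < k \<or> Suc j' < l"
    using next' S less by auto
  ultimately show ?thesis using S card unfolding staircase_def by blast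
qed

lemma staircase_exists:
  assumes f: "fork c k d l" and "3 \<le> k" "3 \<le> l"
    and sub: "enum_arcs c k \<union> enum_arcs d l \<subseteq> A"
    and adj: "\<And>x y z. (x, y) \<in> A \<Longrightarrow> (x, z) \<in> A \<Longrightarrow> y \<noteq> z \<Longrightarrow> adjacent A y z"
  shows "\<exists>i j S. staircase A c k d l i j S \<and> (i + j = n + 2 \<or> Suc i = k \<or> Suc j = l)"
proof (induction n)
  case 0
  have "c 1 \<noteq> d 1" "d 0 = c 0" using fork_facts[OF f] by metis+
  moreover have "(c 0, c 1) \<in> A" "(d 0, d 1) \<in> A"
    using sub enum_arcsI[of 0 k c] enum_arcsI[of 0 l d] assms(2,3) by auto
  ultimately have "adjacent A (c 1) (d 1)" using adj by metis
  then have "staircase A c k d l 1 1 {(1, 1)}" using assms(2,3) by (simp add: staircase_def)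
  then show ?case by (metis one_add_one add_0)
next
  case (Suc n)
  then obtain i j S where st: "staircase A c k d l i j S"
    and tot: "i + j = n + 2 \<or> Suc i = k \<or> Suc j = l"
    by blast
  then have ij: "1 \<le> i" "i < k" "1 \<le> j" "j < l" unfolding staircase_def by blast+
  show ?case
  proof (cases "Suc i = k \<or> Suc j = l")
    case True
    then show ?thesis using st by blast
  next
    case False
    then have less: "Suc i < k" "Suc j < l" and sum: "i + j = n + 2" using ij tot by auto
    have "adjacent A (c (fst (i, j))) (d (snd (i, j)))" using st unfolding staircase_def by blast
    then have "adjacent A (c i) (d j)" by simp
    then consider "(c i, d j) \<in> A" | "(d j, c i) \<in> A" by (auto simp: adjacent_def)
    then show ?thesis
    proof cases
      case 1
      have "(c i, c (Suc i)) \<in> A" using sub enum_arcsI[OF ij(2), of c] by blast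
      moreover have "c (Suc i) \<noteq> d j" using fork_facts(10)[OF f, of "Suc i" j] less ij by auto
      ultimately have "adjacent A (c (Suc i)) (d j)" using adj 1 by blast
      then have "staircase A c k d l (Suc i) j (insert (Suc i, j) S)"
        by (intro staircase_extend[OF st less]) simp_all
      moreover have "Suc i + j = Suc n + 2" using sum by simp
      ultimately show ?thesis by blast
    next
      case 2
      have "(d j, d (Suc j)) \<in> A" using sub enum_arcsI[OF ij(4), of d] by blast
      moreover have "c i \<noteq> d (Suc j)" using fork_facts(10)[OF f, of i "Suc j"] less ij by auto
      ultimately have "adjacent A (c i) (d (Suc j))" using adj 2 by blast
      then have "staircase A c k d l i (Suc j) (insert (i, Suc j) S)"
        by (intro staircase_extend[OF st less]) simp_all
      moreover have "i + Suc j = Suc n + 2" using sum by simp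
      ultimately show ?thesis by blast
    qed
  qed
qed

text \<open>
  Run the staircase until one of the indices is maximal. All its pairs are joined by new arcs except
  possibly the last one, and distinct pairs need distinct arcs. If the last pair is not new, then by
  \<open>fork_adjacent\<close> the staircase is long: \<open>i + j = k + l - 3\<close>, and \<open>k + l - 5 \<ge> k - 1\<close> since \<open>l > 3\<close>.
\<close>

theorem fork_added_arcs_lower_bound:
  assumes f: "fork c k d l" and k: "3 \<le> k" "k \<le> l" "3 < l"
    and sub: "enum_arcs c k \<union> enum_arcs d l \<subseteq> A" and "finite A"
    and adj: "\<And>x y z. (x, y) \<in> A \<Longrightarrow> (x, z) \<in> A \<Longrightarrow> y \<noteq> z \<Longrightarrow> adjacent A y z"
  shows "k - 1 \<le> card (A - (enum_arcs c k \<union> enum_arcs d l))"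
proof -
  let ?B = "enum_arcs c k \<union> enum_arcs d l"
  have "\<exists>i j S. staircase A c k d l i j S \<and> (i + j = (k + l) + 2 \<or> Suc i = k \<or> Suc j = l)"
    by (rule staircase_exists[OF f _ _ sub]) (use k adj in auto)
  then obtain i j S where st: "staircase A c k d l i j S"
    and "i + j = (k + l) + 2 \<or> Suc i = k \<or> Suc j = l"
    by blast
  then have ij: "1 \<le> i" "i < k" "1 \<le> j" "j < l" and stop: "Suc i = k \<or> Suc j = l"
    and corner: "Suc i < k \<or> Suc j < l"
    and S: "(i, j) \<in> S" "finite S" "card S = i + j - 1"
    unfolding staircase_def by (blast, blast, blast, blast, linarith, blast+)
  have el: "1 \<le> i' \<and> i' < k \<and> 1 \<le> j' \<and> j' < l \<and> adjacent A (c i') (d j') \<and>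
      ((i', j') = (i, j) \<or> Suc i' < k \<and> Suc j' < l)" if "(i', j') \<in> S" for i' j'
  proof -
    have "1 \<le> fst u \<and> fst u \<le> i \<and> 1 \<le> snd u \<and> snd u \<le> j \<and>
        adjacent A (c (fst u)) (d (snd u)) \<and> (u = (i, j) \<or> Suc (fst u) < k \<and> Suc (snd u) < l)"
      if "u \<in> S" for u using st that unfolding staircase_def by blast
    from this[OF that] show ?thesis using ij by simp
  qed
  have range: "1 \<le> i' \<and> i' < k \<and> 1 \<le> j' \<and> j' < l \<and> (Suc i' < k \<or> Suc j' < l)"
    if "(i', j') \<in> S" for i' j'
    using el[OF that] corner by auto
  define N where "N = {(i', j')\<in>S. \<not> adjacent ?B (c i') (d j')}"
  define \<phi> where "\<phi> = (\<lambda>(i', j'). if (c i', d j') \<in> A then (c i', d j') else (d j', c i'))"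
  have "inj_on \<phi> N"
  proof (rule inj_onI)
    fix u w assume "u \<in> N" "w \<in> N" and eq: "\<phi> u = \<phi> w"
    then obtain i1 j1 i2 j2 where u: "u = (i1, j1)" "(i1, j1) \<in> S" and w: "w = (i2, j2)" "(i2, j2) \<in> S"
      by (auto simp: N_def)
    have "c i1 = c i2 \<and> d j1 = d j2 \<or> c i1 = d j2 \<and> d j1 = c i2"
      using eq by (auto simp: \<phi>_def u w split: if_splits)
    then show "u = w"
    proof
      assume "c i1 = c i2 \<and> d j1 = d j2"
      then show ?thesis
        using fork_facts(6,7)[OF f] range[OF u(2)] range[OF w(2)] unfolding u w by (auto dest: inj_onD)
    next
      assume "c i1 = d j2 \<and> d j1 = c i2"
      then have "Suc i1 = k" "Suc j1 = l"
        using fork_facts(10)[OF f, of i1 j2] fork_facts(10)[OF f, of i2 j1] range[OF u(2)] range[OF w(2)]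
        by auto
      then show ?thesis using range[OF u(2)] by simp
    qed
  qed
  moreover have "\<phi> ` N \<subseteq> A - ?B"
  proof
    fix z assume "z \<in> \<phi> ` N"
    then obtain i' j' where S': "(i', j') \<in> S" and new: "\<not> adjacent ?B (c i') (d j')"
      and z: "z = \<phi> (i', j')"
      by (auto simp: N_def)
    have "adjacent A (c i') (d j')" using el[OF S'] by blast
    then show "z \<in> A - ?B" using new unfolding z \<phi>_def adjacent_def by auto
  qed
  ultimately have "card N \<le> card (A - ?B)"
    using \<open>finite A\<close> by (metis card_inj_on_le finite_Diff)
  moreover have "k - 1 \<le> card N"
  proof (cases "adjacent ?B (c i) (d j)")
    case False
    have "\<not> adjacent ?B (c i') (d j')" if "(i', j') \<in> S" for i' j'
      using False fork_adjacent[OF f, of i' j'] el[OF that] by auto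
    then have "N = S" by (auto simp: N_def)
    then show ?thesis using S stop ij k by auto
  next
    case True
    have "\<not> adjacent ?B (c i') (d j')" if "(i', j') \<in> S" "(i', j') \<noteq> (i, j)" for i' j'
      using that(2) fork_adjacent[OF f, of i' j'] el[OF that(1)] by auto
    then have "S - {(i, j)} \<subseteq> N" by (auto simp: N_def)
    moreover have "finite N" using S(2) by (auto simp: N_def intro: finite_subset[of _ S])
    ultimately have "card S - 1 \<le> card N" using card_mono[of N "S - {(i, j)}"] S by simp
    then show ?thesis using S fork_adjacent[OF f ij True] k by auto
  qed
  ultimately show ?thesis by linarith
qed

lemma strongly_connected_fork:
  fixes G :: "'n::finite pair_pre_digraph"
  assumes f: "fork c k d l" and G: "pverts G = UNIV" "enum_arcs c k \<union> enum_arcs d l \<subseteq> parcs G"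
    and cover: "c ` {..<k} \<union> d ` {..<l} = UNIV"
  shows "strongly_connected (with_proj G)"
proof -
  note ff = fork_facts[OF f]
  let ?R = "rtrancl_on UNIV (parcs G)"
  have step: "(e i, e j) \<in> ?R" if "i \<le> j" "j \<le> n" "enum_arcs e n \<subseteq> parcs G" for e :: "nat \<Rightarrow> 'n" and i j n
    using that
  proof (induction j rule: dec_induct)
    case (step j)
    then show ?case
      using enum_arcsI[of j n e] by (auto intro: rtrancl_on_into_rtrancl_on)
  qed simp
  have "(c 0, x) \<in> ?R \<and> (x, c 0) \<in> ?R" for x
  proof -
    have "x \<in> c ` {..<k} \<union> d ` {..<l}" using cover by simp
    then show ?thesis
    proof
      assume "x \<in> c ` {..<k}"
      then obtain i where "i < k" "x = c i" by auto
      then show ?thesis using step[of 0 i k c] step[of i k k c] G(2) ff(3) by auto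
    next
      assume "x \<in> d ` {..<l}"
      then obtain i where "i < l" "x = d i" by auto
      then show ?thesis using step[of 0 i l d] step[of i l l d] G(2) ff(4,5) by auto
    qed
  qed
  then have "(x, y) \<in> ?R" for x y by (meson rtrancl_on_trans)
  then show ?thesis using G(1) by (auto simp: strongly_connected_def reachable_def)
qed

lemma enum_vertices: "fst ` enum_arcs c k = c ` {..<k}"
  by (auto simp: enum_arcs_def image_image)

lemma asym_no_short_cycles:
  assumes wf: "pair_wf_digraph G" and asym: "\<And>x y. (x, y) \<in> parcs G \<Longrightarrow> x \<noteq> y \<and> (y, x) \<notin> parcs G"
    and p: "pre_digraph.cycle (with_proj G) p"
  shows "length p \<noteq> 1 \<and> length p \<noteq> 2"
proof -
  obtain c where c: "cyclic_enum c (length p)" "p = map (\<lambda>i. (c i, c (Suc i))) [0..<length p]"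
    using enum_of_cycle[OF wf p] by blast
  have "set p \<subseteq> parcs G"
  proof -
    interpret pair_wf_digraph G by (rule wf)
    show ?thesis using p unfolding cycle_def by (auto simp: awalk_def)
  qed
  then have arc: "(c i, c (Suc i)) \<in> parcs G" if "i < length p" for i
    using that by (subst (asm) c(2)) auto
  have "c (length p) = c 0" "0 < length p" using c(1) by (auto simp: cyclic_enum_def)
  then show ?thesis
    using arc[of 0] arc[of 1] asym[of "c 0" "c 0"] asym[of "c 0" "c 1"]
    by (metis One_nat_def Suc_1 one_less_numeral_iff semiring_norm(76))
qed

text \<open>
  With \<open>w = d 1\<close> this joins every vertex of the first cycle to the first vertex of the second branch;
  the arc from \<open>c 0\<close> to \<open>d 1\<close> belongs to the second cycle already.
\<close>

definition shortcut_digraph :: "(nat \<Rightarrow> 'n) \<Rightarrow> nat \<Rightarrow> 'n \<Rightarrow> 'n pair_pre_digraph \<Rightarrow> 'n pair_pre_digraph" where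
  "shortcut_digraph c k w G = \<lparr>pverts = pverts G, parcs = parcs G \<union> (\<lambda>i. (c i, w)) ` {1..<k}\<rparr>"

theorem proposition3p1:
  fixes G :: "'n::finite pair_pre_digraph"
    and C D :: "('n \<times> 'n) list"
    and k l :: nat
  assumes "vertex_digraph G"
    and "consists_of_two_cycles G C D"
    and "length C = k" and "length D = l"
    and "3 \<le> k" and "k \<le> l" and "3 < l"
    and "card (set C \<inter> set D) \<le> 1"
  shows "(\<exists>G'. has_complete_realisation G G' \<and> card (parcs G') - card (parcs G) = k - 1) \<and>
         (\<forall>G'. has_complete_realisation G G' \<longrightarrow> k - 1 \<le> card (parcs G') - card (parcs G))"
proof -
  have wf: "pair_wf_digraph G" and V: "pverts G = UNIV"
    using assms(1) by (auto simp: vertex_digraph_def)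
  obtain c d where f: "fork c k d l" and CD: "set C = enum_arcs c k" "set D = enum_arcs d l"
    using two_cycles_fork[OF wf assms(2,8)] assms(3,4) by auto
  note ff = fork_facts[OF f]
  have enum: "cyclic_enum c k" "cyclic_enum d l" by (rule ff)+
  have arcs: "parcs G = enum_arcs c k \<union> enum_arcs d l"
    and cover: "UNIV = c ` {..<k} \<union> d ` {..<l}"
    and only: "\<And>p. pre_digraph.cycle (with_proj G) p \<Longrightarrow> set p = enum_arcs c k \<or> set p = enum_arcs d l"
    using assms(2) V enum_vertices[of c k] enum_vertices[of d l] CD
    unfolding consists_of_two_cycles_def by auto
  have short: "length p \<noteq> 1 \<and> length p \<noteq> 2" if "pre_digraph.cycle (with_proj G) p" for p
    using only[OF that] card_enum_arcs[OF enum(1)] card_enum_arcs[OF enum(2)] card_length[of p] assms(5-7)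
    by auto
  have simplexG: "simplex_digraph G"
    using assms(1) strongly_connected_fork[OF f V] arcs cover short by (auto simp: simplex_digraph_def)
  have lower: "k - 1 \<le> card (parcs G') - card (parcs G)" if G': "has_complete_realisation G G'" for G'
  proof -
    from G' obtain a where sG': "simplex_digraph G'" and sub: "parcs G \<subseteq> parcs G'"
      and a: "simplex_coefficients G' a" "complete_simplex_network G' a"
      by (auto simp: has_complete_realisation_def)
    have "adjacent (parcs G') y z" if "(x, y) \<in> parcs G'" "(x, z) \<in> parcs G'" "y \<noteq> z" for x y z
      using complete_out_neighbours_adjacent[OF a that] no_short_cycles_asym[OF sG' that(1)]
        no_short_cycles_asym[OF sG' that(2)] by (auto simp: adjacent_def)
    then have "k - 1 \<le> card (parcs G' - (enum_arcs c k \<union> enum_arcs d l))"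
      using sub arcs by (intro fork_added_arcs_lower_bound[OF f assms(5-7)]) auto
    also have "\<dots> = card (parcs G') - card (parcs G)"
      unfolding arcs[symmetric] by (rule card_Diff_subset[OF _ sub]) simp
    finally show ?thesis .
  qed
  define G' where "G' = shortcut_digraph c k (d 1) G"
  have V': "pverts G' = UNIV" using V by (simp add: G'_def shortcut_digraph_def)
  have arcs': "parcs G' = parcs G \<union> (\<lambda>i. (c i, d 1)) ` {1..<k}"
    by (simp add: G'_def shortcut_digraph_def)
  have sub: "parcs G \<subseteq> parcs G'" by (auto simp: arcs')
  have wf': "pair_wf_digraph G'" by unfold_locales (simp_all add: V')
  have notadj: "\<not> adjacent (parcs G) (c i) (d 1)" if "1 \<le> i" "i < k" for i
    using fork_adjacent[OF f that, of 1] assms(7) arcs by auto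
  have ne: "c i \<noteq> d 1" if "i < k" for i
  proof (cases "i = 0")
    case True
    then show ?thesis using ff(9)[of 1] assms(7) by auto
  next
    case False
    then show ?thesis using ff(10)[of i 1] that assms(7) by auto
  qed
  have asymG: "x \<noteq> y \<and> (y, x) \<notin> parcs G" if "(x, y) \<in> parcs G" for x y
    by (rule no_short_cycles_asym[OF simplexG that])
  have asym': "x \<noteq> y \<and> (y, x) \<notin> parcs G'" if "(x, y) \<in> parcs G'" for x y
    using that asymG notadj ne unfolding arcs' adjacent_def by fastforce
  have simplexG': "simplex_digraph G'"
    using wf' V' strongly_connected_fork[OF f V'] arcs sub cover asym_no_short_cycles[OF wf' asym']
    by (auto simp: simplex_digraph_def vertex_digraph_def)
  have coeff: "simplex_coefficients G' (unit_coefficients G')"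
    by (simp add: simplex_coefficients_def unit_coefficients_def)
  \<comment> \<open>The out-neighbours of \<open>c i\<close> are its successor and \<open>d 1\<close>, and the successor is itself joined to
    \<open>d 1\<close>; a vertex on the second cycle only has a single out-neighbour.\<close>
  have out: "\<exists>p q. {i. (j, i) \<in> parcs G'} = {p, q} \<and> (p = q \<or> (p, q) \<in> parcs G')" for j
  proof (cases "j \<in> c ` {..<k}")
    case True
    then obtain i where i: "i < k" "j = c i" by auto
    have to_d1: "(c m, d 1) \<in> parcs G'" if "m \<le> k" for m
    proof (cases "1 \<le> m \<and> m < k")
      case True
      then show ?thesis by (auto simp: arcs')
    next
      case False
      then have "m = 0 \<or> m = k" using that by auto
      then have "c m = d 0" using ff(3,5) by auto
      then show ?thesis using enum_arcsI[of 0 l d] ff(2) arcs sub by auto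
    qed
    have succ: "(c i, c (Suc i)) \<in> parcs G'" using enum_arcsI[OF i(1), of c] arcs sub by auto
    have "y = c (Suc i) \<or> y = d 1" if y: "(c i, y) \<in> parcs G'" for y
    proof -
      consider "(c i, y) \<in> enum_arcs c k" | "(c i, y) \<in> enum_arcs d l" | "y = d 1"
        using y arcs by (auto simp: arcs')
      then show ?thesis
      proof cases
        case 1
        then show ?thesis using enum_arc_unique[OF enum(1) _ i(1)] by blast
      next
        case 2
        then obtain m where m: "m < l" "c i = d m" "y = d (Suc m)" by (auto simp: enum_arcs_def)
        show ?thesis
        proof (cases "m = 0")
          case False
          then have "c i \<noteq> c 0" using m ff(9)[of m] by auto
          then have "i \<noteq> 0" by metis
          then have "Suc i = k" "Suc m = l" using ff(10)[of i m] i m False by auto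
          then show ?thesis using m ff(3,4) by auto
        qed (use m in simp)
      qed simp
    qed
    then have "{y. (j, y) \<in> parcs G'} = {c (Suc i), d 1}" using succ to_d1[of i] i by auto
    moreover have "(c (Suc i), d 1) \<in> parcs G'" using to_d1[of "Suc i"] i by simp
    ultimately show ?thesis by blast
  next
    case False
    then obtain m where m: "m < l" "j = d m" using cover by blast
    have "y = d (Suc m)" if "(j, y) \<in> parcs G'" for y
    proof -
      have "(j, y) \<in> enum_arcs d l"
        using that False unfolding arcs' arcs by (auto simp: enum_arcs_def)
      then show ?thesis using enum_arc_unique[OF enum(2)] m by blast
    qed
    moreover have "(j, d (Suc m)) \<in> parcs G'" using enum_arcsI[OF m(1), of d] m arcs sub by auto
    ultimately have "{y. (j, y) \<in> parcs G'} = {d (Suc m), d (Suc m)}" by blast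
    then show ?thesis by blast
  qed
  have "complete_simplex_network G' (unit_coefficients G')"
    by (rule transitive_out_neighbourhoods_complete[OF asym' out])
  then have "has_complete_realisation G G'"
    using simplexG simplexG' sub coeff by (auto simp: has_complete_realisation_def)
  moreover have "card (parcs G') - card (parcs G) = k - 1"
  proof -
    have "parcs G \<inter> (\<lambda>i. (c i, d 1)) ` {1..<k} = {}"
      using notadj by (auto simp: adjacent_def)
    then have "card (parcs G') = card (parcs G) + card ((\<lambda>i. (c i, d 1)) ` {1..<k})"
      unfolding arcs' by (intro card_Un_disjoint) auto
    also have "card ((\<lambda>i. (c i, d 1)) ` {1..<k}) = k - 1"
      using ff(6) by (subst card_image) (auto simp: inj_on_def)
    finally show ?thesis by simp
  qed
  ultimately show ?thesis using lower by blast
qed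

end
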